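(* Let $(\mathcal V,\otimes,I)$ be a cocomplete closed symmetric monoidal category for which the relevant relative tensor products exist, and let $G$ be a group. There is a biequivalence of bicategories $$\mathbf{Mod}(\mathcal V)^G\simeq\mathbf{Mod}(\mathcal V)^{G\text{-tw}}.$$
   Context: **Bimodules.** For monoids $A,B,C$ in $\mathcal V$, an $(A,B)$-bimodule $M$ is regarded as a 1-cell $M\colon A\to B$; for $N$ a $(B,C)$-bimodule, $M\odot N=M\odot_BN\colon A\to C$ is the relative tensor product; the unit 1-cell is $U_A=A$. Left and right actions are denoted $\lambda,\rho$. A $G$-monoid is a pair $(A,\alpha)$, $A$ a monoid in $\mathcal V$ and $\alpha\colon G\to\mathrm{Aut}_{\mathrm{Mon}(\mathcal V)}(A)$, $g\mapsto\alpha_g$, a group homomorphism. **$\mathbf{Mod}(\mathcal V)^G$.** 0-cells: $G$-monoids. A 1-cell $(A,\alpha)\to(B,\beta)$ is a pair $(M,\phi)$ with $M$ an $(A,B)$-bimodule and $\phi=\{\phi_g\}_{g\in G}$ automorphisms $\phi_g\colon M\to M$ in $\mathcal V$ such that $\phi_e=\mathrm{id}$, $\phi_{gh}=\phi_g\phi_h$, $\phi_g\circ\lambda=\lambda\circ(\alpha_g\otimes\phi_g)$ and $\phi_g\circ\rho=\rho\circ(\phi_g\otimes\beta_g)$. A 2-cell $(M,\phi)\Rightarrow(N,\psi)$ is a bimodule map $f$ with $f\phi_g=\psi_gf$ for all $g$. Composition: $M\odot_BN$ with the automorphisms induced by $\phi_g\otimes\psi_g$; unit: $A$ with $\{\alpha_g\}$;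 associators and unitors from bimodules. **$\mathbf{Mod}(\mathcal V)^{G\text{-tw}}$.** For a $G$-monoid $(A,\alpha)$ and $g\in G$ let $\Theta_A(g)=A^g$ be the $(A,A)$-bimodule $A$ with the standard left action and right action twisted by $\alpha_g$; there are canonical base-change isomorphisms $\mu^A_{g,h}\colon A^g\odot_AA^h\cong A^{gh}$ and $\eta^A\colon A\cong A^e$, making $\Theta_A$ a strong monoidal functor from $G$ (discrete monoidal category) to invertible $(A,A)$-bimodules. 0-cells: $G$-monoids. A 1-cell $(A,\alpha)\to(B,\beta)$ is $(M,\tau)$ with $M$ an $(A,B)$-bimodule and bimodule isomorphisms $\tau_g\colon A^g\odot_AM\to M\odot_BB^g$, $g\in G$, such that (up to suppressed associators and unitors) $M\cong A\odot_AM\xrightarrow{\eta^A}A^e\odot_AM\xrightarrow{\tau_e}M\odot_BB^e\xrightarrow{(\eta^B)^{-1}}M\odot_BB\cong M$ is the identity and $\tau_{gh}=(\mathrm{id}_M\odot\mu^B_{g,h})(\tau_g\odot\mathrm{id})(\mathrm{id}\odot\tau_h)((\mu^A_{g,h})^{-1}\odot\mathrm{id}_M)$. A 2-cell $(M,\tau)\Rightarrow(N,\sigma)$ is a bimodule map $f$ with $\sigma_g(\mathrm{id}\odot f)=(f\odot\mathrm{id})\tau_g$ for all $g$. Composition: $M\odot_BN$ with $(\tau\star\sigma)_g=(\mathrm{id}_M\odot\sigma_g)(\tau_g\odot\mathrm{id}_N)$; unit: $A$ with the canonical isomorphisms $A^g\odot_AA\cong A^g\cong A\odot_AA^g$; associators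 and unitors from bimodules. *)

theory Defs
  imports "HOL-Algebra.Group" "HOL-Library.Infinite_Typeclass"
begin

section \<open>Categories and functors\<close>

record ('o, 'a) category =
  Obj :: "'o set"
  Arr :: "'a set"
  Dom :: "'a \<Rightarrow> 'o"
  Cod :: "'a \<Rightarrow> 'o"
  Ident :: "'o \<Rightarrow> 'a"
  Comp :: "'a \<Rightarrow> 'a \<Rightarrow> 'a"  (infixr "\<cdot>\<index>" 55)

text \<open>Composition is in applicative order: \<open>g \<cdot> f\<close> is \<open>f\<close> followed by \<open>g\<close>.\<close>

definition Hom :: "('o, 'a, 'm) category_scheme \<Rightarrow> 'o \<Rightarrow> 'o \<Rightarrow> 'a set" where
  "Hom C X Y = {f \<in> Arr C. Dom C f = X \<and> Cod C f = Y}"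

locale category =
  fixes C :: "('o, 'a, 'm) category_scheme" (structure)
  assumes dom_in: "f \<in> Arr C \<Longrightarrow> Dom C f \<in> Obj C"
    and cod_in: "f \<in> Arr C \<Longrightarrow> Cod C f \<in> Obj C"
    and ident_in: "X \<in> Obj C \<Longrightarrow> Ident C X \<in> Hom C X X"
    and comp_in: "\<lbrakk>f \<in> Hom C X Y; g \<in> Hom C Y Z\<rbrakk> \<Longrightarrow> g \<cdot> f \<in> Hom C X Z"
    and comp_ident: "f \<in> Hom C X Y \<Longrightarrow> f \<cdot> Ident C X = f"
    and ident_comp: "f \<in> Hom C X Y \<Longrightarrow> Ident C Y \<cdot> f = f"
    and comp_assoc: "\<lbrakk>f \<in> Hom C W X; g \<in> Hom C X Y; h \<in> Hom C Y Z\<rbrakk>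
      \<Longrightarrow> (h \<cdot> g) \<cdot> f = h \<cdot> (g \<cdot> f)"

definition inverse_pair :: "('o, 'a, 'm) category_scheme \<Rightarrow> 'a \<Rightarrow> 'a \<Rightarrow> bool" where
  "inverse_pair C f g \<longleftrightarrow> f \<in> Arr C \<and> g \<in> Hom C (Cod C f) (Dom C f)
     \<and> g \<cdot>\<^bsub>C\<^esub> f = Ident C (Dom C f) \<and> f \<cdot>\<^bsub>C\<^esub> g = Ident C (Cod C f)"

definition invertible :: "('o, 'a, 'm) category_scheme \<Rightarrow> 'a \<Rightarrow> bool" where
  "invertible C f \<longleftrightarrow> (\<exists>g. inverse_pair C f g)"

definition inverse_of :: "('o, 'a, 'm) category_scheme \<Rightarrow> 'a \<Rightarrow> 'a" where
  "inverse_of C f = (THE g. inverse_pair C f g)"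

definition is_functor ::
  "('o, 'a, 'm) category_scheme \<Rightarrow> ('p, 'b, 'n) category_scheme
     \<Rightarrow> ('o \<Rightarrow> 'p) \<Rightarrow> ('a \<Rightarrow> 'b) \<Rightarrow> bool" where
  "is_functor C D Fo Fa \<longleftrightarrow> category C \<and> category D
     \<and> (\<forall>X \<in> Obj C. Fo X \<in> Obj D \<and> Fa (Ident C X) = Ident D (Fo X))
     \<and> (\<forall>f \<in> Arr C. Fa f \<in> Hom D (Fo (Dom C f)) (Fo (Cod C f)))
     \<and> (\<forall>f \<in> Arr C. \<forall>g \<in> Arr C. Dom C g = Cod C f \<longrightarrow> Fa (g \<cdot>\<^bsub>C\<^esub> f) = Fa g \<cdot>\<^bsub>D\<^esub> Fa f)"

definition natural_iso ::
  "('o, 'a, 'm) category_scheme \<Rightarrow> ('p, 'b, 'n) category_scheme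
     \<Rightarrow> ('o \<Rightarrow> 'p) \<Rightarrow> ('a \<Rightarrow> 'b) \<Rightarrow> ('o \<Rightarrow> 'p) \<Rightarrow> ('a \<Rightarrow> 'b) \<Rightarrow> ('o \<Rightarrow> 'b) \<Rightarrow> bool" where
  "natural_iso C D Fo Fa Ho Ha \<eta> \<longleftrightarrow>
     (\<forall>X \<in> Obj C. \<eta> X \<in> Hom D (Fo X) (Ho X) \<and> invertible D (\<eta> X))
     \<and> (\<forall>f \<in> Arr C. Ha f \<cdot>\<^bsub>D\<^esub> \<eta> (Dom C f) = \<eta> (Cod C f) \<cdot>\<^bsub>D\<^esub> Fa f)"

definition equivalence_functor ::
  "('o, 'a, 'm) category_scheme \<Rightarrow> ('p, 'b, 'n) category_scheme
     \<Rightarrow> ('o \<Rightarrow> 'p) \<Rightarrow> ('a \<Rightarrow> 'b) \<Rightarrow> bool" where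
  "equivalence_functor C D Fo Fa \<longleftrightarrow> is_functor C D Fo Fa
     \<and> (\<exists>Ho Ha \<eta> \<epsilon>. is_functor D C Ho Ha
          \<and> natural_iso C C (\<lambda>X. X) (\<lambda>f. f) (Ho \<circ> Fo) (Ha \<circ> Fa) \<eta>
          \<and> natural_iso D D (Fo \<circ> Ho) (Fa \<circ> Ha) (\<lambda>X. X) (\<lambda>f. f) \<epsilon>)"


section \<open>Colimits\<close>

definition cocone ::
  "('j, 'k, 'n) category_scheme \<Rightarrow> ('o, 'a, 'm) category_scheme
     \<Rightarrow> ('j \<Rightarrow> 'o) \<Rightarrow> ('k \<Rightarrow> 'a) \<Rightarrow> 'o \<Rightarrow> ('j \<Rightarrow> 'a) \<Rightarrow> bool" where
  "cocone J C Do Da X \<kappa> \<longleftrightarrow> X \<in> Obj C \<and> (\<forall>j \<in> Obj J. \<kappa> j \<in> Hom C (Do j) X)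
     \<and> (\<forall>u \<in> Arr J. \<kappa> (Cod J u) \<cdot>\<^bsub>C\<^esub> Da u = \<kappa> (Dom J u))"

definition is_colimit ::
  "('j, 'k, 'n) category_scheme \<Rightarrow> ('o, 'a, 'm) category_scheme
     \<Rightarrow> ('j \<Rightarrow> 'o) \<Rightarrow> ('k \<Rightarrow> 'a) \<Rightarrow> 'o \<Rightarrow> ('j \<Rightarrow> 'a) \<Rightarrow> bool" where
  "is_colimit J C Do Da X \<kappa> \<longleftrightarrow> cocone J C Do Da X \<kappa>
     \<and> (\<forall>Y c. cocone J C Do Da Y c
          \<longrightarrow> (\<exists>!h. h \<in> Hom C X Y \<and> (\<forall>j \<in> Obj J. h \<cdot>\<^bsub>C\<^esub> \<kappa> j = c j)))"

text \<open>The type \<open>'i\<close> plays the role of the universe of small sets: index categories are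
  those whose objects and arrows form subsets of \<open>'i\<close>.\<close>

definition cocomplete :: "'i::infinite itself \<Rightarrow> ('o, 'a, 'm) category_scheme \<Rightarrow> bool" where
  "cocomplete _ C \<longleftrightarrow> (\<forall>(J :: ('i, 'i) category) Do Da. is_functor J C Do Da
     \<longrightarrow> (\<exists>X \<kappa>. is_colimit J C Do Da X \<kappa>))"

definition is_coequalizer ::
  "('o, 'a, 'm) category_scheme \<Rightarrow> 'a \<Rightarrow> 'a \<Rightarrow> 'o \<Rightarrow> 'a \<Rightarrow> bool" where
  "is_coequalizer C f g P q \<longleftrightarrow> q \<in> Hom C (Cod C f) P \<and> q \<cdot>\<^bsub>C\<^esub> f = q \<cdot>\<^bsub>C\<^esub> g
     \<and> (\<forall>k \<in> Arr C. Dom C k = Cod C f \<and> k \<cdot>\<^bsub>C\<^esub> f = k \<cdot>\<^bsub>C\<^esub> g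
          \<longrightarrow> (\<exists>!h. h \<in> Hom C P (Cod C k) \<and> h \<cdot>\<^bsub>C\<^esub> q = k))"


section \<open>Closed symmetric monoidal categories\<close>

record ('o, 'a) monoidal_category = "('o, 'a) category" +
  tens_obj :: "'o \<Rightarrow> 'o \<Rightarrow> 'o"  (infixr "\<boxtimes>\<index>" 70)
  tens :: "'a \<Rightarrow> 'a \<Rightarrow> 'a"  (infixr "\<^bold>\<otimes>\<index>" 70)
  unit_obj :: "'o"
  asc :: "'o \<Rightarrow> 'o \<Rightarrow> 'o \<Rightarrow> 'a"
  lun :: "'o \<Rightarrow> 'a"
  run :: "'o \<Rightarrow> 'a"
  braid :: "'o \<Rightarrow> 'o \<Rightarrow> 'a"

locale symmetric_monoidal_category = category V
  for V :: "('o, 'a) monoidal_category" (structure) +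
  assumes unit_obj_in: "unit_obj V \<in> Obj V"
    and tens_obj_in: "\<lbrakk>X \<in> Obj V; Y \<in> Obj V\<rbrakk> \<Longrightarrow> X \<boxtimes> Y \<in> Obj V"
    and tens_in: "\<lbrakk>f \<in> Hom V X X'; g \<in> Hom V Y Y'\<rbrakk> \<Longrightarrow> f \<^bold>\<otimes> g \<in> Hom V (X \<boxtimes> Y) (X' \<boxtimes> Y')"
    and tens_ident: "\<lbrakk>X \<in> Obj V; Y \<in> Obj V\<rbrakk> \<Longrightarrow> Ident V X \<^bold>\<otimes> Ident V Y = Ident V (X \<boxtimes> Y)"
    and tens_comp: "\<lbrakk>f \<in> Hom V X X'; f' \<in> Hom V X' X''; g \<in> Hom V Y Y'; g' \<in> Hom V Y' Y''\<rbrakk>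
      \<Longrightarrow> (f' \<cdot> f) \<^bold>\<otimes> (g' \<cdot> g) = (f' \<^bold>\<otimes> g') \<cdot> (f \<^bold>\<otimes> g)"
    and asc_in: "\<lbrakk>X \<in> Obj V; Y \<in> Obj V; Z \<in> Obj V\<rbrakk>
      \<Longrightarrow> asc V X Y Z \<in> Hom V ((X \<boxtimes> Y) \<boxtimes> Z) (X \<boxtimes> (Y \<boxtimes> Z))"
    and asc_iso: "\<lbrakk>X \<in> Obj V; Y \<in> Obj V; Z \<in> Obj V\<rbrakk> \<Longrightarrow> invertible V (asc V X Y Z)"
    and asc_nat: "\<lbrakk>f \<in> Hom V X X'; g \<in> Hom V Y Y'; h \<in> Hom V Z Z'\<rbrakk>
      \<Longrightarrow> asc V X' Y' Z' \<cdot> ((f \<^bold>\<otimes> g) \<^bold>\<otimes> h) = (f \<^bold>\<otimes> (g \<^bold>\<otimes> h)) \<cdot> asc V X Y Z"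
    and lun_in: "X \<in> Obj V \<Longrightarrow> lun V X \<in> Hom V (unit_obj V \<boxtimes> X) X"
    and lun_iso: "X \<in> Obj V \<Longrightarrow> invertible V (lun V X)"
    and lun_nat: "f \<in> Hom V X Y \<Longrightarrow> lun V Y \<cdot> (Ident V (unit_obj V) \<^bold>\<otimes> f) = f \<cdot> lun V X"
    and run_in: "X \<in> Obj V \<Longrightarrow> run V X \<in> Hom V (X \<boxtimes> unit_obj V) X"
    and run_iso: "X \<in> Obj V \<Longrightarrow> invertible V (run V X)"
    and run_nat: "f \<in> Hom V X Y \<Longrightarrow> run V Y \<cdot> (f \<^bold>\<otimes> Ident V (unit_obj V)) = f \<cdot> run V X"
    and braid_in: "\<lbrakk>X \<in> Obj V; Y \<in> Obj V\<rbrakk> \<Longrightarrow> braid V X Y \<in> Hom V (X \<boxtimes> Y) (Y \<boxtimes> X)"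
    and braid_nat: "\<lbrakk>f \<in> Hom V X X'; g \<in> Hom V Y Y'\<rbrakk>
      \<Longrightarrow> braid V X' Y' \<cdot> (f \<^bold>\<otimes> g) = (g \<^bold>\<otimes> f) \<cdot> braid V X Y"
    and symmetry: "\<lbrakk>X \<in> Obj V; Y \<in> Obj V\<rbrakk> \<Longrightarrow> braid V Y X \<cdot> braid V X Y = Ident V (X \<boxtimes> Y)"
    and triangle: "\<lbrakk>X \<in> Obj V; Y \<in> Obj V\<rbrakk>
      \<Longrightarrow> (Ident V X \<^bold>\<otimes> lun V Y) \<cdot> asc V X (unit_obj V) Y = run V X \<^bold>\<otimes> Ident V Y"
    and pentagon: "\<lbrakk>W \<in> Obj V; X \<in> Obj V; Y \<in> Obj V; Z \<in> Obj V\<rbrakk>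
      \<Longrightarrow> asc V W X (Y \<boxtimes> Z) \<cdot> asc V (W \<boxtimes> X) Y Z
        = (Ident V W \<^bold>\<otimes> asc V X Y Z) \<cdot> asc V W (X \<boxtimes> Y) Z \<cdot> (asc V W X Y \<^bold>\<otimes> Ident V Z)"
    and hexagon: "\<lbrakk>X \<in> Obj V; Y \<in> Obj V; Z \<in> Obj V\<rbrakk>
      \<Longrightarrow> asc V Y Z X \<cdot> braid V X (Y \<boxtimes> Z) \<cdot> asc V X Y Z
        = (Ident V Y \<^bold>\<otimes> braid V X Z) \<cdot> asc V Y X Z \<cdot> (braid V X Y \<^bold>\<otimes> Ident V Z)"

text \<open>Each functor \<open>- \<boxtimes> Y\<close> has a right adjoint, given by universal arrows \<open>ev\<close>.\<close>

definition closed_monoidal :: "('o, 'a) monoidal_category \<Rightarrow> bool" where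
  "closed_monoidal V \<longleftrightarrow> (\<forall>Y \<in> Obj V. \<forall>Z \<in> Obj V. \<exists>H \<in> Obj V. \<exists>ev \<in> Hom V (H \<boxtimes>\<^bsub>V\<^esub> Y) Z.
     \<forall>X \<in> Obj V. \<forall>f \<in> Hom V (X \<boxtimes>\<^bsub>V\<^esub> Y) Z.
       \<exists>!g. g \<in> Hom V X H \<and> ev \<cdot>\<^bsub>V\<^esub> (g \<^bold>\<otimes>\<^bsub>V\<^esub> Ident V Y) = f)"


section \<open>Bicategories, pseudofunctors, biequivalences\<close>

text \<open>\<open>vert\<close> is the disjoint union of all hom-categories: its objects are the 1-cells, its arrows
  the 2-cells, its composition the vertical one.  Horizontal composition is in diagrammatic
  order: for \<open>M : A \<rightarrow> B\<close> and \<open>N : B \<rightarrow> C\<close> one has \<open>M \<diamondop> N : A \<rightarrow> C\<close>.\<close>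

record ('o, 'f, 't) bicategory =
  cells :: "'o set"
  vert :: "('f, 't) category"
  src :: "'f \<Rightarrow> 'o"
  trg :: "'f \<Rightarrow> 'o"
  unit1 :: "'o \<Rightarrow> 'f"
  hcomp1 :: "'f \<Rightarrow> 'f \<Rightarrow> 'f"  (infixr "\<diamondop>\<index>" 70)
  hcomp2 :: "'t \<Rightarrow> 't \<Rightarrow> 't"  (infixr "\<star>\<index>" 70)
  bassoc :: "'f \<Rightarrow> 'f \<Rightarrow> 'f \<Rightarrow> 't"
  blunit :: "'f \<Rightarrow> 't"
  brunit :: "'f \<Rightarrow> 't"

definition cell1 :: "('o, 'f, 't) bicategory \<Rightarrow> 'o \<Rightarrow> 'o \<Rightarrow> 'f set" where
  "cell1 B X Y = {M \<in> Obj (vert B). src B M = X \<and> trg B M = Y}"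

abbreviation cell2 :: "('o, 'f, 't) bicategory \<Rightarrow> 'f \<Rightarrow> 'f \<Rightarrow> 't set" where
  "cell2 B M N \<equiv> Hom (vert B) M N"

definition hom_category :: "('o, 'f, 't) bicategory \<Rightarrow> 'o \<Rightarrow> 'o \<Rightarrow> ('f, 't) category" where
  "hom_category B X Y = (vert B)\<lparr>Obj := cell1 B X Y,
     Arr := {t \<in> Arr (vert B). Dom (vert B) t \<in> cell1 B X Y \<and> Cod (vert B) t \<in> cell1 B X Y}\<rparr>"

locale bicategory =
  fixes B :: "('o, 'f, 't) bicategory" (structure)
  assumes vert_category: "category (vert B)"
    and src_in: "M \<in> Obj (vert B) \<Longrightarrow> src B M \<in> cells B"
    and trg_in: "M \<in> Obj (vert B) \<Longrightarrow> trg B M \<in> cells B"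
    and parallel: "t \<in> cell2 B M N \<Longrightarrow> src B M = src B N \<and> trg B M = trg B N"
    and unit1_in: "X \<in> cells B \<Longrightarrow> unit1 B X \<in> cell1 B X X"
    and hcomp1_in: "\<lbrakk>M \<in> cell1 B X Y; N \<in> cell1 B Y Z\<rbrakk> \<Longrightarrow> M \<diamondop> N \<in> cell1 B X Z"
    and hcomp2_in: "\<lbrakk>M \<in> cell1 B X Y; N \<in> cell1 B Y Z; t \<in> cell2 B M M'; s \<in> cell2 B N N'\<rbrakk>
      \<Longrightarrow> t \<star> s \<in> cell2 B (M \<diamondop> N) (M' \<diamondop> N')"
    and hcomp2_ident: "\<lbrakk>M \<in> cell1 B X Y; N \<in> cell1 B Y Z\<rbrakk>
      \<Longrightarrow> Ident (vert B) M \<star> Ident (vert B) N = Ident (vert B) (M \<diamondop> N)"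
    and interchange: "\<lbrakk>M \<in> cell1 B X Y; N \<in> cell1 B Y Z; t \<in> cell2 B M M'; t' \<in> cell2 B M' M'';
        s \<in> cell2 B N N'; s' \<in> cell2 B N' N''\<rbrakk>
      \<Longrightarrow> (t' \<cdot>\<^bsub>vert B\<^esub> t) \<star> (s' \<cdot>\<^bsub>vert B\<^esub> s) = (t' \<star> s') \<cdot>\<^bsub>vert B\<^esub> (t \<star> s)"
    and bassoc_in: "\<lbrakk>M \<in> cell1 B W X; N \<in> cell1 B X Y; P \<in> cell1 B Y Z\<rbrakk>
      \<Longrightarrow> bassoc B M N P \<in> cell2 B ((M \<diamondop> N) \<diamondop> P) (M \<diamondop> (N \<diamondop> P))"
    and bassoc_iso: "\<lbrakk>M \<in> cell1 B W X; N \<in> cell1 B X Y; P \<in> cell1 B Y Z\<rbrakk>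
      \<Longrightarrow> invertible (vert B) (bassoc B M N P)"
    and bassoc_nat: "\<lbrakk>M \<in> cell1 B W X; N \<in> cell1 B X Y; P \<in> cell1 B Y Z;
        t \<in> cell2 B M M'; s \<in> cell2 B N N'; r \<in> cell2 B P P'\<rbrakk>
      \<Longrightarrow> bassoc B M' N' P' \<cdot>\<^bsub>vert B\<^esub> ((t \<star> s) \<star> r) = (t \<star> (s \<star> r)) \<cdot>\<^bsub>vert B\<^esub> bassoc B M N P"
    and blunit_in: "M \<in> cell1 B X Y \<Longrightarrow> blunit B M \<in> cell2 B (unit1 B X \<diamondop> M) M"
    and blunit_iso: "M \<in> cell1 B X Y \<Longrightarrow> invertible (vert B) (blunit B M)"
    and blunit_nat: "\<lbrakk>M \<in> cell1 B X Y; t \<in> cell2 B M N\<rbrakk>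
      \<Longrightarrow> blunit B N \<cdot>\<^bsub>vert B\<^esub> (Ident (vert B) (unit1 B X) \<star> t) = t \<cdot>\<^bsub>vert B\<^esub> blunit B M"
    and brunit_in: "M \<in> cell1 B X Y \<Longrightarrow> brunit B M \<in> cell2 B (M \<diamondop> unit1 B Y) M"
    and brunit_iso: "M \<in> cell1 B X Y \<Longrightarrow> invertible (vert B) (brunit B M)"
    and brunit_nat: "\<lbrakk>M \<in> cell1 B X Y; t \<in> cell2 B M N\<rbrakk>
      \<Longrightarrow> brunit B N \<cdot>\<^bsub>vert B\<^esub> (t \<star> Ident (vert B) (unit1 B Y)) = t \<cdot>\<^bsub>vert B\<^esub> brunit B M"
    and bpentagon: "\<lbrakk>M \<in> cell1 B X1 X2; N \<in> cell1 B X2 X3; P \<in> cell1 B X3 X4; Q \<in> cell1 B X4 X5\<rbrakk>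
      \<Longrightarrow> bassoc B M N (P \<diamondop> Q) \<cdot>\<^bsub>vert B\<^esub> bassoc B (M \<diamondop> N) P Q
        = (Ident (vert B) M \<star> bassoc B N P Q) \<cdot>\<^bsub>vert B\<^esub> bassoc B M (N \<diamondop> P) Q
            \<cdot>\<^bsub>vert B\<^esub> (bassoc B M N P \<star> Ident (vert B) Q)"
    and btriangle: "\<lbrakk>M \<in> cell1 B X Y; N \<in> cell1 B Y Z\<rbrakk>
      \<Longrightarrow> (Ident (vert B) M \<star> blunit B N) \<cdot>\<^bsub>vert B\<^esub> bassoc B M (unit1 B Y) N
        = brunit B M \<star> Ident (vert B) N"

definition equivalent_cells :: "('o, 'f, 't) bicategory \<Rightarrow> 'o \<Rightarrow> 'o \<Rightarrow> bool" where
  "equivalent_cells B X Y \<longleftrightarrow> (\<exists>M \<in> cell1 B X Y. \<exists>N \<in> cell1 B Y X.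
     (\<exists>t \<in> cell2 B (unit1 B X) (M \<diamondop>\<^bsub>B\<^esub> N). invertible (vert B) t)
     \<and> (\<exists>s \<in> cell2 B (N \<diamondop>\<^bsub>B\<^esub> M) (unit1 B Y). invertible (vert B) s))"

record ('o, 'f, 't, 'p, 'h, 's) pseudofunctor =
  F0 :: "'o \<Rightarrow> 'p"
  F1 :: "'f \<Rightarrow> 'h"
  F2 :: "'t \<Rightarrow> 's"
  Fcomp :: "'f \<Rightarrow> 'f \<Rightarrow> 's"
  Funit :: "'o \<Rightarrow> 's"

locale pseudofunctor = B: bicategory B + D: bicategory D
  for B :: "('o, 'f, 't) bicategory" and D :: "('p, 'h, 's) bicategory" +
  fixes F :: "('o, 'f, 't, 'p, 'h, 's) pseudofunctor"
  assumes F0_in: "X \<in> cells B \<Longrightarrow> F0 F X \<in> cells D"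
    and F1_in: "M \<in> cell1 B X Y \<Longrightarrow> F1 F M \<in> cell1 D (F0 F X) (F0 F Y)"
    and F2_functor: "is_functor (vert B) (vert D) (F1 F) (F2 F)"
    and Fcomp_in: "\<lbrakk>M \<in> cell1 B X Y; N \<in> cell1 B Y Z\<rbrakk>
      \<Longrightarrow> Fcomp F M N \<in> cell2 D (F1 F M \<diamondop>\<^bsub>D\<^esub> F1 F N) (F1 F (M \<diamondop>\<^bsub>B\<^esub> N))"
    and Fcomp_iso: "\<lbrakk>M \<in> cell1 B X Y; N \<in> cell1 B Y Z\<rbrakk> \<Longrightarrow> invertible (vert D) (Fcomp F M N)"
    and Fcomp_nat: "\<lbrakk>M \<in> cell1 B X Y; N \<in> cell1 B Y Z; t \<in> cell2 B M M'; s \<in> cell2 B N N'\<rbrakk>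
      \<Longrightarrow> Fcomp F M' N' \<cdot>\<^bsub>vert D\<^esub> (F2 F t \<star>\<^bsub>D\<^esub> F2 F s) = F2 F (t \<star>\<^bsub>B\<^esub> s) \<cdot>\<^bsub>vert D\<^esub> Fcomp F M N"
    and Funit_in: "X \<in> cells B \<Longrightarrow> Funit F X \<in> cell2 D (unit1 D (F0 F X)) (F1 F (unit1 B X))"
    and Funit_iso: "X \<in> cells B \<Longrightarrow> invertible (vert D) (Funit F X)"
    and Fassoc: "\<lbrakk>M \<in> cell1 B W X; N \<in> cell1 B X Y; P \<in> cell1 B Y Z\<rbrakk>
      \<Longrightarrow> F2 F (bassoc B M N P) \<cdot>\<^bsub>vert D\<^esub> Fcomp F (M \<diamondop>\<^bsub>B\<^esub> N) P
            \<cdot>\<^bsub>vert D\<^esub> (Fcomp F M N \<star>\<^bsub>D\<^esub> Ident (vert D) (F1 F P))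
        = Fcomp F M (N \<diamondop>\<^bsub>B\<^esub> P) \<cdot>\<^bsub>vert D\<^esub> (Ident (vert D) (F1 F M) \<star>\<^bsub>D\<^esub> Fcomp F N P)
            \<cdot>\<^bsub>vert D\<^esub> bassoc D (F1 F M) (F1 F N) (F1 F P)"
    and Flunit: "M \<in> cell1 B X Y
      \<Longrightarrow> F2 F (blunit B M) \<cdot>\<^bsub>vert D\<^esub> Fcomp F (unit1 B X) M
            \<cdot>\<^bsub>vert D\<^esub> (Funit F X \<star>\<^bsub>D\<^esub> Ident (vert D) (F1 F M))
        = blunit D (F1 F M)"
    and Frunit: "M \<in> cell1 B X Y
      \<Longrightarrow> F2 F (brunit B M) \<cdot>\<^bsub>vert D\<^esub> Fcomp F M (unit1 B Y)
            \<cdot>\<^bsub>vert D\<^esub> (Ident (vert D) (F1 F M) \<star>\<^bsub>D\<^esub> Funit F Y)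
        = brunit D (F1 F M)"

text \<open>A biequivalence is a pseudofunctor (between bicategories) that is a local equivalence and
  surjective on 0-cells up to internal equivalence.\<close>

locale biequivalence = pseudofunctor B D F
  for B :: "('o, 'f, 't) bicategory" and D :: "('p, 'h, 's) bicategory"
    and F :: "('o, 'f, 't, 'p, 'h, 's) pseudofunctor" +
  assumes local_equivalence: "\<lbrakk>X \<in> cells B; Y \<in> cells B\<rbrakk>
      \<Longrightarrow> equivalence_functor (hom_category B X Y) (hom_category D (F0 F X) (F0 F Y)) (F1 F) (F2 F)"
    and biessentially_surjective: "Z \<in> cells D \<Longrightarrow> \<exists>X \<in> cells B. equivalent_cells D (F0 F X) Z"


section \<open>Monoids, bimodules and relative tensor products\<close>

record ('o, 'a) mon =
  mobj :: 'o
  mmul :: 'a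
  munit :: 'a

record ('o, 'a) bimod =
  bsrc :: "('o, 'a) mon"
  btrg :: "('o, 'a) mon"
  bobj :: 'o
  lact :: 'a
  ract :: 'a

text \<open>\<open>bimod\<close> records a 1-cell \<open>bsrc \<rightarrow> btrg\<close>: the left action is by \<open>bsrc\<close>, the right one by \<open>btrg\<close>.\<close>

context
  fixes V :: "('o, 'a) monoidal_category" (structure)
begin

definition is_mon :: "('o, 'a) mon \<Rightarrow> bool" where
  "is_mon A \<longleftrightarrow> (let X = mobj A in X \<in> Obj V
     \<and> mmul A \<in> Hom V (X \<boxtimes> X) X \<and> munit A \<in> Hom V (unit_obj V) X
     \<and> mmul A \<cdot> (mmul A \<^bold>\<otimes> Ident V X) = mmul A \<cdot> (Ident V X \<^bold>\<otimes> mmul A) \<cdot> asc V X X X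
     \<and> mmul A \<cdot> (munit A \<^bold>\<otimes> Ident V X) = lun V X
     \<and> mmul A \<cdot> (Ident V X \<^bold>\<otimes> munit A) = run V X)"

definition mon_hom :: "('o, 'a) mon \<Rightarrow> ('o, 'a) mon \<Rightarrow> 'a \<Rightarrow> bool" where
  "mon_hom A B f \<longleftrightarrow> f \<in> Hom V (mobj A) (mobj B)
     \<and> f \<cdot> mmul A = mmul B \<cdot> (f \<^bold>\<otimes> f) \<and> f \<cdot> munit A = munit B"

definition Aut_mon :: "('o, 'a) mon \<Rightarrow> 'a monoid" where
  "Aut_mon A = \<lparr>carrier = {f. mon_hom A A f \<and> (\<exists>g. mon_hom A A g \<and> inverse_pair V f g)},
     mult = (\<lambda>g f. g \<cdot> f), one = Ident V (mobj A)\<rparr>"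

definition is_bimod :: "('o, 'a) bimod \<Rightarrow> bool" where
  "is_bimod M \<longleftrightarrow> (let A = bsrc M; B = btrg M; X = bobj M; a = mobj A; b = mobj B in
     is_mon A \<and> is_mon B \<and> X \<in> Obj V
     \<and> lact M \<in> Hom V (a \<boxtimes> X) X \<and> ract M \<in> Hom V (X \<boxtimes> b) X
     \<and> lact M \<cdot> (mmul A \<^bold>\<otimes> Ident V X) = lact M \<cdot> (Ident V a \<^bold>\<otimes> lact M) \<cdot> asc V a a X
     \<and> lact M \<cdot> (munit A \<^bold>\<otimes> Ident V X) = lun V X
     \<and> ract M \<cdot> (ract M \<^bold>\<otimes> Ident V b) = ract M \<cdot> (Ident V X \<^bold>\<otimes> mmul B) \<cdot> asc V X b b
     \<and> ract M \<cdot> (Ident V X \<^bold>\<otimes> munit B) = run V X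
     \<and> ract M \<cdot> (lact M \<^bold>\<otimes> Ident V b) = lact M \<cdot> (Ident V a \<^bold>\<otimes> ract M) \<cdot> asc V a X b)"

definition bimod_map :: "('o, 'a) bimod \<Rightarrow> ('o, 'a) bimod \<Rightarrow> 'a \<Rightarrow> bool" where
  "bimod_map M N f \<longleftrightarrow> bsrc M = bsrc N \<and> btrg M = btrg N \<and> f \<in> Hom V (bobj M) (bobj N)
     \<and> f \<cdot> lact M = lact N \<cdot> (Ident V (mobj (bsrc M)) \<^bold>\<otimes> f)
     \<and> f \<cdot> ract M = ract N \<cdot> (f \<^bold>\<otimes> Ident V (mobj (btrg M)))"

definition bimod_iso :: "('o, 'a) bimod \<Rightarrow> ('o, 'a) bimod \<Rightarrow> 'a \<Rightarrow> bool" where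
  "bimod_iso M N f \<longleftrightarrow> bimod_map M N f \<and> (\<exists>g. bimod_map N M g \<and> inverse_pair V f g)"

text \<open>The parallel pair \<open>(M \<boxtimes> B) \<boxtimes> N \<rightarrow> M \<boxtimes> N\<close> whose coequalizer is the relative tensor product
  over \<open>B = btrg M = bsrc N\<close>.\<close>

definition rel_coequalizer :: "('o, 'a) bimod \<Rightarrow> ('o, 'a) bimod \<Rightarrow> 'o \<Rightarrow> 'a \<Rightarrow> bool" where
  "rel_coequalizer M N P q \<longleftrightarrow> is_coequalizer V
     (ract M \<^bold>\<otimes> Ident V (bobj N))
     ((Ident V (bobj M) \<^bold>\<otimes> lact N) \<cdot> asc V (bobj M) (mobj (btrg M)) (bobj N)) P q"

definition has_relative_tensors :: bool where
  "has_relative_tensors \<longleftrightarrow> (\<forall>M N. is_bimod M \<and> is_bimod N \<and> btrg M = bsrc N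
     \<longrightarrow> (\<exists>P q. rel_coequalizer M N P q))"

definition rel_obj :: "('o, 'a) bimod \<Rightarrow> ('o, 'a) bimod \<Rightarrow> 'o" where
  "rel_obj M N = fst (SOME (P, q). rel_coequalizer M N P q)"

definition rel_proj :: "('o, 'a) bimod \<Rightarrow> ('o, 'a) bimod \<Rightarrow> 'a" where
  "rel_proj M N = snd (SOME (P, q). rel_coequalizer M N P q)"

text \<open>\<open>descend e k\<close> is the factorization of \<open>k\<close> through the epimorphism \<open>e\<close>.  Below, \<open>e\<close> is always
  built from the projections \<open>rel_proj\<close> by tensoring and composing; such arrows are epimorphisms
  because \<open>V\<close> is closed.\<close>

definition descend :: "'a \<Rightarrow> 'a \<Rightarrow> 'a" where
  "descend e k = (THE h. h \<in> Hom V (Cod V e) (Cod V k) \<and> h \<cdot> e = k)"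

definition rel_tensor :: "('o, 'a) bimod \<Rightarrow> ('o, 'a) bimod \<Rightarrow> ('o, 'a) bimod"  (infixr "\<odot>" 70) where
  "M \<odot> N = (let a = mobj (bsrc M); c = mobj (btrg N); q = rel_proj M N in
     \<lparr>bsrc = bsrc M, btrg = btrg N, bobj = rel_obj M N,
      lact = descend (Ident V a \<^bold>\<otimes> q)
        (q \<cdot> (lact M \<^bold>\<otimes> Ident V (bobj N)) \<cdot> inverse_of V (asc V a (bobj M) (bobj N))),
      ract = descend (q \<^bold>\<otimes> Ident V c)
        (q \<cdot> (Ident V (bobj M) \<^bold>\<otimes> ract N) \<cdot> asc V (bobj M) (bobj N) c)\<rparr>)"

text \<open>The arrow \<open>M \<odot> N \<rightarrow> M' \<odot> N'\<close> induced by \<open>f \<otimes> g\<close>, where \<open>f : M \<rightarrow> M'\<close> and \<open>g : N \<rightarrow> N'\<close> need only be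
  arrows of \<open>V\<close> for which \<open>f \<otimes> g\<close> descends.\<close>

definition rel_map ::
  "('o, 'a) bimod \<Rightarrow> ('o, 'a) bimod \<Rightarrow> ('o, 'a) bimod \<Rightarrow> ('o, 'a) bimod \<Rightarrow> 'a \<Rightarrow> 'a \<Rightarrow> 'a" where
  "rel_map M N M' N' f g = descend (rel_proj M N) (rel_proj M' N' \<cdot> (f \<^bold>\<otimes> g))"

definition lwhisk :: "('o, 'a) bimod \<Rightarrow> ('o, 'a) bimod \<Rightarrow> ('o, 'a) bimod \<Rightarrow> 'a \<Rightarrow> 'a" where
  "lwhisk M N N' g = rel_map M N M N' (Ident V (bobj M)) g"

definition rwhisk :: "('o, 'a) bimod \<Rightarrow> ('o, 'a) bimod \<Rightarrow> 'a \<Rightarrow> ('o, 'a) bimod \<Rightarrow> 'a" where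
  "rwhisk M M' f N = rel_map M N M' N f (Ident V (bobj N))"

definition rel_assoc :: "('o, 'a) bimod \<Rightarrow> ('o, 'a) bimod \<Rightarrow> ('o, 'a) bimod \<Rightarrow> 'a" where
  "rel_assoc M N P = descend
     (rel_proj (M \<odot> N) P \<cdot> (rel_proj M N \<^bold>\<otimes> Ident V (bobj P)))
     (rel_proj M (N \<odot> P) \<cdot> (Ident V (bobj M) \<^bold>\<otimes> rel_proj N P) \<cdot> asc V (bobj M) (bobj N) (bobj P))"

definition unit_bimod :: "('o, 'a) mon \<Rightarrow> ('o, 'a) bimod" where
  "unit_bimod A = \<lparr>bsrc = A, btrg = A, bobj = mobj A, lact = mmul A, ract = mmul A\<rparr>"

definition rel_lunit :: "('o, 'a) bimod \<Rightarrow> 'a" where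
  "rel_lunit M = descend (rel_proj (unit_bimod (bsrc M)) M) (lact M)"

definition rel_runit :: "('o, 'a) bimod \<Rightarrow> 'a" where
  "rel_runit M = descend (rel_proj M (unit_bimod (btrg M))) (ract M)"

end


section \<open>The two bicategories of equivariant bimodules\<close>

type_synonym ('o, 'a, 'g) gmon = "('o, 'a) mon \<times> ('g \<Rightarrow> 'a)"

text \<open>A 1-cell consists of a bimodule and a family of arrows indexed by the group (\<open>\<phi>\<close> in
  \<open>Mod(V)^G\<close>, \<open>\<tau>\<close> in the twisted version).  Families are \<open>extensional (carrier G)\<close>, so that cells are
  not duplicated by irrelevant values outside the group.\<close>

record ('o, 'a, 'g) gcell =
  gsrc :: "('o, 'a, 'g) gmon"
  gtrg :: "('o, 'a, 'g) gmon"
  gbim :: "('o, 'a) bimod"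
  gstr :: "'g \<Rightarrow> 'a"

record ('o, 'a, 'g) gcell2 =
  tdom :: "('o, 'a, 'g) gcell"
  tcod :: "('o, 'a, 'g) gcell"
  tmap :: 'a

context
  fixes V :: "('o, 'a) monoidal_category" (structure)
    and G :: "('g, 'm) monoid_scheme"
begin

private abbreviation rel_tensor_V  (infixr "\<odot>" 70) where "M \<odot> N \<equiv> rel_tensor V M N"

definition is_gmon :: "('o, 'a, 'g) gmon \<Rightarrow> bool" where
  "is_gmon A \<longleftrightarrow> is_mon V (fst A)
     \<and> snd A \<in> hom G (Aut_mon V (fst A)) \<and> snd A \<in> extensional (carrier G)"

text \<open>The part common to both bicategories: 1-cells are selected by \<open>P\<close>, 2-cells are the bimodule
  maps \<open>f : m \<Rightarrow> n\<close> with \<open>E m n f\<close>, and \<open>H\<close> and \<open>U\<close> are the families carried by composites and by units.\<close>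

definition equivariant_bicategory ::
  "(('o, 'a, 'g) gcell \<Rightarrow> bool)
   \<Rightarrow> (('o, 'a, 'g) gcell \<Rightarrow> ('o, 'a, 'g) gcell \<Rightarrow> 'a \<Rightarrow> bool)
   \<Rightarrow> (('o, 'a, 'g) gcell \<Rightarrow> ('o, 'a, 'g) gcell \<Rightarrow> 'g \<Rightarrow> 'a)
   \<Rightarrow> (('o, 'a, 'g) gmon \<Rightarrow> 'g \<Rightarrow> 'a)
   \<Rightarrow> (('o, 'a, 'g) gmon, ('o, 'a, 'g) gcell, ('o, 'a, 'g) gcell2) bicategory" where
  "equivariant_bicategory P E H U =
    (let hc = (\<lambda>m n. \<lparr>gsrc = gsrc m, gtrg = gtrg n, gbim = gbim m \<odot> gbim n,
                      gstr = restrict (H m n) (carrier G)\<rparr>);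
         un = (\<lambda>A. \<lparr>gsrc = A, gtrg = A, gbim = unit_bimod (fst A),
                    gstr = restrict (U A) (carrier G)\<rparr>)
     in
     \<lparr>cells = {A. is_gmon A},
      vert =
       \<lparr>Obj = {m. P m},
        Arr = {t. P (tdom t) \<and> P (tcod t)
                  \<and> gsrc (tdom t) = gsrc (tcod t) \<and> gtrg (tdom t) = gtrg (tcod t)
                  \<and> bimod_map V (gbim (tdom t)) (gbim (tcod t)) (tmap t)
                  \<and> E (tdom t) (tcod t) (tmap t)},
        Dom = tdom,
        Cod = tcod,
        Ident = (\<lambda>m. \<lparr>tdom = m, tcod = m, tmap = Ident V (bobj (gbim m))\<rparr>),
        Comp = (\<lambda>s t. \<lparr>tdom = tdom t, tcod = tcod s, tmap = tmap s \<cdot> tmap t\<rparr>)\<rparr>,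
      src = gsrc,
      trg = gtrg,
      unit1 = un,
      hcomp1 = hc,
      hcomp2 = (\<lambda>t s. \<lparr>tdom = hc (tdom t) (tdom s), tcod = hc (tcod t) (tcod s),
        tmap = rel_map V (gbim (tdom t)) (gbim (tdom s)) (gbim (tcod t)) (gbim (tcod s))
                 (tmap t) (tmap s)\<rparr>),
      bassoc = (\<lambda>m n p. \<lparr>tdom = hc (hc m n) p, tcod = hc m (hc n p),
        tmap = rel_assoc V (gbim m) (gbim n) (gbim p)\<rparr>),
      blunit = (\<lambda>m. \<lparr>tdom = hc (un (gsrc m)) m, tcod = m, tmap = rel_lunit V (gbim m)\<rparr>),
      brunit = (\<lambda>m. \<lparr>tdom = hc m (un (gtrg m)), tcod = m, tmap = rel_runit V (gbim m)\<rparr>)\<rparr>)"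

definition is_gcell_base :: "('o, 'a, 'g) gcell \<Rightarrow> bool" where
  "is_gcell_base m \<longleftrightarrow> is_gmon (gsrc m) \<and> is_gmon (gtrg m) \<and> is_bimod V (gbim m)
     \<and> bsrc (gbim m) = fst (gsrc m) \<and> btrg (gbim m) = fst (gtrg m)
     \<and> gstr m \<in> extensional (carrier G)"

subsection \<open>\<open>Mod(V)^G\<close>\<close>

definition G_cell :: "('o, 'a, 'g) gcell \<Rightarrow> bool" where
  "G_cell m \<longleftrightarrow> is_gcell_base m
     \<and> (let M = gbim m; X = bobj M; \<alpha> = snd (gsrc m); \<beta> = snd (gtrg m); \<phi> = gstr m in
         (\<forall>g \<in> carrier G. \<phi> g \<in> Hom V X X \<and> invertible V (\<phi> g))
         \<and> \<phi> \<one>\<^bsub>G\<^esub> = Ident V X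
         \<and> (\<forall>g \<in> carrier G. \<forall>h \<in> carrier G. \<phi> (g \<otimes>\<^bsub>G\<^esub> h) = \<phi> g \<cdot> \<phi> h)
         \<and> (\<forall>g \<in> carrier G. \<phi> g \<cdot> lact M = lact M \<cdot> (\<alpha> g \<^bold>\<otimes> \<phi> g))
         \<and> (\<forall>g \<in> carrier G. \<phi> g \<cdot> ract M = ract M \<cdot> (\<phi> g \<^bold>\<otimes> \<beta> g)))"

definition G_equivariant :: "('o, 'a, 'g) gcell \<Rightarrow> ('o, 'a, 'g) gcell \<Rightarrow> 'a \<Rightarrow> bool" where
  "G_equivariant m n f \<longleftrightarrow> (\<forall>g \<in> carrier G. f \<cdot> gstr m g = gstr n g \<cdot> f)"

definition Mod_G :: "(('o, 'a, 'g) gmon, ('o, 'a, 'g) gcell, ('o, 'a, 'g) gcell2) bicategory" where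
  "Mod_G = equivariant_bicategory G_cell G_equivariant
     (\<lambda>m n g. rel_map V (gbim m) (gbim n) (gbim m) (gbim n) (gstr m g) (gstr n g))
     (\<lambda>A. snd A)"

subsection \<open>\<open>Mod(V)^{G-tw}\<close>\<close>

definition twist :: "('o, 'a, 'g) gmon \<Rightarrow> 'g \<Rightarrow> ('o, 'a) bimod" where
  "twist A g = \<lparr>bsrc = fst A, btrg = fst A, bobj = mobj (fst A), lact = mmul (fst A),
     ract = mmul (fst A) \<cdot> (Ident V (mobj (fst A)) \<^bold>\<otimes> snd A g)\<rparr>"

text \<open>On elements: \<open>a \<odot> b \<mapsto> a \<alpha>\<^sub>g(b)\<close>.\<close>

definition twist_mu :: "('o, 'a, 'g) gmon \<Rightarrow> 'g \<Rightarrow> 'g \<Rightarrow> 'a" where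
  "twist_mu A g h = descend V (rel_proj V (twist A g) (twist A h))
     (mmul (fst A) \<cdot> (Ident V (mobj (fst A)) \<^bold>\<otimes> snd A g))"

text \<open>The unit isomorphism \<open>A \<cong> A\<^sup>e\<close> has the identity as underlying arrow, as \<open>\<alpha>\<^sub>e = id\<close>.\<close>

definition twist_eta :: "('o, 'a, 'g) gmon \<Rightarrow> 'a" where
  "twist_eta A = Ident V (mobj (fst A))"

definition Gtw_cell :: "('o, 'a, 'g) gcell \<Rightarrow> bool" where
  "Gtw_cell m \<longleftrightarrow> is_gcell_base m
     \<and> (let M = gbim m; A = twist (gsrc m); B = twist (gtrg m);
            UA = unit_bimod (fst (gsrc m)); UB = unit_bimod (fst (gtrg m));
            e = \<one>\<^bsub>G\<^esub>; \<tau> = gstr m in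
         (\<forall>g \<in> carrier G. bimod_iso V (A g \<odot> M) (M \<odot> B g) (\<tau> g))
         \<and> rel_runit V M
             \<cdot> lwhisk V M (B e) UB (inverse_of V (twist_eta (gtrg m)))
             \<cdot> \<tau> e
             \<cdot> rwhisk V UA (A e) (twist_eta (gsrc m)) M
             \<cdot> inverse_of V (rel_lunit V M)
           = Ident V (bobj M)
         \<and> (\<forall>g \<in> carrier G. \<forall>h \<in> carrier G.
             \<tau> (g \<otimes>\<^bsub>G\<^esub> h)
             = lwhisk V M (B g \<odot> B h) (B (g \<otimes>\<^bsub>G\<^esub> h)) (twist_mu (gtrg m) g h)
               \<cdot> rel_assoc V M (B g) (B h)
               \<cdot> rwhisk V (A g \<odot> M) (M \<odot> B g) (\<tau> g) (B h)
               \<cdot> inverse_of V (rel_assoc V (A g) M (B h))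
               \<cdot> lwhisk V (A g) (A h \<odot> M) (M \<odot> B h) (\<tau> h)
               \<cdot> rel_assoc V (A g) (A h) M
               \<cdot> rwhisk V (A (g \<otimes>\<^bsub>G\<^esub> h)) (A g \<odot> A h) (inverse_of V (twist_mu (gsrc m) g h)) M))"

definition Gtw_equivariant :: "('o, 'a, 'g) gcell \<Rightarrow> ('o, 'a, 'g) gcell \<Rightarrow> 'a \<Rightarrow> bool" where
  "Gtw_equivariant m n f \<longleftrightarrow> (\<forall>g \<in> carrier G.
     gstr n g \<cdot> lwhisk V (twist (gsrc m) g) (gbim m) (gbim n) f
     = rwhisk V (gbim m) (gbim n) f (twist (gtrg m) g) \<cdot> gstr m g)"

definition Gtw_comp :: "('o, 'a, 'g) gcell \<Rightarrow> ('o, 'a, 'g) gcell \<Rightarrow> 'g \<Rightarrow> 'a" where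
  "Gtw_comp m n g =
     (let M = gbim m; N = gbim n; A = twist (gsrc m) g; B = twist (gtrg m) g; C = twist (gtrg n) g in
       inverse_of V (rel_assoc V M N C)
       \<cdot> lwhisk V M (B \<odot> N) (N \<odot> C) (gstr n g)
       \<cdot> rel_assoc V M B N
       \<cdot> rwhisk V (A \<odot> M) (M \<odot> B) (gstr m g) N
       \<cdot> inverse_of V (rel_assoc V A M N))"

definition Gtw_unit :: "('o, 'a, 'g) gmon \<Rightarrow> 'g \<Rightarrow> 'a" where
  "Gtw_unit A g = inverse_of V (rel_lunit V (twist A g)) \<cdot> rel_runit V (twist A g)"

definition Mod_Gtw :: "(('o, 'a, 'g) gmon, ('o, 'a, 'g) gcell, ('o, 'a, 'g) gcell2) bicategory" where
  "Mod_Gtw = equivariant_bicategory Gtw_cell Gtw_equivariant Gtw_comp Gtw_unit"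

end

end

theory Submission
  imports Defs
begin

text \<open>
  A bimodule map \<open>\<tau>\<^sub>g : A\<^sup>g \<odot> M \<rightarrow> M \<odot> B\<^sup>g\<close> is the same thing as a map \<open>\<phi>\<^sub>g : M \<rightarrow> M\<close> that is
  semilinear over \<open>\<alpha>\<^sub>g\<close> and \<open>\<beta>\<^sub>g\<close>.  The map \<open>x \<otimes> b \<mapsto> x b\<close> identifies \<open>M \<odot> B\<^sup>g\<close> with \<open>M\<close>, left
  linearity of \<open>\<tau>\<^sub>g\<close> determines it by its values on \<open>1 \<otimes> x\<close>, and so every \<open>\<tau>\<^sub>g\<close> has the form
  \<open>a \<otimes> x \<mapsto> a \<phi>\<^sub>g(x) \<otimes> 1\<close>; since \<open>1 \<otimes> b x = \<alpha>\<^sub>g(b) \<otimes> x\<close> in \<open>A\<^sup>g \<odot> M\<close>, linearity of \<open>\<tau>\<^sub>g\<close> is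
  semilinearity of \<open>\<phi>\<^sub>g\<close>.  This correspondence is the relation \<open>represents\<close>.  Under it the unit
  and cocycle conditions on \<open>\<tau>\<close> become \<open>\<phi>\<^sub>e = id\<close> and \<open>\<phi>\<^sub>g\<^sub>h = \<phi>\<^sub>g \<phi>\<^sub>h\<close> (\<open>twisted_unit_condition\<close>,
  \<open>twisted_cocycle\<close>), compatibility of a bimodule map with the families \<open>\<tau>\<close> becomes compatibility
  with the families \<open>\<phi>\<close> (\<open>twisted_equivariance\<close>), the family of a composite becomes the family
  induced on the relative tensor product (\<open>twisted_composite\<close>), and the canonical family of a unit
  becomes \<open>\<alpha>\<close> (\<open>twisted_unit\<close>).  Replacing \<open>\<phi>\<close> by \<open>\<tau>\<close> is therefore bijective on 1-cells and on
  2-cells and preserves all operations on the nose: it is a strict isomorphism of bicategories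
  that is the identity on 0-cells, and such an isomorphism is a biequivalence.

  What remains is that bimodules form a bicategory, and that these formulas on elements make
  sense.  An element of an object \<open>X\<close> is here an arrow into \<open>X\<close> from the right-nested tensor product
  of a list of objects, and elements of \<open>X\<close> and \<open>Y\<close> pair to an element of \<open>X \<boxtimes> Y\<close> by concatenation
  of the lists.  With lists as domains, associators and unitors act on elements as plain
  rebracketing (\<open>app_asc\<close>, \<open>app_lun\<close>, \<open>app_run\<close>), although \<open>V\<close> is not strict.  A map is determined by
  its value on a single \<open>dense\<close> element, one whose underlying arrow is epic.  Because \<open>V\<close> is closed,
  tensoring preserves epimorphisms and coequalizers; so dense elements are stable under pairing
  and under the projections onto relative tensor products, and every law about bimodules reduces
  to an equation between elements such as \<open>(m \<otimes> n) \<otimes> p\<close>, which is a matter of rewriting.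

  The constructions on bimodule maps are carried out for maps that are semilinear over arbitrary
  maps of monoids.  In this generality the naturality of associators and unitors with respect to
  2-cells and their compatibility with the action of \<open>G\<close> are instances of the same lemmas.
\<close>

section \<open>Arrows of a category\<close>

lemma HomI: "f \<in> Arr C \<Longrightarrow> Dom C f = X \<Longrightarrow> Cod C f = Y \<Longrightarrow> f \<in> Hom C X Y"
  by (simp add: Hom_def)

lemma HomD: "f \<in> Hom C X Y \<Longrightarrow> f \<in> Arr C \<and> Dom C f = X \<and> Cod C f = Y"
  by (simp add: Hom_def)

context category
begin

lemma arr_hom: "f \<in> Arr C \<Longrightarrow> f \<in> Hom C (Dom C f) (Cod C f)"
  by (simp add: Hom_def)

lemma hom_obj: "f \<in> Hom C X Y \<Longrightarrow> X \<in> Obj C \<and> Y \<in> Obj C"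
  using dom_in cod_in by (auto simp: Hom_def)

lemma comp_typing [simp]:
  assumes "f \<in> Arr C" "g \<in> Arr C" "Dom C g = Cod C f"
  shows "g \<cdot> f \<in> Arr C" "Dom C (g \<cdot> f) = Dom C f" "Cod C (g \<cdot> f) = Cod C g"
  using comp_in[of f "Dom C f" "Cod C f" g "Cod C g"] assms by (auto simp: Hom_def)

lemma ident_typing [simp]:
  assumes "X \<in> Obj C"
  shows "Ident C X \<in> Arr C" "Dom C (Ident C X) = X" "Cod C (Ident C X) = X"
  using ident_in[OF assms] by (auto simp: Hom_def)

lemma comp_assoc_arr [simp]:
  "f \<in> Arr C \<Longrightarrow> g \<in> Arr C \<Longrightarrow> h \<in> Arr C \<Longrightarrow> Dom C g = Cod C f \<Longrightarrow> Dom C h = Cod C g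
    \<Longrightarrow> (h \<cdot> g) \<cdot> f = h \<cdot> g \<cdot> f"
  using comp_assoc[of f "Dom C f" "Cod C f" g "Cod C g" h "Cod C h"] by (auto simp: Hom_def)

lemma comp_ident_arr [simp]: "f \<in> Arr C \<Longrightarrow> Dom C f = X \<Longrightarrow> f \<cdot> Ident C X = f"
  using comp_ident[of f X "Cod C f"] by (auto simp: Hom_def)

lemma ident_comp_arr [simp]: "f \<in> Arr C \<Longrightarrow> Cod C f = X \<Longrightarrow> Ident C X \<cdot> f = f"
  using ident_comp[of f "Dom C f" X] by (auto simp: Hom_def)

lemma dom_cod_obj [simp]: "f \<in> Arr C \<Longrightarrow> Dom C f \<in> Obj C" "f \<in> Arr C \<Longrightarrow> Cod C f \<in> Obj C"
  using dom_in cod_in by auto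

lemma inverse_pair_unique: "inverse_pair C f g \<Longrightarrow> inverse_pair C f h \<Longrightarrow> g = h"
proof -
  assume a: "inverse_pair C f g" "inverse_pair C f h"
  then have t: "f \<in> Arr C" "g \<in> Arr C" "h \<in> Arr C" "Dom C g = Cod C f" "Cod C g = Dom C f"
    "Dom C h = Cod C f" "Cod C h = Dom C f"
    by (auto simp: inverse_pair_def Hom_def)
  have "g = g \<cdot> (f \<cdot> h)" using a t by (simp add: inverse_pair_def)
  also have "\<dots> = (g \<cdot> f) \<cdot> h" using t by simp
  also have "\<dots> = h" using a t by (simp add: inverse_pair_def)
  finally show "g = h" .
qed

lemma inverse_of_eq: "inverse_pair C f g \<Longrightarrow> inverse_of C f = g"
  unfolding inverse_of_def using inverse_pair_unique by blast

lemma inverse_pair_inverse_of: "invertible C f \<Longrightarrow> inverse_pair C f (inverse_of C f)"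
  unfolding invertible_def using inverse_of_eq by blast

lemma inverse_pair_sym: "inverse_pair C f g \<Longrightarrow> inverse_pair C g f"
  by (auto simp: inverse_pair_def Hom_def)

lemma inverse_of_typing [simp]:
  assumes "invertible C f"
  shows "inverse_of C f \<in> Arr C" "Dom C (inverse_of C f) = Cod C f"
    "Cod C (inverse_of C f) = Dom C f"
  using inverse_pair_inverse_of[OF assms] by (auto simp: inverse_pair_def Hom_def)

lemma inverse_of_cancel [simp]:
  assumes "invertible C f"
  shows "inverse_of C f \<cdot> f = Ident C (Dom C f)" "f \<cdot> inverse_of C f = Ident C (Cod C f)"
  using inverse_pair_inverse_of[OF assms] by (auto simp: inverse_pair_def Hom_def)

lemma invertible_arr: "invertible C f \<Longrightarrow> f \<in> Arr C"
  by (auto simp: invertible_def inverse_pair_def)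

lemma inverse_of_cancel_left [simp]:
  assumes "invertible C f" "x \<in> Arr C"
  shows "Cod C x = Dom C f \<Longrightarrow> inverse_of C f \<cdot> f \<cdot> x = x"
    "Cod C x = Cod C f \<Longrightarrow> f \<cdot> inverse_of C f \<cdot> x = x"
proof -
  note [simp] = invertible_arr[OF assms(1)] assms
  show "inverse_of C f \<cdot> f \<cdot> x = x" if "Cod C x = Dom C f"
  proof -
    have "inverse_of C f \<cdot> f \<cdot> x = (inverse_of C f \<cdot> f) \<cdot> x"
      using that by (simp del: inverse_of_cancel)
    then show ?thesis using that by simp
  qed
  show "f \<cdot> inverse_of C f \<cdot> x = x" if "Cod C x = Cod C f"
  proof -
    have "f \<cdot> inverse_of C f \<cdot> x = (f \<cdot> inverse_of C f) \<cdot> x"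
      using that by (simp del: inverse_of_cancel)
    then show ?thesis using that by simp
  qed
qed

lemma invertible_comp:
  assumes "invertible C f" "invertible C g" "Dom C g = Cod C f"
  shows "invertible C (g \<cdot> f)"
proof -
  note [simp] = invertible_arr[OF assms(1)] invertible_arr[OF assms(2)] assms
  have "inverse_pair C (g \<cdot> f) (inverse_of C f \<cdot> inverse_of C g)"
    unfolding inverse_pair_def by (simp add: Hom_def)
  then show ?thesis by (auto simp: invertible_def)
qed

lemma invertible_ident [simp]: "X \<in> Obj C \<Longrightarrow> invertible C (Ident C X)"
  unfolding invertible_def inverse_pair_def
  by (rule exI[of _ "Ident C X"]) (simp add: Hom_def)

lemma invertible_inverse_of [simp]: "invertible C f \<Longrightarrow> invertible C (inverse_of C f)"
  using inverse_pair_inverse_of inverse_pair_sym by (auto simp: invertible_def)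

lemma inverse_of_ident [simp]: "X \<in> Obj C \<Longrightarrow> inverse_of C (Ident C X) = Ident C X"
  by (rule inverse_of_eq) (simp add: inverse_pair_def Hom_def)

lemma cancel_left:
  assumes "invertible C h" "h \<cdot> f = h \<cdot> g" "f \<in> Arr C" "g \<in> Arr C" "Cod C f = Dom C h" "Cod C g = Dom C h"
  shows "f = g"
proof -
  have "inverse_of C h \<cdot> h \<cdot> f = inverse_of C h \<cdot> h \<cdot> g" using assms(2) by simp
  then show ?thesis using assms(1,3-6) invertible_arr[OF assms(1)] by simp
qed

text \<open>The two arrows compared are not required to have the same codomain; equality of the
  composites forces it.\<close>
definition epi :: "'a \<Rightarrow> bool" where
  "epi e \<longleftrightarrow> e \<in> Arr C \<and> (\<forall>f g. f \<in> Arr C \<and> g \<in> Arr C \<and> Dom C f = Cod C e \<and> Dom C g = Cod C e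
     \<and> f \<cdot> e = g \<cdot> e \<longrightarrow> f = g)"

lemma epiD: "epi e \<Longrightarrow> f \<cdot> e = g \<cdot> e \<Longrightarrow> f \<in> Arr C \<Longrightarrow> g \<in> Arr C
    \<Longrightarrow> Dom C f = Cod C e \<Longrightarrow> Dom C g = Cod C e \<Longrightarrow> f = g"
  unfolding epi_def by blast

lemma epi_arr: "epi e \<Longrightarrow> e \<in> Arr C"
  by (simp add: epi_def)

lemma invertible_epi:
  assumes "invertible C e"
  shows "epi e"
proof -
  note [simp] = invertible_arr[OF assms(1)] assms
  { fix f g assume a: "f \<in> Arr C" "g \<in> Arr C" "Dom C f = Cod C e" "Dom C g = Cod C e" "f \<cdot> e = g \<cdot> e"
    then have "(f \<cdot> e) \<cdot> inverse_of C e = (g \<cdot> e) \<cdot> inverse_of C e" by simp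
    then have "f = g" using a(1-4) by simp }
  then show ?thesis unfolding epi_def by auto
qed

lemma epi_comp:
  assumes "epi e" "epi d" "Dom C d = Cod C e"
  shows "epi (d \<cdot> e)"
proof -
  note [simp] = epi_arr[OF assms(1)] epi_arr[OF assms(2)] assms(3)
  { fix f g assume a: "f \<in> Arr C" "g \<in> Arr C" "Dom C f = Cod C d" "Dom C g = Cod C d"
      "f \<cdot> d \<cdot> e = g \<cdot> d \<cdot> e"
    have "f \<cdot> d = g \<cdot> d" by (rule epiD[OF assms(1)]) (use a in simp_all)
    then have "f = g" by (rule epiD[OF assms(2)]) (use a in simp_all) }
  then show ?thesis unfolding epi_def by auto
qed

end

section \<open>Coherence for units and associators\<close>

context symmetric_monoidal_category
begin

lemma tens_typing [simp]:
  assumes "f \<in> Arr V" "g \<in> Arr V"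
  shows "f \<^bold>\<otimes> g \<in> Arr V" "Dom V (f \<^bold>\<otimes> g) = Dom V f \<boxtimes> Dom V g" "Cod V (f \<^bold>\<otimes> g) = Cod V f \<boxtimes> Cod V g"
  using tens_in[OF arr_hom[OF assms(1)] arr_hom[OF assms(2)]] by (auto simp: Hom_def)

lemmas obj_simps [simp] = unit_obj_in tens_obj_in

lemma asc_typing [simp]:
  assumes "X \<in> Obj V" "Y \<in> Obj V" "Z \<in> Obj V"
  shows "asc V X Y Z \<in> Arr V" "Dom V (asc V X Y Z) = (X \<boxtimes> Y) \<boxtimes> Z" "Cod V (asc V X Y Z) = X \<boxtimes> (Y \<boxtimes> Z)"
  using asc_in[OF assms] by (auto simp: Hom_def)

lemma lun_typing [simp]:
  assumes "X \<in> Obj V"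
  shows "lun V X \<in> Arr V" "Dom V (lun V X) = unit_obj V \<boxtimes> X" "Cod V (lun V X) = X"
  using lun_in[OF assms] by (auto simp: Hom_def)

lemma run_typing [simp]:
  assumes "X \<in> Obj V"
  shows "run V X \<in> Arr V" "Dom V (run V X) = X \<boxtimes> unit_obj V" "Cod V (run V X) = X"
  using run_in[OF assms] by (auto simp: Hom_def)

lemma braid_typing [simp]:
  assumes "X \<in> Obj V" "Y \<in> Obj V"
  shows "braid V X Y \<in> Arr V" "Dom V (braid V X Y) = X \<boxtimes> Y" "Cod V (braid V X Y) = Y \<boxtimes> X"
  using braid_in[OF assms] by (auto simp: Hom_def)

lemmas iso_simps [simp] = asc_iso lun_iso run_iso

lemmas tens_ident_simp [simp] = tens_ident

lemma interchange [simp]: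
  assumes "f \<in> Arr V" "f' \<in> Arr V" "g \<in> Arr V" "g' \<in> Arr V" "Dom V f' = Cod V f" "Dom V g' = Cod V g"
  shows "(f' \<^bold>\<otimes> g') \<cdot> (f \<^bold>\<otimes> g) = (f' \<cdot> f) \<^bold>\<otimes> (g' \<cdot> g)"
  using tens_comp[of f "Dom V f" "Cod V f" f' "Cod V f'" g "Dom V g" "Cod V g" g' "Cod V g'"] assms
  by (simp add: Hom_def)

lemma interchange_left [simp]:
  assumes "f \<in> Arr V" "f' \<in> Arr V" "g \<in> Arr V" "g' \<in> Arr V" "Dom V f' = Cod V f" "Dom V g' = Cod V g"
    "x \<in> Arr V" "Cod V x = Dom V f \<boxtimes> Dom V g"
  shows "(f' \<^bold>\<otimes> g') \<cdot> (f \<^bold>\<otimes> g) \<cdot> x = ((f' \<cdot> f) \<^bold>\<otimes> (g' \<cdot> g)) \<cdot> x"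
  using interchange[of f f' g g'] comp_assoc_arr[of x "f \<^bold>\<otimes> g" "f' \<^bold>\<otimes> g'"] assms by simp

lemma asc_natural:
  assumes "f \<in> Arr V" "g \<in> Arr V" "h \<in> Arr V"
  shows "asc V (Cod V f) (Cod V g) (Cod V h) \<cdot> ((f \<^bold>\<otimes> g) \<^bold>\<otimes> h)
    = (f \<^bold>\<otimes> (g \<^bold>\<otimes> h)) \<cdot> asc V (Dom V f) (Dom V g) (Dom V h)"
  using asc_nat[OF arr_hom[OF assms(1)] arr_hom[OF assms(2)] arr_hom[OF assms(3)]] .

lemma lun_natural: "f \<in> Arr V \<Longrightarrow> lun V (Cod V f) \<cdot> (Ident V (unit_obj V) \<^bold>\<otimes> f) = f \<cdot> lun V (Dom V f)"
  using lun_nat[OF arr_hom] .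

lemma run_natural: "f \<in> Arr V \<Longrightarrow> run V (Cod V f) \<cdot> (f \<^bold>\<otimes> Ident V (unit_obj V)) = f \<cdot> run V (Dom V f)"
  using run_nat[OF arr_hom] .

lemma invertible_tens:
  assumes "invertible V f" "invertible V g"
  shows "invertible V (f \<^bold>\<otimes> g)"
proof -
  note [simp] = invertible_arr[OF assms(1)] invertible_arr[OF assms(2)] assms
  have "inverse_pair V (f \<^bold>\<otimes> g) (inverse_of V f \<^bold>\<otimes> inverse_of V g)"
    unfolding inverse_pair_def by (simp add: Hom_def)
  then show ?thesis by (auto simp: invertible_def)
qed

abbreviation I where "I \<equiv> unit_obj V"

text \<open>Tensoring with the unit object is naturally isomorphic to the identity functor, so an
  equation may be checked after tensoring with the unit.\<close>
lemma unit_tens_faithful: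
  assumes "Ident V I \<^bold>\<otimes> f = Ident V I \<^bold>\<otimes> g" "f \<in> Arr V" "g \<in> Arr V" "Dom V f = Dom V g" "Cod V f = Cod V g"
  shows "f = g"
proof (rule epiD[OF invertible_epi[OF lun_iso, of "Dom V f"]])
  show "f \<cdot> lun V (Dom V f) = g \<cdot> lun V (Dom V f)"
    using lun_natural[of f] lun_natural[of g] assms by simp
qed (use assms in simp_all)

lemma tens_unit_faithful:
  assumes "f \<^bold>\<otimes> Ident V I = g \<^bold>\<otimes> Ident V I" "f \<in> Arr V" "g \<in> Arr V" "Dom V f = Dom V g" "Cod V f = Cod V g"
  shows "f = g"
proof (rule epiD[OF invertible_epi[OF run_iso, of "Dom V f"]])
  show "f \<cdot> run V (Dom V f) = g \<cdot> run V (Dom V f)"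
    using run_natural[of f] run_natural[of g] assms by simp
qed (use assms in simp_all)

text \<open>Kelly's argument: after tensoring with the unit on the left, both sides agree up to an
  invertible arrow, by the pentagon for \<open>I, I, X, Y\<close> and two instances of the triangle.\<close>
lemma lun_tens:
  assumes X: "X \<in> Obj V" and Y: "Y \<in> Obj V"
  shows "lun V (X \<boxtimes> Y) \<cdot> asc V I X Y = lun V X \<^bold>\<otimes> Ident V Y"
proof (rule unit_tens_faithful)
  note [simp] = X Y
  let ?c = "asc V I (I \<boxtimes> X) Y \<cdot> (asc V I I X \<^bold>\<otimes> Ident V Y)"
  have c: "invertible V ?c"
    by (intro invertible_comp invertible_tens) simp_all
  show "Ident V I \<^bold>\<otimes> (lun V (X \<boxtimes> Y) \<cdot> asc V I X Y) = Ident V I \<^bold>\<otimes> (lun V X \<^bold>\<otimes> Ident V Y)"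
  proof (rule epiD[OF invertible_epi[OF c]])
    have "(Ident V I \<^bold>\<otimes> (lun V (X \<boxtimes> Y) \<cdot> asc V I X Y)) \<cdot> ?c
      = (Ident V I \<^bold>\<otimes> lun V (X \<boxtimes> Y)) \<cdot> ((Ident V I \<^bold>\<otimes> asc V I X Y) \<cdot> ?c)"
      by simp
    also have "(Ident V I \<^bold>\<otimes> asc V I X Y) \<cdot> ?c = asc V I I (X \<boxtimes> Y) \<cdot> asc V (I \<boxtimes> I) X Y"
      using pentagon[of I I X Y] by simp
    also have "(Ident V I \<^bold>\<otimes> lun V (X \<boxtimes> Y)) \<cdot> \<dots>
      = ((Ident V I \<^bold>\<otimes> lun V (X \<boxtimes> Y)) \<cdot> asc V I I (X \<boxtimes> Y)) \<cdot> asc V (I \<boxtimes> I) X Y"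
      by simp
    also have "\<dots> = (run V I \<^bold>\<otimes> Ident V (X \<boxtimes> Y)) \<cdot> asc V (I \<boxtimes> I) X Y"
      using triangle[of I "X \<boxtimes> Y"] by simp
    also have "\<dots> = asc V I X Y \<cdot> ((run V I \<^bold>\<otimes> Ident V X) \<^bold>\<otimes> Ident V Y)"
      using asc_natural[of "run V I" "Ident V X" "Ident V Y"] by simp
    also have "\<dots> = (asc V I X Y \<cdot> ((Ident V I \<^bold>\<otimes> lun V X) \<^bold>\<otimes> Ident V Y)) \<cdot> (asc V I I X \<^bold>\<otimes> Ident V Y)"
      using triangle[of I X] by simp
    also have "\<dots> = (Ident V I \<^bold>\<otimes> (lun V X \<^bold>\<otimes> Ident V Y)) \<cdot> ?c"
      using asc_natural[of "Ident V I" "lun V X" "Ident V Y"] by simp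
    finally show "(Ident V I \<^bold>\<otimes> (lun V (X \<boxtimes> Y) \<cdot> asc V I X Y)) \<cdot> ?c
      = (Ident V I \<^bold>\<otimes> (lun V X \<^bold>\<otimes> Ident V Y)) \<cdot> ?c" .
  qed simp_all
qed (use X Y in simp_all)

text \<open>The mirror image of \<open>lun_tens\<close>, from the pentagon for \<open>X, Y, I, I\<close>.\<close>
lemma run_tens:
  assumes X: "X \<in> Obj V" and Y: "Y \<in> Obj V"
  shows "(Ident V X \<^bold>\<otimes> run V Y) \<cdot> asc V X Y I = run V (X \<boxtimes> Y)"
proof (rule tens_unit_faithful, rule cancel_left)
  note [simp] = X Y
  show "invertible V (asc V X Y I)" by simp
  have "asc V X Y I \<cdot> (run V (X \<boxtimes> Y) \<^bold>\<otimes> Ident V I)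
      = (asc V X Y I \<cdot> ((Ident V X \<^bold>\<otimes> Ident V Y) \<^bold>\<otimes> lun V I)) \<cdot> asc V (X \<boxtimes> Y) I I"
    using triangle[of "X \<boxtimes> Y" I] by simp
  also have "\<dots> = (Ident V X \<^bold>\<otimes> (Ident V Y \<^bold>\<otimes> lun V I)) \<cdot> (asc V X Y (I \<boxtimes> I) \<cdot> asc V (X \<boxtimes> Y) I I)"
    using asc_natural[of "Ident V X" "Ident V Y" "lun V I"] by simp
  also have "\<dots> = (Ident V X \<^bold>\<otimes> ((Ident V Y \<^bold>\<otimes> lun V I) \<cdot> asc V Y I I)) \<cdot> asc V X (Y \<boxtimes> I) I \<cdot> (asc V X Y I \<^bold>\<otimes> Ident V I)"
    by (subst pentagon) simp_all
  also have "\<dots> = ((Ident V X \<^bold>\<otimes> (run V Y \<^bold>\<otimes> Ident V I)) \<cdot> asc V X (Y \<boxtimes> I) I) \<cdot> (asc V X Y I \<^bold>\<otimes> Ident V I)"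
    using triangle[of Y I] by simp
  also have "\<dots> = (asc V X Y I \<cdot> ((Ident V X \<^bold>\<otimes> run V Y) \<^bold>\<otimes> Ident V I)) \<cdot> (asc V X Y I \<^bold>\<otimes> Ident V I)"
    using asc_natural[of "Ident V X" "run V Y" "Ident V I"] by simp
  finally show "asc V X Y I \<cdot> ((Ident V X \<^bold>\<otimes> run V Y) \<cdot> asc V X Y I) \<^bold>\<otimes> Ident V I
    = asc V X Y I \<cdot> (run V (X \<boxtimes> Y) \<^bold>\<otimes> Ident V I)"
    by simp
qed (use X Y in simp_all)

text \<open>By naturality of the left unitor along itself, \<open>id \<otimes> lun I\<close> and \<open>lun (I \<otimes> I)\<close> agree; then
  \<open>lun_tens\<close> and the triangle compare the two unitors after tensoring with \<open>I\<close>.\<close>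
lemma lun_unit_run_unit: "lun V I = run V I"
proof (rule tens_unit_faithful)
  have "Ident V I \<^bold>\<otimes> lun V I = lun V (I \<boxtimes> I)"
    by (rule cancel_left[OF lun_iso[of I]]) (use lun_natural[of "lun V I"] in simp_all)
  then show "lun V I \<^bold>\<otimes> Ident V I = run V I \<^bold>\<otimes> Ident V I"
    using triangle[of I I] lun_tens[of I I] by simp
qed simp_all

section \<open>Generalized elements\<close>

text \<open>Domains of elements are bracketed canonically, to the right and ending in the unit object, so
  that a list of objects determines the domain.  The isomorphism \<open>split_list L K\<close> is the canonical
  one from the tensor product of a concatenation to the tensor product of the two parts.\<close>
primrec tensor_list :: "'o list \<Rightarrow> 'o" where
  "tensor_list [] = I"
| "tensor_list (X # L) = X \<boxtimes> tensor_list L"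

primrec split_list :: "'o list \<Rightarrow> 'o list \<Rightarrow> 'a" where
  "split_list [] K = inverse_of V (lun V (tensor_list K))"
| "split_list (X # L) K
    = inverse_of V (asc V X (tensor_list L) (tensor_list K)) \<cdot> (Ident V X \<^bold>\<otimes> split_list L K)"

lemma tensor_list_obj [simp]: "set L \<subseteq> Obj V \<Longrightarrow> tensor_list L \<in> Obj V"
  by (induction L) auto

lemma split_list_typing [simp]:
  assumes "set L \<subseteq> Obj V" "set K \<subseteq> Obj V"
  shows "split_list L K \<in> Arr V" "Dom V (split_list L K) = tensor_list (L @ K)"
    "Cod V (split_list L K) = tensor_list L \<boxtimes> tensor_list K"
  using assms by (induction L) auto

lemma split_list_iso: "set L \<subseteq> Obj V \<Longrightarrow> set K \<subseteq> Obj V \<Longrightarrow> invertible V (split_list L K)"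
  by (induction L) (auto intro!: invertible_comp invertible_tens)

lemma split_list_Nil_right:
  "set L \<subseteq> Obj V \<Longrightarrow> run V (tensor_list L) \<cdot> split_list L [] = Ident V (tensor_list L)"
proof (induction L)
  case Nil
  then show ?case by (simp flip: lun_unit_run_unit)
next
  case (Cons X L)
  then have [simp]: "X \<in> Obj V" "set L \<subseteq> Obj V" by auto
  have "run V (X \<boxtimes> tensor_list L) \<cdot> split_list (X # L) []
    = (Ident V X \<^bold>\<otimes> run V (tensor_list L)) \<cdot> (Ident V X \<^bold>\<otimes> split_list L [])"
    by (simp flip: run_tens del: interchange)
  then show ?case using Cons by simp
qed

text \<open>The only coherence statement about lists: the two ways of splitting a concatenation of three
  lists agree up to the associator.  By induction on the first list, where the inductive step is
  one pentagon together with naturality of the associator.\<close>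
lemma split_list_assoc:
  "set L \<subseteq> Obj V \<Longrightarrow> set K \<subseteq> Obj V \<Longrightarrow> set J \<subseteq> Obj V \<Longrightarrow>
   asc V (tensor_list L) (tensor_list K) (tensor_list J)
      \<cdot> (split_list L K \<^bold>\<otimes> Ident V (tensor_list J)) \<cdot> split_list (L @ K) J
    = (Ident V (tensor_list L) \<^bold>\<otimes> split_list K J) \<cdot> split_list L (K @ J)"
proof (induction L)
  case Nil
  let ?K = "tensor_list K" and ?J = "tensor_list J" and ?KJ = "tensor_list (K @ J)"
  let ?s = "split_list K J"
  note [simp] = Nil
  have a: "(Ident V I \<^bold>\<otimes> ?s) \<cdot> inverse_of V (lun V ?KJ) = inverse_of V (lun V (?K \<boxtimes> ?J)) \<cdot> ?s"
  proof (rule cancel_left[OF lun_iso[of "?K \<boxtimes> ?J"]])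
    have "lun V (?K \<boxtimes> ?J) \<cdot> (Ident V I \<^bold>\<otimes> ?s) \<cdot> inverse_of V (lun V ?KJ)
      = (lun V (?K \<boxtimes> ?J) \<cdot> (Ident V I \<^bold>\<otimes> ?s)) \<cdot> inverse_of V (lun V ?KJ)" by simp
    also have "\<dots> = ?s" using lun_natural[of ?s] by simp
    finally show "lun V (?K \<boxtimes> ?J) \<cdot> (Ident V I \<^bold>\<otimes> ?s) \<cdot> inverse_of V (lun V ?KJ)
      = lun V (?K \<boxtimes> ?J) \<cdot> inverse_of V (lun V (?K \<boxtimes> ?J)) \<cdot> ?s" by simp
  qed simp_all
  have b: "asc V I ?K ?J \<cdot> (inverse_of V (lun V ?K) \<^bold>\<otimes> Ident V ?J) \<cdot> ?s
      = inverse_of V (lun V (?K \<boxtimes> ?J)) \<cdot> ?s"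
  proof (rule cancel_left[OF lun_iso[of "?K \<boxtimes> ?J"]])
    have "lun V (?K \<boxtimes> ?J) \<cdot> asc V I ?K ?J \<cdot> (inverse_of V (lun V ?K) \<^bold>\<otimes> Ident V ?J) \<cdot> ?s
      = (lun V (?K \<boxtimes> ?J) \<cdot> asc V I ?K ?J) \<cdot> (inverse_of V (lun V ?K) \<^bold>\<otimes> Ident V ?J) \<cdot> ?s"
      by simp
    also have "\<dots> = ?s" by (simp add: lun_tens del: comp_assoc_arr)
    finally show "lun V (?K \<boxtimes> ?J) \<cdot> asc V I ?K ?J \<cdot> (inverse_of V (lun V ?K) \<^bold>\<otimes> Ident V ?J) \<cdot> ?s
      = lun V (?K \<boxtimes> ?J) \<cdot> inverse_of V (lun V (?K \<boxtimes> ?J)) \<cdot> ?s" by simp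
  qed simp_all
  show ?case using a b by simp
next
  case (Cons X L)
  then have [simp]: "X \<in> Obj V" "set L \<subseteq> Obj V" "set K \<subseteq> Obj V" "set J \<subseteq> Obj V" by auto
  let ?L = "tensor_list L" and ?K = "tensor_list K" and ?J = "tensor_list J"
    and ?LK = "tensor_list (L @ K)" and ?KJ = "tensor_list (K @ J)" and ?LKJ = "tensor_list (L @ K @ J)"
  let ?s = "split_list L K" and ?t = "split_list (L @ K) J" and ?u = "split_list K J"
    and ?v = "split_list L (K @ J)"
  let ?i = "inverse_of V"
  have IH: "asc V ?L ?K ?J \<cdot> (?s \<^bold>\<otimes> Ident V ?J) \<cdot> ?t = (Ident V ?L \<^bold>\<otimes> ?u) \<cdot> ?v"
    using Cons by simp
  have nat1: "((Ident V X \<^bold>\<otimes> ?s) \<^bold>\<otimes> Ident V ?J) \<cdot> ?i (asc V X ?LK ?J)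
      = ?i (asc V X (?L \<boxtimes> ?K) ?J) \<cdot> (Ident V X \<^bold>\<otimes> (?s \<^bold>\<otimes> Ident V ?J))"
  proof (rule cancel_left[OF asc_iso[of X "?L \<boxtimes> ?K" ?J]])
    have "asc V X (?L \<boxtimes> ?K) ?J \<cdot> ((Ident V X \<^bold>\<otimes> ?s) \<^bold>\<otimes> Ident V ?J) \<cdot> ?i (asc V X ?LK ?J)
      = (asc V X (?L \<boxtimes> ?K) ?J \<cdot> ((Ident V X \<^bold>\<otimes> ?s) \<^bold>\<otimes> Ident V ?J)) \<cdot> ?i (asc V X ?LK ?J)" by simp
    also have "\<dots> = (Ident V X \<^bold>\<otimes> (?s \<^bold>\<otimes> Ident V ?J))" using asc_natural[of "Ident V X" ?s "Ident V ?J"]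
      by simp
    finally show "asc V X (?L \<boxtimes> ?K) ?J \<cdot> ((Ident V X \<^bold>\<otimes> ?s) \<^bold>\<otimes> Ident V ?J) \<cdot> ?i (asc V X ?LK ?J)
      = asc V X (?L \<boxtimes> ?K) ?J \<cdot> ?i (asc V X (?L \<boxtimes> ?K) ?J) \<cdot> (Ident V X \<^bold>\<otimes> (?s \<^bold>\<otimes> Ident V ?J))" by simp
  qed simp_all
  have nat2: "(Ident V (X \<boxtimes> ?L) \<^bold>\<otimes> ?u) \<cdot> ?i (asc V X ?L ?KJ)
      = ?i (asc V X ?L (?K \<boxtimes> ?J)) \<cdot> (Ident V X \<^bold>\<otimes> (Ident V ?L \<^bold>\<otimes> ?u))"
  proof (rule cancel_left[OF asc_iso[of X ?L "?K \<boxtimes> ?J"]])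
    have "asc V X ?L (?K \<boxtimes> ?J) \<cdot> (Ident V (X \<boxtimes> ?L) \<^bold>\<otimes> ?u) \<cdot> ?i (asc V X ?L ?KJ)
      = (asc V X ?L (?K \<boxtimes> ?J) \<cdot> ((Ident V X \<^bold>\<otimes> Ident V ?L) \<^bold>\<otimes> ?u)) \<cdot> ?i (asc V X ?L ?KJ)" by simp
    also have "\<dots> = Ident V X \<^bold>\<otimes> (Ident V ?L \<^bold>\<otimes> ?u)" using asc_natural[of "Ident V X" "Ident V ?L" ?u]
      by (simp del: tens_ident_simp)
    finally show "asc V X ?L (?K \<boxtimes> ?J) \<cdot> (Ident V (X \<boxtimes> ?L) \<^bold>\<otimes> ?u) \<cdot> ?i (asc V X ?L ?KJ)
      = asc V X ?L (?K \<boxtimes> ?J) \<cdot> ?i (asc V X ?L (?K \<boxtimes> ?J)) \<cdot> (Ident V X \<^bold>\<otimes> (Ident V ?L \<^bold>\<otimes> ?u))" by simp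
  qed simp_all
  have pent: "asc V (X \<boxtimes> ?L) ?K ?J \<cdot> (?i (asc V X ?L ?K) \<^bold>\<otimes> Ident V ?J) \<cdot> ?i (asc V X (?L \<boxtimes> ?K) ?J)
      = ?i (asc V X ?L (?K \<boxtimes> ?J)) \<cdot> (Ident V X \<^bold>\<otimes> asc V ?L ?K ?J)"
  proof (rule cancel_left[OF asc_iso[of X ?L "?K \<boxtimes> ?J"]])
    have "asc V X ?L (?K \<boxtimes> ?J) \<cdot> asc V (X \<boxtimes> ?L) ?K ?J \<cdot> (?i (asc V X ?L ?K) \<^bold>\<otimes> Ident V ?J) \<cdot> ?i (asc V X (?L \<boxtimes> ?K) ?J)
      = (asc V X ?L (?K \<boxtimes> ?J) \<cdot> asc V (X \<boxtimes> ?L) ?K ?J) \<cdot> (?i (asc V X ?L ?K) \<^bold>\<otimes> Ident V ?J) \<cdot> ?i (asc V X (?L \<boxtimes> ?K) ?J)"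
      by simp
    also have "\<dots> = Ident V X \<^bold>\<otimes> asc V ?L ?K ?J" by (subst pentagon) simp_all
    finally show "asc V X ?L (?K \<boxtimes> ?J) \<cdot> asc V (X \<boxtimes> ?L) ?K ?J \<cdot> (?i (asc V X ?L ?K) \<^bold>\<otimes> Ident V ?J) \<cdot> ?i (asc V X (?L \<boxtimes> ?K) ?J)
      = asc V X ?L (?K \<boxtimes> ?J) \<cdot> ?i (asc V X ?L (?K \<boxtimes> ?J)) \<cdot> (Ident V X \<^bold>\<otimes> asc V ?L ?K ?J)" by simp
  qed simp_all
  have "asc V (X \<boxtimes> ?L) ?K ?J \<cdot> (split_list (X # L) K \<^bold>\<otimes> Ident V ?J) \<cdot> split_list ((X # L) @ K) J
    = asc V (X \<boxtimes> ?L) ?K ?J \<cdot> (?i (asc V X ?L ?K) \<^bold>\<otimes> Ident V ?J)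
      \<cdot> (((Ident V X \<^bold>\<otimes> ?s) \<^bold>\<otimes> Ident V ?J) \<cdot> ?i (asc V X ?LK ?J)) \<cdot> (Ident V X \<^bold>\<otimes> ?t)"
    by simp
  also have "\<dots> = (asc V (X \<boxtimes> ?L) ?K ?J \<cdot> (?i (asc V X ?L ?K) \<^bold>\<otimes> Ident V ?J) \<cdot> ?i (asc V X (?L \<boxtimes> ?K) ?J))
      \<cdot> (Ident V X \<^bold>\<otimes> ((?s \<^bold>\<otimes> Ident V ?J) \<cdot> ?t))"
    unfolding nat1 by simp
  also have "\<dots> = ?i (asc V X ?L (?K \<boxtimes> ?J)) \<cdot> (Ident V X \<^bold>\<otimes> (asc V ?L ?K ?J \<cdot> (?s \<^bold>\<otimes> Ident V ?J) \<cdot> ?t))"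
    unfolding pent by simp
  also have "\<dots> = (?i (asc V X ?L (?K \<boxtimes> ?J)) \<cdot> (Ident V X \<^bold>\<otimes> (Ident V ?L \<^bold>\<otimes> ?u))) \<cdot> (Ident V X \<^bold>\<otimes> ?v)"
    unfolding IH by simp
  also have "\<dots> = (Ident V (X \<boxtimes> ?L) \<^bold>\<otimes> ?u) \<cdot> split_list (X # L) (K @ J)"
    unfolding nat2[symmetric] by simp
  finally show ?case by simp
qed

text \<open>Generalized elements.  The list that presents the domain is part of the element: this makes
  pairing strictly associative after rebracketing, and equality of elements compares underlying
  arrows only when their domains are presented in the same way.\<close>
definition El :: "'o \<Rightarrow> ('o list \<times> 'a) set" where
  "El X = {x. set (fst x) \<subseteq> Obj V \<and> snd x \<in> Hom V (tensor_list (fst x)) X}"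

definition app :: "'a \<Rightarrow> 'o list \<times> 'a \<Rightarrow> 'o list \<times> 'a"  (infixr "\<bullet>" 80) where
  "f \<bullet> x = (fst x, f \<cdot> snd x)"

definition pair :: "'o list \<times> 'a \<Rightarrow> 'o list \<times> 'a \<Rightarrow> 'o list \<times> 'a"  (infixr "\<parallel>" 85) where
  "x \<parallel> y = (fst x @ fst y, (snd x \<^bold>\<otimes> snd y) \<cdot> split_list (fst x) (fst y))"

definition unit_elt :: "'o list \<times> 'a" where
  "unit_elt = ([], Ident V I)"

text \<open>The generic element of \<open>X\<close>: the identity of \<open>X\<close>, up to the unit object that ends every domain.\<close>
definition gen :: "'o \<Rightarrow> 'o list \<times> 'a" where
  "gen X = ([X], run V X)"

text \<open>Elements on which an arrow out of \<open>X\<close> can be tested.  The generic element is dense, but so is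
  the image of a dense element under a coequalizer projection; the latter is how maps out of
  relative tensor products are compared.\<close>
definition dense :: "'o \<Rightarrow> ('o list \<times> 'a) set" where
  "dense X = {x \<in> El X. epi (snd x)}"

lemma El_iff: "x \<in> El X \<longleftrightarrow> set (fst x) \<subseteq> Obj V \<and> snd x \<in> Arr V
    \<and> Dom V (snd x) = tensor_list (fst x) \<and> Cod V (snd x) = X"
  by (auto simp: El_def Hom_def)

lemma El_obj: "x \<in> El X \<Longrightarrow> X \<in> Obj V"
  by (auto simp: El_iff)

lemma dense_El [simp]: "x \<in> dense X \<Longrightarrow> x \<in> El X"
  by (simp add: dense_def)

lemma app_in [simp]: "f \<in> Arr V \<Longrightarrow> Cod V f = Y \<Longrightarrow> x \<in> El (Dom V f) \<Longrightarrow> f \<bullet> x \<in> El Y"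
  by (auto simp: El_iff app_def)

lemma app_comp [simp]:
  "f \<in> Arr V \<Longrightarrow> g \<in> Arr V \<Longrightarrow> Dom V g = Cod V f \<Longrightarrow> x \<in> El (Dom V f) \<Longrightarrow> (g \<cdot> f) \<bullet> x = g \<bullet> f \<bullet> x"
  by (auto simp: El_iff app_def)

lemma app_ident [simp]: "x \<in> El X \<Longrightarrow> Ident V X \<bullet> x = x"
  by (auto simp: El_iff app_def)

lemma pair_in [simp]: "x \<in> El X \<Longrightarrow> y \<in> El Y \<Longrightarrow> x \<parallel> y \<in> El (X \<boxtimes> Y)"
  by (auto simp: El_iff pair_def)

lemma unit_elt_in [simp]: "unit_elt \<in> El I"
  by (simp add: El_iff unit_elt_def)

lemma app_tens [simp]:
  "f \<in> Arr V \<Longrightarrow> g \<in> Arr V \<Longrightarrow> x \<in> El (Dom V f) \<Longrightarrow> y \<in> El (Dom V g)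
    \<Longrightarrow> (f \<^bold>\<otimes> g) \<bullet> (x \<parallel> y) = (f \<bullet> x) \<parallel> (g \<bullet> y)"
  by (simp add: El_iff app_def pair_def)

text \<open>This is where the domains of elements matter: both sides have the concatenated list as domain,
  and the statement is naturality of the associator combined with \<open>split_list_assoc\<close>.\<close>
lemma app_asc [simp]:
  assumes "x \<in> El X" "y \<in> El Y" "z \<in> El Z"
  shows "asc V X Y Z \<bullet> ((x \<parallel> y) \<parallel> z) = x \<parallel> (y \<parallel> z)"
proof -
  obtain L f where x: "x = (L, f)" by force
  obtain K g where y: "y = (K, g)" by force
  obtain J h where z: "z = (J, h)" by force
  note [simp] = assms[unfolded x y z El_iff, simplified]
  let ?L = "tensor_list L" and ?K = "tensor_list K" and ?J = "tensor_list J"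
  let ?s = "split_list"
  have o [simp]: "X \<in> Obj V" "Y \<in> Obj V" "Z \<in> Obj V" using assms El_obj by auto
  have "asc V X Y Z \<cdot> (((f \<^bold>\<otimes> g) \<cdot> ?s L K) \<^bold>\<otimes> h) \<cdot> ?s (L @ K) J
    = (asc V X Y Z \<cdot> ((f \<^bold>\<otimes> g) \<^bold>\<otimes> h)) \<cdot> (?s L K \<^bold>\<otimes> Ident V ?J) \<cdot> ?s (L @ K) J" by simp
  also have "asc V X Y Z \<cdot> ((f \<^bold>\<otimes> g) \<^bold>\<otimes> h) = (f \<^bold>\<otimes> (g \<^bold>\<otimes> h)) \<cdot> asc V ?L ?K ?J"
    using asc_natural[of f g h] by simp
  also have "((f \<^bold>\<otimes> (g \<^bold>\<otimes> h)) \<cdot> asc V ?L ?K ?J) \<cdot> (?s L K \<^bold>\<otimes> Ident V ?J) \<cdot> ?s (L @ K) J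
    = (f \<^bold>\<otimes> (g \<^bold>\<otimes> h)) \<cdot> asc V ?L ?K ?J \<cdot> (?s L K \<^bold>\<otimes> Ident V ?J) \<cdot> ?s (L @ K) J" by simp
  also have "\<dots> = (f \<^bold>\<otimes> ((g \<^bold>\<otimes> h) \<cdot> ?s K J)) \<cdot> ?s L (K @ J)"
    by (subst split_list_assoc) simp_all
  finally show ?thesis by (simp add: x y z app_def pair_def)
qed

lemma app_inverse_of:
  assumes "invertible V f" "x \<in> El (Dom V f)" "f \<bullet> x = y"
  shows "inverse_of V f \<bullet> y = x"
proof -
  have "inverse_of V f \<bullet> y = (inverse_of V f \<cdot> f) \<bullet> x"
    using assms invertible_arr by (subst app_comp) auto
  then show ?thesis using assms by simp
qed

lemma app_asc_inverse [simp]: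
  assumes "x \<in> El X" "y \<in> El Y" "z \<in> El Z"
  shows "inverse_of V (asc V X Y Z) \<bullet> (x \<parallel> (y \<parallel> z)) = (x \<parallel> y) \<parallel> z"
  using assms El_obj[of x X] El_obj[of y Y] El_obj[of z Z]
  by (intro app_inverse_of) simp_all

lemma app_lun [simp]:
  assumes "x \<in> El X" shows "lun V X \<bullet> (unit_elt \<parallel> x) = x"
proof -
  have "lun V X \<cdot> ((Ident V I \<^bold>\<otimes> snd x) \<cdot> inverse_of V (lun V (tensor_list (fst x))))
    = (lun V X \<cdot> (Ident V I \<^bold>\<otimes> snd x)) \<cdot> inverse_of V (lun V (tensor_list (fst x)))"
    using assms El_obj[OF assms] by (simp add: El_iff)
  also have "\<dots> = snd x"
    using assms lun_natural[of "snd x"] by (simp add: El_iff)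
  finally show ?thesis by (simp add: app_def pair_def unit_elt_def)
qed

lemma app_run [simp]:
  assumes "x \<in> El X" shows "run V X \<bullet> (x \<parallel> unit_elt) = x"
proof -
  have "run V X \<cdot> ((snd x \<^bold>\<otimes> Ident V I) \<cdot> split_list (fst x) [])
    = (run V X \<cdot> (snd x \<^bold>\<otimes> Ident V I)) \<cdot> split_list (fst x) []"
    using assms El_obj[OF assms] by (simp add: El_iff)
  also have "\<dots> = snd x"
    using assms run_natural[of "snd x"] by (simp add: El_iff split_list_Nil_right)
  finally show ?thesis by (simp add: app_def pair_def unit_elt_def)
qed

lemma app_lun_inverse [simp]: "x \<in> El X \<Longrightarrow> inverse_of V (lun V X) \<bullet> x = unit_elt \<parallel> x"
  using El_obj[of x X] by (intro app_inverse_of) simp_all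

lemma app_run_inverse [simp]: "x \<in> El X \<Longrightarrow> inverse_of V (run V X) \<bullet> x = x \<parallel> unit_elt"
  using El_obj[of x X] by (intro app_inverse_of) simp_all

lemma dense_ext:
  assumes "x \<in> dense X" "f \<bullet> x = g \<bullet> x" "f \<in> Hom V X Y" "g \<in> Hom V X Y"
  shows "f = g"
proof -
  have x: "epi (snd x)" "Cod V (snd x) = X" using assms(1) by (simp_all add: dense_def El_iff)
  have e: "f \<cdot> snd x = g \<cdot> snd x" using assms(2) by (simp add: app_def)
  show ?thesis by (rule epiD[OF x(1) e]) (use assms(3,4) x(2) in \<open>simp_all add: Hom_def\<close>)
qed

lemma gen_dense [simp]: "X \<in> Obj V \<Longrightarrow> gen X \<in> dense X"
  by (auto simp: dense_def El_iff gen_def intro: invertible_epi)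

lemma gen_El [simp]: "X \<in> Obj V \<Longrightarrow> gen X \<in> El X"
  by simp

lemma unit_elt_dense [simp]: "unit_elt \<in> dense I"
  by (auto simp: dense_def unit_elt_def El_iff intro: invertible_epi)

lemma app_dense: "epi q \<Longrightarrow> Cod V q = Y \<Longrightarrow> x \<in> dense (Dom V q) \<Longrightarrow> q \<bullet> x \<in> dense Y"
  using epi_arr[of q] by (auto simp: dense_def app_def El_iff intro: epi_comp)

end

section \<open>Closedness: tensoring preserves epimorphisms and coequalizers\<close>

locale closed_symmetric_monoidal_category = symmetric_monoidal_category V
  for V :: "('o, 'a) monoidal_category" (structure) +
  assumes closed: "closed_monoidal V"
begin

text \<open>The universal property of internal homs, with existence and uniqueness of transposes separated.\<close>
lemma currying:
  assumes "Y \<in> Obj V" "Z \<in> Obj V"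
  obtains H ev where "H \<in> Obj V" "ev \<in> Hom V (H \<boxtimes> Y) Z"
    "\<And>X f. X \<in> Obj V \<Longrightarrow> f \<in> Hom V (X \<boxtimes> Y) Z \<Longrightarrow> \<exists>g. g \<in> Hom V X H \<and> ev \<cdot> (g \<^bold>\<otimes> Ident V Y) = f"
    "\<And>X g g'. g \<in> Hom V X H \<Longrightarrow> g' \<in> Hom V X H
      \<Longrightarrow> ev \<cdot> (g \<^bold>\<otimes> Ident V Y) = ev \<cdot> (g' \<^bold>\<otimes> Ident V Y) \<Longrightarrow> g = g'"
proof -
  obtain H ev where H: "H \<in> Obj V" "ev \<in> Hom V (H \<boxtimes> Y) Z"
    and u: "\<And>X f. X \<in> Obj V \<Longrightarrow> f \<in> Hom V (X \<boxtimes> Y) Z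
      \<Longrightarrow> \<exists>!g. g \<in> Hom V X H \<and> ev \<cdot> (g \<^bold>\<otimes> Ident V Y) = f"
    using closed[unfolded closed_monoidal_def, rule_format, OF assms] by blast
  show ?thesis
  proof (rule that[OF H])
    show "\<exists>g. g \<in> Hom V X H \<and> ev \<cdot> (g \<^bold>\<otimes> Ident V Y) = f" if "X \<in> Obj V" "f \<in> Hom V (X \<boxtimes> Y) Z" for X f
      using u[OF that] by blast
    show "g = g'" if a: "g \<in> Hom V X H" "g' \<in> Hom V X H"
      "ev \<cdot> (g \<^bold>\<otimes> Ident V Y) = ev \<cdot> (g' \<^bold>\<otimes> Ident V Y)" for X g g'
    proof -
      have X: "X \<in> Obj V" using hom_obj[OF a(1)] by simp
      have "ev \<cdot> (g' \<^bold>\<otimes> Ident V Y) \<in> Hom V (X \<boxtimes> Y) Z"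
        using a H assms by (auto simp: Hom_def)
      from u[OF X this] a show ?thesis by blast
    qed
  qed
qed

text \<open>A functor with a right adjoint preserves epimorphisms: two arrows that agree after
  precomposition have transposes that agree after precomposition with \<open>e\<close>.\<close>
lemma epi_tens_ident:
  assumes e: "epi e" and Y [simp]: "Y \<in> Obj V"
  shows "epi (e \<^bold>\<otimes> Ident V Y)"
proof -
  note [simp] = epi_arr[OF e]
  { fix f g assume a [simp]: "f \<in> Arr V" "g \<in> Arr V" "Dom V f = Cod V e \<boxtimes> Y" "Dom V g = Cod V e \<boxtimes> Y"
      and eq: "f \<cdot> (e \<^bold>\<otimes> Ident V Y) = g \<cdot> (e \<^bold>\<otimes> Ident V Y)"
    have "Cod V (f \<cdot> (e \<^bold>\<otimes> Ident V Y)) = Cod V (g \<cdot> (e \<^bold>\<otimes> Ident V Y))" using eq by metis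
    then have c: "Cod V g = Cod V f" by simp
    obtain H ev where H: "H \<in> Obj V" "ev \<in> Hom V (H \<boxtimes> Y) (Cod V f)"
      and ex: "\<And>X f'. X \<in> Obj V \<Longrightarrow> f' \<in> Hom V (X \<boxtimes> Y) (Cod V f)
        \<Longrightarrow> \<exists>g. g \<in> Hom V X H \<and> ev \<cdot> (g \<^bold>\<otimes> Ident V Y) = f'"
      and un: "\<And>X g g'. g \<in> Hom V X H \<Longrightarrow> g' \<in> Hom V X H
        \<Longrightarrow> ev \<cdot> (g \<^bold>\<otimes> Ident V Y) = ev \<cdot> (g' \<^bold>\<otimes> Ident V Y) \<Longrightarrow> g = g'"
      using currying[OF Y, of "Cod V f"] by (metis a(1) cod_in)
    obtain f' where f': "f' \<in> Hom V (Cod V e) H" "ev \<cdot> (f' \<^bold>\<otimes> Ident V Y) = f"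
      using ex[of "Cod V e" f] by (auto simp: Hom_def)
    obtain g' where g': "g' \<in> Hom V (Cod V e) H" "ev \<cdot> (g' \<^bold>\<otimes> Ident V Y) = g"
      using ex[of "Cod V e" g] c by (auto simp: Hom_def)
    note [simp] = f'(1)[THEN HomD] g'(1)[THEN HomD] H(2)[THEN HomD]
    have fg: "(ev \<cdot> (f' \<^bold>\<otimes> Ident V Y)) \<cdot> (e \<^bold>\<otimes> Ident V Y) = (ev \<cdot> (g' \<^bold>\<otimes> Ident V Y)) \<cdot> (e \<^bold>\<otimes> Ident V Y)"
      using eq by (simp only: f'(2) g'(2))
    have fg': "f' \<cdot> e = g' \<cdot> e"
      by (rule un[of _ "Dom V e"]) (use fg in \<open>simp_all add: Hom_def\<close>)
    have "f' = g'" by (rule epiD[OF e fg']) simp_all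
    then have "f = g" using f'(2) g'(2) by simp }
  then show ?thesis unfolding epi_def by auto
qed

lemma braid_iso: "X \<in> Obj V \<Longrightarrow> Y \<in> Obj V \<Longrightarrow> invertible V (braid V X Y)"
  unfolding invertible_def inverse_pair_def
  by (rule exI[of _ "braid V Y X"]) (simp add: Hom_def symmetry)

lemma braid_natural: "f \<in> Arr V \<Longrightarrow> g \<in> Arr V \<Longrightarrow> braid V (Cod V f) (Cod V g) \<cdot> (f \<^bold>\<otimes> g)
    = (g \<^bold>\<otimes> f) \<cdot> braid V (Dom V f) (Dom V g)"
  using braid_nat[OF arr_hom arr_hom] .

lemma epi_ident_tens:
  assumes e: "epi e" and Y [simp]: "Y \<in> Obj V"
  shows "epi (Ident V Y \<^bold>\<otimes> e)"
proof -
  note [simp] = epi_arr[OF e]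
  have "Ident V Y \<^bold>\<otimes> e = braid V (Cod V e) Y \<cdot> braid V Y (Cod V e) \<cdot> (Ident V Y \<^bold>\<otimes> e)"
    by (simp add: symmetry flip: comp_assoc_arr)
  also have "\<dots> = braid V (Cod V e) Y \<cdot> (e \<^bold>\<otimes> Ident V Y) \<cdot> braid V Y (Dom V e)"
    using braid_natural[of "Ident V Y" e] by simp
  finally have "Ident V Y \<^bold>\<otimes> e = braid V (Cod V e) Y \<cdot> (e \<^bold>\<otimes> Ident V Y) \<cdot> braid V Y (Dom V e)" .
  moreover have "epi (braid V (Cod V e) Y \<cdot> (e \<^bold>\<otimes> Ident V Y) \<cdot> braid V Y (Dom V e))"
    by (intro epi_comp epi_tens_ident e invertible_epi braid_iso) simp_all
  ultimately show ?thesis by simp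
qed

lemma epi_tens:
  assumes "epi e" "epi d" shows "epi (e \<^bold>\<otimes> d)"
proof -
  note [simp] = epi_arr[OF assms(1)] epi_arr[OF assms(2)]
  have "e \<^bold>\<otimes> d = (e \<^bold>\<otimes> Ident V (Cod V d)) \<cdot> (Ident V (Dom V e) \<^bold>\<otimes> d)" by simp
  moreover have "epi ((e \<^bold>\<otimes> Ident V (Cod V d)) \<cdot> (Ident V (Dom V e) \<^bold>\<otimes> d))"
    by (intro epi_comp epi_tens_ident epi_ident_tens assms) simp_all
  ultimately show ?thesis by simp
qed

lemma pair_dense [simp]: "x \<in> dense X \<Longrightarrow> y \<in> dense Y \<Longrightarrow> x \<parallel> y \<in> dense (X \<boxtimes> Y)"
  by (auto simp: dense_def El_iff pair_def intro!: epi_comp epi_tens invertible_epi[OF split_list_iso])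

lemma coequalizer_epi:
  assumes "is_coequalizer V f g P q" "f \<in> Hom V A B" "g \<in> Hom V A B"
  shows "epi q"
proof -
  note [simp] = assms(2,3)[THEN HomD]
  have q [simp]: "q \<in> Arr V" "Dom V q = B" "Cod V q = P" and eq: "q \<cdot> f = q \<cdot> g"
    and u: "\<And>k. k \<in> Arr V \<Longrightarrow> Dom V k = B \<Longrightarrow> k \<cdot> f = k \<cdot> g \<Longrightarrow> \<exists>!h. h \<in> Hom V P (Cod V k) \<and> h \<cdot> q = k"
    using assms(1) by (auto simp: is_coequalizer_def Hom_def)
  { fix h h' assume a: "h \<in> Arr V" "h' \<in> Arr V" "Dom V h = P" "Dom V h' = P" "h \<cdot> q = h' \<cdot> q"
    have "Cod V (h \<cdot> q) = Cod V (h' \<cdot> q)" using a(5) by metis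
    then have c: "Cod V h' = Cod V h" using a(1-4) by simp
    have "(h \<cdot> q) \<cdot> f = (h \<cdot> q) \<cdot> g" using a(1-4) eq by simp
    then have "\<exists>!h''. h'' \<in> Hom V P (Cod V h) \<and> h'' \<cdot> q = h \<cdot> q" using a(1-4) u[of "h \<cdot> q"] by simp
    moreover have "h \<in> Hom V P (Cod V h)" "h' \<in> Hom V P (Cod V h)" using a(1-4) c by (auto simp: Hom_def)
    ultimately have "h = h'" using a(5) by metis }
  then show ?thesis unfolding epi_def by auto
qed

text \<open>A functor with a right adjoint preserves coequalizers: the transpose of \<open>k\<close> coequalizes the
  original pair, and the transpose of its factorization is the factorization of \<open>k\<close>.  Uniqueness
  is a consequence of \<open>epi_tens_ident\<close>.\<close>
lemma coequalizer_tens_ident: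
  assumes "is_coequalizer V f g P q" "f \<in> Hom V A B" "g \<in> Hom V A B" "Y \<in> Obj V"
    "k \<in> Hom V (B \<boxtimes> Y) Z" "k \<cdot> (f \<^bold>\<otimes> Ident V Y) = k \<cdot> (g \<^bold>\<otimes> Ident V Y)"
  shows "\<exists>h. h \<in> Hom V (P \<boxtimes> Y) Z \<and> h \<cdot> (q \<^bold>\<otimes> Ident V Y) = k"
proof -
  note [simp] = assms(2,3,5)[THEN HomD] assms(4)
  have q [simp]: "q \<in> Arr V" "Dom V q = B" "Cod V q = P"
    and u: "\<And>k. k \<in> Arr V \<Longrightarrow> Dom V k = B \<Longrightarrow> k \<cdot> f = k \<cdot> g \<Longrightarrow> \<exists>!h. h \<in> Hom V P (Cod V k) \<and> h \<cdot> q = k"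
    using assms(1) by (auto simp: is_coequalizer_def Hom_def)
  have B: "B \<in> Obj V" using hom_obj[OF assms(2)] by simp
  obtain H ev where H: "H \<in> Obj V" "ev \<in> Hom V (H \<boxtimes> Y) Z"
    and ex: "\<And>X f'. X \<in> Obj V \<Longrightarrow> f' \<in> Hom V (X \<boxtimes> Y) Z
      \<Longrightarrow> \<exists>g. g \<in> Hom V X H \<and> ev \<cdot> (g \<^bold>\<otimes> Ident V Y) = f'"
    and un: "\<And>X g g'. g \<in> Hom V X H \<Longrightarrow> g' \<in> Hom V X H
      \<Longrightarrow> ev \<cdot> (g \<^bold>\<otimes> Ident V Y) = ev \<cdot> (g' \<^bold>\<otimes> Ident V Y) \<Longrightarrow> g = g'"
    using currying[OF assms(4), of Z] hom_obj[OF assms(5)] by metis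
  obtain c where c: "c \<in> Hom V B H" "ev \<cdot> (c \<^bold>\<otimes> Ident V Y) = k" using ex[OF B assms(5)] by blast
  note [simp] = c(1)[THEN HomD] H(2)[THEN HomD]
  have fg: "(ev \<cdot> (c \<^bold>\<otimes> Ident V Y)) \<cdot> (f \<^bold>\<otimes> Ident V Y) = (ev \<cdot> (c \<^bold>\<otimes> Ident V Y)) \<cdot> (g \<^bold>\<otimes> Ident V Y)"
    using assms(6) by (simp only: c(2))
  have "c \<cdot> f = c \<cdot> g" by (rule un[of _ A]) (use fg in \<open>simp_all add: Hom_def\<close>)
  then obtain h where h: "h \<in> Hom V P H" "h \<cdot> q = c" using u[of c] by auto
  note [simp] = h(1)[THEN HomD]
  have "(ev \<cdot> (h \<^bold>\<otimes> Ident V Y)) \<cdot> (q \<^bold>\<otimes> Ident V Y) = k" using h(2) c(2) by simp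
  moreover have "ev \<cdot> (h \<^bold>\<otimes> Ident V Y) \<in> Hom V (P \<boxtimes> Y) Z" by (simp add: Hom_def)
  ultimately show ?thesis by blast
qed

text \<open>Reduced to \<open>coequalizer_tens_ident\<close> by conjugation with the braiding.\<close>
lemma coequalizer_ident_tens:
  assumes "is_coequalizer V f g P q" "f \<in> Hom V A B" "g \<in> Hom V A B" "Y \<in> Obj V"
    "k \<in> Hom V (Y \<boxtimes> B) Z" "k \<cdot> (Ident V Y \<^bold>\<otimes> f) = k \<cdot> (Ident V Y \<^bold>\<otimes> g)"
  shows "\<exists>h. h \<in> Hom V (Y \<boxtimes> P) Z \<and> h \<cdot> (Ident V Y \<^bold>\<otimes> q) = k"
proof -
  note [simp] = assms(2,3,5)[THEN HomD] assms(4)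
  have [simp]: "q \<in> Arr V" "Dom V q = B" "Cod V q = P"
    using assms(1) by (auto simp: is_coequalizer_def Hom_def)
  have [simp]: "B \<in> Obj V" "A \<in> Obj V" "P \<in> Obj V"
    using hom_obj[OF assms(2)] cod_in[of q] by simp_all
  have "(k \<cdot> braid V B Y) \<cdot> (f \<^bold>\<otimes> Ident V Y) = (k \<cdot> (Ident V Y \<^bold>\<otimes> f)) \<cdot> braid V A Y"
    using braid_natural[of f "Ident V Y"] by simp
  also have "\<dots> = (k \<cdot> braid V B Y) \<cdot> (g \<^bold>\<otimes> Ident V Y)"
    using braid_natural[of g "Ident V Y"] assms(6) by simp
  finally obtain h where h: "h \<in> Hom V (P \<boxtimes> Y) Z" "h \<cdot> (q \<^bold>\<otimes> Ident V Y) = k \<cdot> braid V B Y"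
    using coequalizer_tens_ident[OF assms(1-4), of "k \<cdot> braid V B Y" Z] by (auto simp: Hom_def)
  note [simp] = h(1)[THEN HomD]
  have "(h \<cdot> braid V Y P) \<cdot> (Ident V Y \<^bold>\<otimes> q) = (h \<cdot> (q \<^bold>\<otimes> Ident V Y)) \<cdot> braid V Y B"
    using braid_natural[of "Ident V Y" q] by simp
  also have "\<dots> = k" unfolding h(2) by (simp add: symmetry)
  finally show ?thesis by (intro exI[of _ "h \<cdot> braid V Y P"]) (simp add: Hom_def)
qed

end

section \<open>Monoids and bimodules in terms of elements\<close>

lemma (in symmetric_monoidal_category) descend_eq:
  assumes "epi e" "h \<in> Hom V (Cod V e) Z" "h \<cdot> e = k"
  shows "descend V e k = h"
  unfolding descend_def
proof (rule the_equality)
  have t: "e \<in> Arr V" "h \<in> Arr V" "Dom V h = Cod V e" "Cod V h = Z"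
    using assms epi_arr by (auto simp: Hom_def)
  then have Z: "Cod V k = Z" using assms(3) by auto
  show "h \<in> Hom V (Cod V e) (Cod V k) \<and> h \<cdot> e = k" using assms Z by simp
  show "h' = h" if "h' \<in> Hom V (Cod V e) (Cod V k) \<and> h' \<cdot> e = k" for h'
  proof (rule epiD[OF assms(1)])
    show "h' \<cdot> e = h \<cdot> e" using that assms(3) by simp
  qed (use that t in \<open>auto simp: Hom_def\<close>)
qed

context symmetric_monoidal_category
begin

abbreviation lscal where "lscal M \<equiv> El (mobj (bsrc M))"
abbreviation rscal where "rscal M \<equiv> El (mobj (btrg M))"
abbreviation elts where "elts M \<equiv> El (bobj M)"
abbreviation bgen where "bgen M \<equiv> gen (bobj M)"

text \<open>The structure maps of monoids and bimodules as operations on elements.  Their laws are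
  then the familiar equations of rings and bimodules and serve as rewrite rules.\<close>
definition mop where "mop A x y = mmul A \<bullet> (x \<parallel> y)"
definition mun where "mun A = munit A \<bullet> unit_elt"
definition lop where "lop M x m = lact M \<bullet> (x \<parallel> m)"
definition rop where "rop M m y = ract M \<bullet> (m \<parallel> y)"

lemma is_mon_typing:
  assumes "is_mon V A"
  shows "mobj A \<in> Obj V" "mmul A \<in> Arr V" "Dom V (mmul A) = mobj A \<boxtimes> mobj A" "Cod V (mmul A) = mobj A"
    "munit A \<in> Arr V" "Dom V (munit A) = I" "Cod V (munit A) = mobj A"
  using assms by (auto simp: is_mon_def Let_def Hom_def)

lemma mop_in [simp]:
  assumes "is_mon V A" "x \<in> El (mobj A)" "y \<in> El (mobj A)"
  shows "mop A x y \<in> El (mobj A)"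
  using assms is_mon_typing[OF assms(1)] by (simp add: mop_def)

lemma mun_in [simp]: "is_mon V A \<Longrightarrow> mun A \<in> El (mobj A)"
  using is_mon_typing[of A] by (simp add: mun_def)

lemma mop_assoc [simp]:
  assumes A: "is_mon V A" and x: "x \<in> El (mobj A)" "y \<in> El (mobj A)" "z \<in> El (mobj A)"
  shows "mop A (mop A x y) z = mop A x (mop A y z)"
proof -
  note [simp] = is_mon_typing[OF A] x
  have "mmul A \<cdot> (mmul A \<^bold>\<otimes> Ident V (mobj A)) = mmul A \<cdot> (Ident V (mobj A) \<^bold>\<otimes> mmul A) \<cdot> asc V (mobj A) (mobj A) (mobj A)"
    using A by (simp add: is_mon_def Let_def)
  from arg_cong[OF this, of "\<lambda>f. f \<bullet> ((x \<parallel> y) \<parallel> z)"] show ?thesis by (simp add: mop_def)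
qed

lemma mop_mun [simp]:
  assumes A: "is_mon V A" and x: "x \<in> El (mobj A)"
  shows "mop A (mun A) x = x" "mop A x (mun A) = x"
proof -
  note [simp] = is_mon_typing[OF A] x
  have "mmul A \<cdot> (munit A \<^bold>\<otimes> Ident V (mobj A)) = lun V (mobj A)"
    "mmul A \<cdot> (Ident V (mobj A) \<^bold>\<otimes> munit A) = run V (mobj A)"
    using A by (simp_all add: is_mon_def Let_def)
  from arg_cong[OF this(1), of "\<lambda>f. f \<bullet> (unit_elt \<parallel> x)"] arg_cong[OF this(2), of "\<lambda>f. f \<bullet> (x \<parallel> unit_elt)"]
  show "mop A (mun A) x = x" "mop A x (mun A) = x" by (simp_all add: mop_def mun_def)
qed

lemma mon_homD:
  assumes A: "is_mon V A" and B: "is_mon V B" and f: "mon_hom V A B f"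
  shows "f \<in> Arr V" "Dom V f = mobj A" "Cod V f = mobj B" "f \<bullet> mun A = mun B"
    "\<And>x y. x \<in> El (mobj A) \<Longrightarrow> y \<in> El (mobj A) \<Longrightarrow> f \<bullet> mop A x y = mop B (f \<bullet> x) (f \<bullet> y)"
proof -
  show t [simp]: "f \<in> Arr V" "Dom V f = mobj A" "Cod V f = mobj B"
    using f by (auto simp: mon_hom_def Hom_def)
  note [simp] = is_mon_typing[OF A] is_mon_typing[OF B]
  have "f \<cdot> munit A = munit B" using f by (simp add: mon_hom_def)
  from arg_cong[OF this, of "\<lambda>f. f \<bullet> unit_elt"] show "f \<bullet> mun A = mun B" by (simp add: mun_def)
  fix x y assume [simp]: "x \<in> El (mobj A)" "y \<in> El (mobj A)"
  have "f \<cdot> mmul A = mmul B \<cdot> (f \<^bold>\<otimes> f)" using f by (simp add: mon_hom_def)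
  from arg_cong[OF this, of "\<lambda>f. f \<bullet> (x \<parallel> y)"] show "f \<bullet> mop A x y = mop B (f \<bullet> x) (f \<bullet> y)"
    by (simp add: mop_def)
qed

lemma is_bimod_typing:
  assumes "is_bimod V M"
  shows "is_mon V (bsrc M)" "is_mon V (btrg M)" "bobj M \<in> Obj V"
    "lact M \<in> Arr V" "Dom V (lact M) = mobj (bsrc M) \<boxtimes> bobj M" "Cod V (lact M) = bobj M"
    "ract M \<in> Arr V" "Dom V (ract M) = bobj M \<boxtimes> mobj (btrg M)" "Cod V (ract M) = bobj M"
  using assms by (auto simp: is_bimod_def Let_def Hom_def)

lemmas is_bimod_mon [simp] = is_bimod_typing(1,2,3)

lemma is_mon_obj [simp]: "is_mon V A \<Longrightarrow> mobj A \<in> Obj V"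
  by (rule is_mon_typing)

lemma lop_in [simp]: "is_bimod V M \<Longrightarrow> x \<in> lscal M \<Longrightarrow> m \<in> elts M \<Longrightarrow> lop M x m \<in> elts M"
  using is_bimod_typing[of M] by (simp add: lop_def)

lemma rop_in [simp]: "is_bimod V M \<Longrightarrow> m \<in> elts M \<Longrightarrow> y \<in> rscal M \<Longrightarrow> rop M m y \<in> elts M"
  using is_bimod_typing[of M] by (simp add: rop_def)

lemma bimod_left [simp]:
  assumes M: "is_bimod V M" and m: "m \<in> elts M"
  shows "x \<in> lscal M \<Longrightarrow> y \<in> lscal M \<Longrightarrow> lop M (mop (bsrc M) x y) m = lop M x (lop M y m)"
    "lop M (mun (bsrc M)) m = m"
proof -
  note [simp] = is_bimod_typing[OF M] is_mon_typing[OF is_bimod_typing(1)[OF M]] m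
  have e: "lact M \<cdot> (mmul (bsrc M) \<^bold>\<otimes> Ident V (bobj M))
      = lact M \<cdot> (Ident V (mobj (bsrc M)) \<^bold>\<otimes> lact M) \<cdot> asc V (mobj (bsrc M)) (mobj (bsrc M)) (bobj M)"
    "lact M \<cdot> (munit (bsrc M) \<^bold>\<otimes> Ident V (bobj M)) = lun V (bobj M)"
    using M by (simp_all add: is_bimod_def Let_def)
  from arg_cong[OF e(2), of "\<lambda>f. f \<bullet> (unit_elt \<parallel> m)"]
  show "lop M (mun (bsrc M)) m = m" by (simp_all add: lop_def mun_def)
  assume [simp]: "x \<in> lscal M" "y \<in> lscal M"
  from arg_cong[OF e(1), of "\<lambda>f. f \<bullet> ((x \<parallel> y) \<parallel> m)"]
  show "lop M (mop (bsrc M) x y) m = lop M x (lop M y m)" by (simp add: lop_def mop_def)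
qed

lemma bimod_right [simp]:
  assumes M: "is_bimod V M" and m: "m \<in> elts M"
  shows "x \<in> rscal M \<Longrightarrow> y \<in> rscal M \<Longrightarrow> rop M (rop M m x) y = rop M m (mop (btrg M) x y)"
    "rop M m (mun (btrg M)) = m"
proof -
  note [simp] = is_bimod_typing[OF M] is_mon_typing[OF is_bimod_typing(2)[OF M]] m
  have e: "ract M \<cdot> (ract M \<^bold>\<otimes> Ident V (mobj (btrg M)))
      = ract M \<cdot> (Ident V (bobj M) \<^bold>\<otimes> mmul (btrg M)) \<cdot> asc V (bobj M) (mobj (btrg M)) (mobj (btrg M))"
    "ract M \<cdot> (Ident V (bobj M) \<^bold>\<otimes> munit (btrg M)) = run V (bobj M)"
    using M by (simp_all add: is_bimod_def Let_def)
  from arg_cong[OF e(2), of "\<lambda>f. f \<bullet> (m \<parallel> unit_elt)"]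
  show "rop M m (mun (btrg M)) = m" by (simp_all add: rop_def mun_def)
  assume [simp]: "x \<in> rscal M" "y \<in> rscal M"
  from arg_cong[OF e(1), of "\<lambda>f. f \<bullet> ((m \<parallel> x) \<parallel> y)"]
  show "rop M (rop M m x) y = rop M m (mop (btrg M) x y)" by (simp add: rop_def mop_def)
qed

lemma bimod_middle [simp]:
  assumes M: "is_bimod V M"
    and [simp]: "x \<in> lscal M" "m \<in> elts M" "y \<in> rscal M"
  shows "rop M (lop M x m) y = lop M x (rop M m y)"
proof -
  note [simp] = is_bimod_typing[OF M] is_mon_typing[OF is_bimod_typing(2)[OF M]]
    is_mon_typing[OF is_bimod_typing(1)[OF M]]
  have "ract M \<cdot> (lact M \<^bold>\<otimes> Ident V (mobj (btrg M)))
    = lact M \<cdot> (Ident V (mobj (bsrc M)) \<^bold>\<otimes> ract M) \<cdot> asc V (mobj (bsrc M)) (bobj M) (mobj (btrg M))"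
    using M by (simp_all add: is_bimod_def Let_def)
  from arg_cong[OF this, of "\<lambda>f. f \<bullet> ((x \<parallel> m) \<parallel> y)"]
  show ?thesis by (simp add: lop_def rop_def)
qed

text \<open>Semilinear maps: \<open>f (a x b) = \<alpha>(a) f(x) \<beta>(b)\<close>.  Bimodule maps are the case in which \<open>\<alpha>\<close> and \<open>\<beta>\<close> are
  identities, and the structure maps \<open>\<phi>\<^sub>g\<close> of a 1-cell are the case of automorphisms.\<close>
definition equivariant where
  "equivariant \<alpha> \<beta> M N f \<longleftrightarrow> \<alpha> \<in> Hom V (mobj (bsrc M)) (mobj (bsrc N))
     \<and> \<beta> \<in> Hom V (mobj (btrg M)) (mobj (btrg N)) \<and> f \<in> Hom V (bobj M) (bobj N)
     \<and> f \<cdot> lact M = lact N \<cdot> (\<alpha> \<^bold>\<otimes> f) \<and> f \<cdot> ract M = ract N \<cdot> (f \<^bold>\<otimes> \<beta>)"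

lemma bimod_map_equivariant:
  assumes "is_bimod V M"
  shows "bimod_map V M N f \<longleftrightarrow> bsrc M = bsrc N \<and> btrg M = btrg N
    \<and> equivariant (Ident V (mobj (bsrc M))) (Ident V (mobj (btrg M))) M N f"
  using ident_in[OF is_mon_obj[OF is_bimod_mon(1)[OF assms]]]
    ident_in[OF is_mon_obj[OF is_bimod_mon(2)[OF assms]]]
  by (auto simp: bimod_map_def equivariant_def)

lemma equivariantD:
  assumes f: "equivariant \<alpha> \<beta> M N f" and M: "is_bimod V M" and N: "is_bimod V N"
  shows "\<alpha> \<in> Arr V" "Dom V \<alpha> = mobj (bsrc M)" "Cod V \<alpha> = mobj (bsrc N)"
    "\<beta> \<in> Arr V" "Dom V \<beta> = mobj (btrg M)" "Cod V \<beta> = mobj (btrg N)"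
    "f \<in> Arr V" "Dom V f = bobj M" "Cod V f = bobj N"
    "\<And>x m. x \<in> lscal M \<Longrightarrow> m \<in> elts M \<Longrightarrow> f \<bullet> lop M x m = lop N (\<alpha> \<bullet> x) (f \<bullet> m)"
    "\<And>m y. m \<in> elts M \<Longrightarrow> y \<in> rscal M \<Longrightarrow> f \<bullet> rop M m y = rop N (f \<bullet> m) (\<beta> \<bullet> y)"
proof -
  show t [simp]: "\<alpha> \<in> Arr V" "Dom V \<alpha> = mobj (bsrc M)" "Cod V \<alpha> = mobj (bsrc N)"
    "\<beta> \<in> Arr V" "Dom V \<beta> = mobj (btrg M)" "Cod V \<beta> = mobj (btrg N)"
    "f \<in> Arr V" "Dom V f = bobj M" "Cod V f = bobj N"
    using f by (auto simp: equivariant_def Hom_def)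
  note [simp] = is_bimod_typing[OF M] is_bimod_typing[OF N]
  have e: "f \<cdot> lact M = lact N \<cdot> (\<alpha> \<^bold>\<otimes> f)" "f \<cdot> ract M = ract N \<cdot> (f \<^bold>\<otimes> \<beta>)"
    using f by (simp_all add: equivariant_def)
  show "f \<bullet> lop M x m = lop N (\<alpha> \<bullet> x) (f \<bullet> m)" if [simp]: "x \<in> lscal M" "m \<in> elts M" for x m
    using arg_cong[OF e(1), of "\<lambda>f. f \<bullet> (x \<parallel> m)"] by (simp add: lop_def)
  show "f \<bullet> rop M m y = rop N (f \<bullet> m) (\<beta> \<bullet> y)" if [simp]: "m \<in> elts M" "y \<in> rscal M" for m y
    using arg_cong[OF e(2), of "\<lambda>f. f \<bullet> (m \<parallel> y)"] by (simp add: rop_def)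
qed

end

context closed_symmetric_monoidal_category
begin

text \<open>All axioms of a bimodule are equations between arrows out of tensor products in which the
  bimodule occurs once, so they need only be checked at one dense element of it.\<close>
lemma is_bimodI:
  assumes A: "is_mon V (bsrc M)" and B: "is_mon V (btrg M)"
    and l: "lact M \<in> Hom V (mobj (bsrc M) \<boxtimes> bobj M) (bobj M)"
    and r: "ract M \<in> Hom V (bobj M \<boxtimes> mobj (btrg M)) (bobj M)"
    and m: "m \<in> dense (bobj M)"
    and ll: "\<And>x y. x \<in> lscal M \<Longrightarrow> y \<in> lscal M \<Longrightarrow> lop M (mop (bsrc M) x y) m = lop M x (lop M y m)"
    and lu: "lop M (mun (bsrc M)) m = m"
    and rr: "\<And>x y. x \<in> rscal M \<Longrightarrow> y \<in> rscal M \<Longrightarrow> rop M (rop M m x) y = rop M m (mop (btrg M) x y)"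
    and ru: "rop M m (mun (btrg M)) = m"
    and lr: "\<And>x y. x \<in> lscal M \<Longrightarrow> y \<in> rscal M \<Longrightarrow> rop M (lop M x m) y = lop M x (rop M m y)"
  shows "is_bimod V M"
proof -
  let ?a = "mobj (bsrc M)" and ?b = "mobj (btrg M)" and ?X = "bobj M"
  note [simp] = is_mon_typing[OF A] is_mon_typing[OF B] l[THEN HomD] r[THEN HomD]
  note [simp] = m dense_El[OF m] El_obj[OF dense_El[OF m]] ll lu rr ru lr
  have 1: "lact M \<cdot> (mmul (bsrc M) \<^bold>\<otimes> Ident V ?X) = lact M \<cdot> (Ident V ?a \<^bold>\<otimes> lact M) \<cdot> asc V ?a ?a ?X"
    using ll[of "gen ?a" "gen ?a"]
    by (intro dense_ext[of "(gen ?a \<parallel> gen ?a) \<parallel> m" "(?a \<boxtimes> ?a) \<boxtimes> ?X" _ _ ?X] HomI)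
      (simp_all add: lop_def mop_def)
  have 2: "lact M \<cdot> (munit (bsrc M) \<^bold>\<otimes> Ident V ?X) = lun V ?X"
    using lu
    by (intro dense_ext[of "unit_elt \<parallel> m" "I \<boxtimes> ?X" _ _ ?X] HomI) (simp_all add: lop_def mun_def)
  have 3: "ract M \<cdot> (ract M \<^bold>\<otimes> Ident V ?b) = ract M \<cdot> (Ident V ?X \<^bold>\<otimes> mmul (btrg M)) \<cdot> asc V ?X ?b ?b"
    using rr[of "gen ?b" "gen ?b"]
    by (intro dense_ext[of "(m \<parallel> gen ?b) \<parallel> gen ?b" "(?X \<boxtimes> ?b) \<boxtimes> ?b" _ _ ?X] HomI)
      (simp_all add: rop_def mop_def)
  have 4: "ract M \<cdot> (Ident V ?X \<^bold>\<otimes> munit (btrg M)) = run V ?X"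
    using ru
    by (intro dense_ext[of "m \<parallel> unit_elt" "?X \<boxtimes> I" _ _ ?X] HomI) (simp_all add: rop_def mun_def)
  have 5: "ract M \<cdot> (lact M \<^bold>\<otimes> Ident V ?b) = lact M \<cdot> (Ident V ?a \<^bold>\<otimes> ract M) \<cdot> asc V ?a ?X ?b"
    using lr[of "gen ?a" "gen ?b"]
    by (intro dense_ext[of "(gen ?a \<parallel> m) \<parallel> gen ?b" "(?a \<boxtimes> ?X) \<boxtimes> ?b" _ _ ?X] HomI)
      (simp_all add: rop_def lop_def)
  show ?thesis unfolding is_bimod_def Let_def
    using A B El_obj[OF dense_El[OF m]] l r 1 2 3 4 5 by blast
qed

lemma equivariantI:
  assumes M: "is_bimod V M" and N: "is_bimod V N"
    and a: "\<alpha> \<in> Hom V (mobj (bsrc M)) (mobj (bsrc N))" and b: "\<beta> \<in> Hom V (mobj (btrg M)) (mobj (btrg N))"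
    and f: "f \<in> Hom V (bobj M) (bobj N)" and m: "m \<in> dense (bobj M)"
    and l: "\<And>x. x \<in> lscal M \<Longrightarrow> f \<bullet> lop M x m = lop N (\<alpha> \<bullet> x) (f \<bullet> m)"
    and r: "\<And>y. y \<in> rscal M \<Longrightarrow> f \<bullet> rop M m y = rop N (f \<bullet> m) (\<beta> \<bullet> y)"
  shows "equivariant \<alpha> \<beta> M N f"
proof -
  let ?a = "mobj (bsrc M)" and ?b = "mobj (btrg M)"
  note [simp] = is_bimod_typing[OF M] is_bimod_typing[OF N] a[THEN HomD] b[THEN HomD] f[THEN HomD]
    m dense_El[OF m]
  have 1: "f \<cdot> lact M = lact N \<cdot> (\<alpha> \<^bold>\<otimes> f)"
    using l[of "gen ?a"]
    by (intro dense_ext[of "gen ?a \<parallel> m" "?a \<boxtimes> bobj M" _ _ "bobj N"] HomI) (simp_all add: lop_def)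
  have 2: "f \<cdot> ract M = ract N \<cdot> (f \<^bold>\<otimes> \<beta>)"
    using r[of "gen ?b"]
    by (intro dense_ext[of "m \<parallel> gen ?b" "bobj M \<boxtimes> ?b" _ _ "bobj N"] HomI) (simp_all add: rop_def)
  show ?thesis unfolding equivariant_def using 1 2 a b f by blast
qed

end

section \<open>Relative tensor products\<close>

locale bimodule_setting = closed_symmetric_monoidal_category V
  for V :: "('o, 'a) monoidal_category" (structure) +
  assumes relative_tensors: "has_relative_tensors V"
begin

abbreviation rel_tensor_V  (infixr "\<odot>" 70) where "M \<odot> N \<equiv> rel_tensor V M N"

text \<open>The class of \<open>m \<otimes> n\<close> in the relative tensor product.\<close>
definition tp where "tp M N m n = rel_proj V M N \<bullet> (m \<parallel> n)"

lemma descend_factor: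
  assumes "epi e" "h \<in> Hom V (Cod V e) Z" "h \<cdot> e = k"
  shows "descend V e k \<in> Arr V" "Dom V (descend V e k) = Cod V e" "Cod V (descend V e k) = Z"
    "\<And>w. w \<in> El (Dom V e) \<Longrightarrow> descend V e k \<bullet> e \<bullet> w = k \<bullet> w"
proof -
  have d: "descend V e k = h" by (rule descend_eq[OF assms])
  note [simp] = epi_arr[OF assms(1)] assms(2)[THEN HomD]
  show "descend V e k \<in> Arr V" "Dom V (descend V e k) = Cod V e" "Cod V (descend V e k) = Z"
    by (simp_all add: d)
  show "descend V e k \<bullet> e \<bullet> w = k \<bullet> w" if "w \<in> El (Dom V e)" for w
  proof -
    have "k \<bullet> w = (h \<cdot> e) \<bullet> w" using assms(3) by simp
    then show ?thesis using that by (simp add: d)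
  qed
qed

lemma coequalizer_factor:
  assumes "is_coequalizer V f g P q" "f \<in> Hom V A B" "k \<in> Hom V B Z" "k \<cdot> f = k \<cdot> g"
  shows "\<exists>h. h \<in> Hom V P Z \<and> h \<cdot> q = k"
  using assms unfolding is_coequalizer_def Hom_def by blast

lemma rel_proj_coequalizer:
  assumes "is_bimod V M" "is_bimod V N" "btrg M = bsrc N"
  shows "is_coequalizer V (ract M \<^bold>\<otimes> Ident V (bobj N))
     ((Ident V (bobj M) \<^bold>\<otimes> lact N) \<cdot> asc V (bobj M) (mobj (btrg M)) (bobj N))
     (rel_obj V M N) (rel_proj V M N)"
proof -
  obtain P q where "rel_coequalizer V M N P q"
    using relative_tensors assms unfolding has_relative_tensors_def by blast
  then have "case (P, q) of (P, q) \<Rightarrow> rel_coequalizer V M N P q" by simp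
  then have "case (SOME (P, q). rel_coequalizer V M N P q) of (P, q) \<Rightarrow> rel_coequalizer V M N P q"
    by (rule someI)
  then show ?thesis by (simp add: rel_obj_def rel_proj_def rel_coequalizer_def case_prod_beta)
qed

lemma rel_pair_hom:
  assumes "is_bimod V M" "is_bimod V N" "btrg M = bsrc N"
  shows "ract M \<^bold>\<otimes> Ident V (bobj N) \<in> Hom V ((bobj M \<boxtimes> mobj (btrg M)) \<boxtimes> bobj N) (bobj M \<boxtimes> bobj N)"
    "(Ident V (bobj M) \<^bold>\<otimes> lact N) \<cdot> asc V (bobj M) (mobj (btrg M)) (bobj N)
      \<in> Hom V ((bobj M \<boxtimes> mobj (btrg M)) \<boxtimes> bobj N) (bobj M \<boxtimes> bobj N)"
  using assms is_bimod_typing[of M] is_bimod_typing[of N] by (auto intro!: HomI)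

lemma rel_proj_typing [simp]:
  assumes "is_bimod V M" "is_bimod V N" "btrg M = bsrc N"
  shows "rel_proj V M N \<in> Arr V" "Dom V (rel_proj V M N) = bobj M \<boxtimes> bobj N"
    "Cod V (rel_proj V M N) = rel_obj V M N"
  using rel_proj_coequalizer[OF assms] is_bimod_typing[OF assms(1)] is_bimod_typing[OF assms(2)]
  by (auto simp: is_coequalizer_def Hom_def)

lemma rel_obj_obj [simp]: "is_bimod V M \<Longrightarrow> is_bimod V N \<Longrightarrow> btrg M = bsrc N \<Longrightarrow> rel_obj V M N \<in> Obj V"
  using rel_proj_typing cod_in by metis

text \<open>With \<open>app_dense\<close> this makes classes of pairs of dense elements dense, so that maps out of
  relative tensor products can be compared on elements of the form \<open>m \<otimes> n\<close>.\<close>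
lemma rel_proj_epi: "is_bimod V M \<Longrightarrow> is_bimod V N \<Longrightarrow> btrg M = bsrc N \<Longrightarrow> epi (rel_proj V M N)"
  using coequalizer_epi rel_proj_coequalizer rel_pair_hom by blast

lemma tp_in [simp]:
  "is_bimod V M \<Longrightarrow> is_bimod V N \<Longrightarrow> btrg M = bsrc N \<Longrightarrow> m \<in> elts M \<Longrightarrow> n \<in> elts N
    \<Longrightarrow> tp M N m n \<in> El (rel_obj V M N)"
  by (simp add: tp_def)

lemma tp_dense [simp]:
  "is_bimod V M \<Longrightarrow> is_bimod V N \<Longrightarrow> btrg M = bsrc N \<Longrightarrow> m \<in> dense (bobj M) \<Longrightarrow> n \<in> dense (bobj N)
    \<Longrightarrow> tp M N m n \<in> dense (rel_obj V M N)"
  by (simp add: tp_def app_dense rel_proj_epi)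

lemma tp_balanced [simp]:
  assumes M: "is_bimod V M" and N: "is_bimod V N" and c: "btrg M = bsrc N"
    and [simp]: "m \<in> elts M" "y \<in> lscal N" "n \<in> elts N"
  shows "tp M N (rop M m y) n = tp M N m (lop N y n)"
proof -
  note [simp] = M N c is_bimod_typing[OF M] is_bimod_typing[OF N]
  have "rel_proj V M N \<cdot> (ract M \<^bold>\<otimes> Ident V (bobj N))
    = rel_proj V M N \<cdot> ((Ident V (bobj M) \<^bold>\<otimes> lact N) \<cdot> asc V (bobj M) (mobj (btrg M)) (bobj N))"
    using rel_proj_coequalizer[OF M N c] unfolding is_coequalizer_def by blast
  from arg_cong[OF this, of "\<lambda>f. f \<bullet> ((m \<parallel> y) \<parallel> n)"] show ?thesis
    by (simp add: tp_def lop_def rop_def)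
qed

text \<open>The universal property of the relative tensor product in terms of elements.  Balancedness is
  asked only at one dense element of each factor; when a factor is itself a relative tensor
  product, that element can be chosen as a class \<open>m \<otimes> n\<close>.\<close>
lemma descend_rel:
  assumes M: "is_bimod V M" and N: "is_bimod V N" and c: "btrg M = bsrc N"
    and k: "k \<in> Hom V (bobj M \<boxtimes> bobj N) Z"
    and m: "m \<in> dense (bobj M)" and n: "n \<in> dense (bobj N)"
    and b: "\<And>y. y \<in> lscal N \<Longrightarrow> k \<bullet> (rop M m y \<parallel> n) = k \<bullet> (m \<parallel> lop N y n)"
  shows "descend V (rel_proj V M N) k \<in> Hom V (rel_obj V M N) Z"
    "\<And>m n. m \<in> elts M \<Longrightarrow> n \<in> elts N
      \<Longrightarrow> descend V (rel_proj V M N) k \<bullet> tp M N m n = k \<bullet> (m \<parallel> n)"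
proof -
  note [simp] = M N c is_bimod_typing[OF M] is_bimod_typing[OF N] k[THEN HomD] m n
  let ?y = "gen (mobj (bsrc N))"
  let ?f = "ract M \<^bold>\<otimes> Ident V (bobj N)"
    and ?g = "(Ident V (bobj M) \<^bold>\<otimes> lact N) \<cdot> asc V (bobj M) (mobj (btrg M)) (bobj N)"
  have "k \<cdot> ?f = k \<cdot> ?g"
    by (rule dense_ext[of "(m \<parallel> ?y) \<parallel> n" "(bobj M \<boxtimes> mobj (bsrc N)) \<boxtimes> bobj N" _ _ Z])
      (use b[of ?y] in \<open>simp_all add: Hom_def lop_def rop_def\<close>)
  then obtain h where h: "h \<in> Hom V (Cod V (rel_proj V M N)) Z" "h \<cdot> rel_proj V M N = k"
    using coequalizer_factor[OF rel_proj_coequalizer[OF M N c] rel_pair_hom(1)[OF M N c] k] by auto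
  from descend_factor[OF rel_proj_epi[OF M N c] h]
  show "descend V (rel_proj V M N) k \<in> Hom V (rel_obj V M N) Z"
    "\<And>m n. m \<in> elts M \<Longrightarrow> n \<in> elts N
      \<Longrightarrow> descend V (rel_proj V M N) k \<bullet> tp M N m n = k \<bullet> (m \<parallel> n)"
    by (simp_all add: tp_def Hom_def)
qed

text \<open>Relative tensor products are stable under tensoring with an object.  This variant and the next
  are what the two actions on a relative tensor product and the associator are built from.\<close>
lemma descend_ident_tens_rel:
  assumes M: "is_bimod V M" and N: "is_bimod V N" and c: "btrg M = bsrc N" and X: "X \<in> Obj V"
    and k: "k \<in> Hom V (X \<boxtimes> (bobj M \<boxtimes> bobj N)) Z"
    and b: "\<And>x m y n. x \<in> El X \<Longrightarrow> m \<in> elts M \<Longrightarrow> y \<in> lscal N \<Longrightarrow> n \<in> elts N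
      \<Longrightarrow> k \<bullet> (x \<parallel> (rop M m y \<parallel> n)) = k \<bullet> (x \<parallel> (m \<parallel> lop N y n))"
  shows "descend V (Ident V X \<^bold>\<otimes> rel_proj V M N) k \<in> Hom V (X \<boxtimes> rel_obj V M N) Z"
    "\<And>x m n. x \<in> El X \<Longrightarrow> m \<in> elts M \<Longrightarrow> n \<in> elts N
      \<Longrightarrow> descend V (Ident V X \<^bold>\<otimes> rel_proj V M N) k \<bullet> (x \<parallel> tp M N m n) = k \<bullet> (x \<parallel> (m \<parallel> n))"
proof -
  note [simp] = M N c X is_bimod_typing[OF M] is_bimod_typing[OF N] k[THEN HomD]
  let ?x = "gen X" and ?m = "bgen M" and ?y = "gen (mobj (bsrc N))" and ?n = "bgen N"
  let ?f = "ract M \<^bold>\<otimes> Ident V (bobj N)"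
    and ?g = "(Ident V (bobj M) \<^bold>\<otimes> lact N) \<cdot> asc V (bobj M) (mobj (btrg M)) (bobj N)"
  let ?e = "Ident V X \<^bold>\<otimes> rel_proj V M N"
  have "k \<cdot> (Ident V X \<^bold>\<otimes> ?f) = k \<cdot> (Ident V X \<^bold>\<otimes> ?g)"
    by (rule dense_ext[of "?x \<parallel> ((?m \<parallel> ?y) \<parallel> ?n)" "X \<boxtimes> ((bobj M \<boxtimes> mobj (bsrc N)) \<boxtimes> bobj N)" _ _ Z])
      (use b[of ?x ?m ?y ?n] in \<open>simp_all add: Hom_def lop_def rop_def\<close>)
  then obtain h where h: "h \<in> Hom V (Cod V ?e) Z" "h \<cdot> ?e = k"
    using coequalizer_ident_tens[OF rel_proj_coequalizer[OF M N c] rel_pair_hom[OF M N c] X k] by auto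
  have e: "epi ?e" by (intro epi_ident_tens rel_proj_epi) simp_all
  have w: "?e \<bullet> (x \<parallel> (m \<parallel> n)) = x \<parallel> tp M N m n"
    if "x \<in> El X" "m \<in> elts M" "n \<in> elts N" for x m n
    using that by (simp add: tp_def)
  show "descend V ?e k \<in> Hom V (X \<boxtimes> rel_obj V M N) Z"
    using descend_factor(1-3)[OF e h] by (simp add: Hom_def)
  show "descend V ?e k \<bullet> (x \<parallel> tp M N m n) = k \<bullet> (x \<parallel> (m \<parallel> n))"
    if "x \<in> El X" "m \<in> elts M" "n \<in> elts N" for x m n
    using descend_factor(4)[OF e h, of "x \<parallel> (m \<parallel> n)"] that unfolding w[OF that] by simp
qed

lemma descend_tens_ident_rel:
  assumes M: "is_bimod V M" and N: "is_bimod V N" and c: "btrg M = bsrc N" and X: "X \<in> Obj V"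
    and k: "k \<in> Hom V ((bobj M \<boxtimes> bobj N) \<boxtimes> X) Z"
    and b: "\<And>x m y n. x \<in> El X \<Longrightarrow> m \<in> elts M \<Longrightarrow> y \<in> lscal N \<Longrightarrow> n \<in> elts N
      \<Longrightarrow> k \<bullet> ((rop M m y \<parallel> n) \<parallel> x) = k \<bullet> ((m \<parallel> lop N y n) \<parallel> x)"
  shows "descend V (rel_proj V M N \<^bold>\<otimes> Ident V X) k \<in> Hom V (rel_obj V M N \<boxtimes> X) Z"
    "\<And>x m n. x \<in> El X \<Longrightarrow> m \<in> elts M \<Longrightarrow> n \<in> elts N
      \<Longrightarrow> descend V (rel_proj V M N \<^bold>\<otimes> Ident V X) k \<bullet> (tp M N m n \<parallel> x) = k \<bullet> ((m \<parallel> n) \<parallel> x)"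
proof -
  note [simp] = M N c X is_bimod_typing[OF M] is_bimod_typing[OF N] k[THEN HomD]
  let ?x = "gen X" and ?m = "bgen M" and ?y = "gen (mobj (bsrc N))" and ?n = "bgen N"
  let ?f = "ract M \<^bold>\<otimes> Ident V (bobj N)"
    and ?g = "(Ident V (bobj M) \<^bold>\<otimes> lact N) \<cdot> asc V (bobj M) (mobj (btrg M)) (bobj N)"
  let ?e = "rel_proj V M N \<^bold>\<otimes> Ident V X"
  have "k \<cdot> (?f \<^bold>\<otimes> Ident V X) = k \<cdot> (?g \<^bold>\<otimes> Ident V X)"
    by (rule dense_ext[of "((?m \<parallel> ?y) \<parallel> ?n) \<parallel> ?x" "((bobj M \<boxtimes> mobj (bsrc N)) \<boxtimes> bobj N) \<boxtimes> X" _ _ Z])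
      (use b[of ?x ?m ?y ?n] in \<open>simp_all add: Hom_def lop_def rop_def\<close>)
  then obtain h where h: "h \<in> Hom V (Cod V ?e) Z" "h \<cdot> ?e = k"
    using coequalizer_tens_ident[OF rel_proj_coequalizer[OF M N c] rel_pair_hom[OF M N c] X k] by auto
  have e: "epi ?e" by (intro epi_tens_ident rel_proj_epi) simp_all
  have w: "?e \<bullet> ((m \<parallel> n) \<parallel> x) = tp M N m n \<parallel> x"
    if "x \<in> El X" "m \<in> elts M" "n \<in> elts N" for x m n
    using that by (simp add: tp_def)
  show "descend V ?e k \<in> Hom V (rel_obj V M N \<boxtimes> X) Z"
    using descend_factor(1-3)[OF e h] by (simp add: Hom_def)
  show "descend V ?e k \<bullet> (tp M N m n \<parallel> x) = k \<bullet> ((m \<parallel> n) \<parallel> x)"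
    if "x \<in> El X" "m \<in> elts M" "n \<in> elts N" for x m n
    using descend_factor(4)[OF e h, of "(m \<parallel> n) \<parallel> x"] that unfolding w[OF that] by simp
qed

lemma rel_tensor_simps [simp]:
  "bsrc (M \<odot> N) = bsrc M" "btrg (M \<odot> N) = btrg N" "bobj (M \<odot> N) = rel_obj V M N"
  by (simp_all add: rel_tensor_def Let_def)

lemma rel_tensor_left:
  assumes M: "is_bimod V M" and N: "is_bimod V N" and c: "btrg M = bsrc N"
  shows "lact (M \<odot> N) \<in> Hom V (mobj (bsrc M) \<boxtimes> rel_obj V M N) (rel_obj V M N)"
    "\<And>x m n. x \<in> lscal M \<Longrightarrow> m \<in> elts M \<Longrightarrow> n \<in> elts N
      \<Longrightarrow> lop (M \<odot> N) x (tp M N m n) = tp M N (lop M x m) n"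
proof -
  note [simp] = M N c is_bimod_typing[OF M] is_bimod_typing[OF N]
  let ?k = "rel_proj V M N \<cdot> (lact M \<^bold>\<otimes> Ident V (bobj N))
    \<cdot> inverse_of V (asc V (mobj (bsrc M)) (bobj M) (bobj N))"
  have l: "lact (M \<odot> N) = descend V (Ident V (mobj (bsrc M)) \<^bold>\<otimes> rel_proj V M N) ?k"
    by (simp add: rel_tensor_def Let_def)
  have k: "?k \<bullet> (x \<parallel> (m \<parallel> n)) = tp M N (lop M x m) n"
    if "x \<in> lscal M" "m \<in> elts M" "n \<in> elts N" for x m n
    using that by (simp add: tp_def lop_def)
  have h: "?k \<in> Hom V (mobj (bsrc M) \<boxtimes> (bobj M \<boxtimes> bobj N)) (rel_obj V M N)" by (simp add: Hom_def)
  have b: "?k \<bullet> (x \<parallel> (rop M m y \<parallel> n)) = ?k \<bullet> (x \<parallel> (m \<parallel> lop N y n))"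
    if "x \<in> lscal M" "m \<in> elts M" "y \<in> lscal N" "n \<in> elts N" for x m y n
    using that by (simp add: k del: app_comp flip: bimod_middle)
  have a: "mobj (bsrc M) \<in> Obj V" by simp
  show "lact (M \<odot> N) \<in> Hom V (mobj (bsrc M) \<boxtimes> rel_obj V M N) (rel_obj V M N)"
    unfolding l by (rule descend_ident_tens_rel(1)[OF M N c a h b])
  show "lop (M \<odot> N) x (tp M N m n) = tp M N (lop M x m) n"
    if x: "x \<in> lscal M" "m \<in> elts M" "n \<in> elts N" for x m n
    unfolding lop_def[of "M \<odot> N"] l
    by (rule trans[OF descend_ident_tens_rel(2)[OF M N c a h _ x] k[OF x]]) (rule b)
qed

lemma rel_tensor_right:
  assumes M: "is_bimod V M" and N: "is_bimod V N" and c: "btrg M = bsrc N"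
  shows "ract (M \<odot> N) \<in> Hom V (rel_obj V M N \<boxtimes> mobj (btrg N)) (rel_obj V M N)"
    "\<And>m n y. m \<in> elts M \<Longrightarrow> n \<in> elts N \<Longrightarrow> y \<in> rscal N
      \<Longrightarrow> rop (M \<odot> N) (tp M N m n) y = tp M N m (rop N n y)"
proof -
  note [simp] = M N c is_bimod_typing[OF M] is_bimod_typing[OF N]
  let ?k = "rel_proj V M N \<cdot> (Ident V (bobj M) \<^bold>\<otimes> ract N) \<cdot> asc V (bobj M) (bobj N) (mobj (btrg N))"
  have r: "ract (M \<odot> N) = descend V (rel_proj V M N \<^bold>\<otimes> Ident V (mobj (btrg N))) ?k"
    by (simp add: rel_tensor_def Let_def)
  have k: "?k \<bullet> ((m \<parallel> n) \<parallel> y) = tp M N m (rop N n y)"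
    if "y \<in> rscal N" "m \<in> elts M" "n \<in> elts N" for y m n
    using that by (simp add: tp_def rop_def)
  have h: "?k \<in> Hom V ((bobj M \<boxtimes> bobj N) \<boxtimes> mobj (btrg N)) (rel_obj V M N)" by (simp add: Hom_def)
  have b: "?k \<bullet> ((rop M m y \<parallel> n) \<parallel> x) = ?k \<bullet> ((m \<parallel> lop N y n) \<parallel> x)"
    if "x \<in> rscal N" "m \<in> elts M" "y \<in> lscal N" "n \<in> elts N" for x m y n
    using that by (simp add: k del: app_comp)
  have a: "mobj (btrg N) \<in> Obj V" by simp
  show "ract (M \<odot> N) \<in> Hom V (rel_obj V M N \<boxtimes> mobj (btrg N)) (rel_obj V M N)"
    unfolding r by (rule descend_tens_ident_rel(1)[OF M N c a h b])
  show "rop (M \<odot> N) (tp M N m n) y = tp M N m (rop N n y)"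
    if x: "m \<in> elts M" "n \<in> elts N" "y \<in> rscal N" for m n y
    unfolding rop_def[of "M \<odot> N"] r
    by (rule trans[OF descend_tens_ident_rel(2)[OF M N c a h _ x(3,1,2)] k[OF x(3,1,2)]]) (rule b)
qed

lemmas rel_tensor_ops [simp] = rel_tensor_left(2) rel_tensor_right(2)

lemma rel_tensor_bimod [simp]:
  assumes M: "is_bimod V M" and N: "is_bimod V N" and c: "btrg M = bsrc N"
  shows "is_bimod V (M \<odot> N)"
proof (rule is_bimodI)
  note [simp] = M N c
  let ?m = "tp M N (bgen M) (bgen N)"
  show "?m \<in> dense (bobj (M \<odot> N))" by simp
  show "lact (M \<odot> N) \<in> Hom V (mobj (bsrc (M \<odot> N)) \<boxtimes> bobj (M \<odot> N)) (bobj (M \<odot> N))"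
    "ract (M \<odot> N) \<in> Hom V (bobj (M \<odot> N) \<boxtimes> mobj (btrg (M \<odot> N))) (bobj (M \<odot> N))"
    using rel_tensor_left(1)[OF M N c] rel_tensor_right(1)[OF M N c] by simp_all
  show "lop (M \<odot> N) (mop (bsrc (M \<odot> N)) x y) ?m = lop (M \<odot> N) x (lop (M \<odot> N) y ?m)"
    if "x \<in> El (mobj (bsrc (M \<odot> N)))" "y \<in> El (mobj (bsrc (M \<odot> N)))" for x y using that by simp
  show "rop (M \<odot> N) (rop (M \<odot> N) ?m x) y = rop (M \<odot> N) ?m (mop (btrg (M \<odot> N)) x y)"
    if "x \<in> El (mobj (btrg (M \<odot> N)))" "y \<in> El (mobj (btrg (M \<odot> N)))" for x y using that by simp
  show "rop (M \<odot> N) (lop (M \<odot> N) x ?m) y = lop (M \<odot> N) x (rop (M \<odot> N) ?m y)"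
    if "x \<in> El (mobj (bsrc (M \<odot> N)))" "y \<in> El (mobj (btrg (M \<odot> N)))" for x y using that by simp
qed (use assms in \<open>simp_all add: is_bimod_mon(1)[OF M]\<close>)

text \<open>The middle monoid homomorphism \<open>\<beta>\<close> is shared by \<open>f\<close> and \<open>g\<close>, which is exactly what makes \<open>f \<otimes> g\<close>
  balanced: \<open>f(m y) \<otimes> g(n) = f(m) \<otimes> \<beta>(y) g(n) = f(m) \<otimes> g(y n)\<close>.\<close>
lemma rel_map:
  assumes M: "is_bimod V M" and N: "is_bimod V N" and c: "btrg M = bsrc N"
    and M': "is_bimod V M'" and N': "is_bimod V N'" and c': "btrg M' = bsrc N'"
    and f: "equivariant \<alpha> \<beta> M M' f" and g: "equivariant \<beta> \<gamma> N N' g"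
  shows "rel_map V M N M' N' f g \<in> Hom V (rel_obj V M N) (rel_obj V M' N')"
    "\<And>m n. m \<in> elts M \<Longrightarrow> n \<in> elts N
      \<Longrightarrow> rel_map V M N M' N' f g \<bullet> tp M N m n = tp M' N' (f \<bullet> m) (g \<bullet> n)"
    "equivariant \<alpha> \<gamma> (M \<odot> N) (M' \<odot> N') (rel_map V M N M' N' f g)"
proof -
  note [simp] = M N c M' N' c' equivariantD[OF f M M'] equivariantD[OF g N N']
  let ?k = "rel_proj V M' N' \<cdot> (f \<^bold>\<otimes> g)"
  have k: "?k \<bullet> (m \<parallel> n) = tp M' N' (f \<bullet> m) (g \<bullet> n)" if "m \<in> elts M" "n \<in> elts N" for m n
    using that by (simp add: tp_def)
  have h: "?k \<in> Hom V (bobj M \<boxtimes> bobj N) (rel_obj V M' N')" by (simp add: Hom_def)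
  note m0 = gen_dense[OF is_bimod_typing(3)[OF M]] and n0 = gen_dense[OF is_bimod_typing(3)[OF N]]
  have b: "?k \<bullet> (rop M m y \<parallel> n) = ?k \<bullet> (m \<parallel> lop N y n)"
    if "m \<in> elts M" "y \<in> lscal N" "n \<in> elts N" for m y n
    using that by (simp add: k del: app_comp)
  show 1: "rel_map V M N M' N' f g \<in> Hom V (rel_obj V M N) (rel_obj V M' N')"
    unfolding rel_map_def by (rule descend_rel(1)[OF M N c h m0 n0 b]) (simp_all add: dense_El)
  show 2: "rel_map V M N M' N' f g \<bullet> tp M N m n = tp M' N' (f \<bullet> m) (g \<bullet> n)"
    if x: "m \<in> elts M" "n \<in> elts N" for m n
    unfolding rel_map_def
    by (rule trans[OF descend_rel(2)[OF M N c h m0 n0 _ x] k[OF x]]) (rule b, simp_all add: dense_El)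
  note [simp] = 1[THEN HomD] 2
  show "equivariant \<alpha> \<gamma> (M \<odot> N) (M' \<odot> N') (rel_map V M N M' N' f g)"
    by (rule equivariantI[of _ _ _ _ _ "tp M N (bgen M) (bgen N)"]) (simp_all add: Hom_def)
qed

end

section \<open>Associators and unitors\<close>

context bimodule_setting
begin

lemma inverse_pairI:
  assumes f: "f \<in> Hom V X Y" and g: "g \<in> Hom V Y X" and x: "x \<in> dense X" and y: "y \<in> dense Y"
    and "g \<bullet> f \<bullet> x = x" "f \<bullet> g \<bullet> y = y"
  shows "inverse_pair V f g"
proof -
  note [simp] = f[THEN HomD] g[THEN HomD] dense_El[OF x] dense_El[OF y]
  have o: "X \<in> Obj V" "Y \<in> Obj V" using hom_obj[OF f] by auto
  have "g \<cdot> f = Ident V X" "f \<cdot> g = Ident V Y"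
    using assms(5,6) comp_in[OF f g] comp_in[OF g f] o ident_in
    by (auto intro: dense_ext[OF x] dense_ext[OF y])
  then show ?thesis using g by (simp add: inverse_pair_def)
qed

lemma unit_bimod_simps [simp]:
  "bsrc (unit_bimod A) = A" "btrg (unit_bimod A) = A" "bobj (unit_bimod A) = mobj A"
  "lop (unit_bimod A) = mop A" "rop (unit_bimod A) = mop A"
  by (auto simp: unit_bimod_def lop_def rop_def mop_def fun_eq_iff)

lemma unit_bimod [simp]: "is_mon V A \<Longrightarrow> is_bimod V (unit_bimod A)"
  unfolding is_mon_def is_bimod_def unit_bimod_def Let_def by simp

lemma mon_hom_equivariant:
  assumes "is_mon V A" "is_mon V B" "mon_hom V A B f"
  shows "equivariant f f (unit_bimod A) (unit_bimod B) f"
  using assms unfolding equivariant_def mon_hom_def unit_bimod_def by simp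

text \<open>The factorization is found in two steps, first through \<open>M \<odot> N\<close> tensored with \<open>P\<close> and then through
  \<open>(M \<odot> N) \<odot> P\<close>; uniqueness for the composite projection identifies it with the associator.\<close>
lemma rel_assoc:
  assumes M: "is_bimod V M" and N: "is_bimod V N" and P: "is_bimod V P"
    and c: "btrg M = bsrc N" and c': "btrg N = bsrc P"
  shows "rel_assoc V M N P \<in> Hom V (rel_obj V (M \<odot> N) P) (rel_obj V M (N \<odot> P))"
    "\<And>m n p. m \<in> elts M \<Longrightarrow> n \<in> elts N \<Longrightarrow> p \<in> elts P \<Longrightarrow>
      rel_assoc V M N P \<bullet> tp (M \<odot> N) P (tp M N m n) p = tp M (N \<odot> P) m (tp N P n p)"
proof -
  note [simp] = M N P c c'
  let ?e = "rel_proj V (M \<odot> N) P \<cdot> (rel_proj V M N \<^bold>\<otimes> Ident V (bobj P))"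
  let ?k = "rel_proj V M (N \<odot> P) \<cdot> (Ident V (bobj M) \<^bold>\<otimes> rel_proj V N P) \<cdot> asc V (bobj M) (bobj N) (bobj P)"
  let ?Z = "rel_obj V M (N \<odot> P)"
  have k: "?k \<bullet> ((m \<parallel> n) \<parallel> p) = tp M (N \<odot> P) m (tp N P n p)"
    if "p \<in> elts P" "m \<in> elts M" "n \<in> elts N" for m n p
    using that by (simp add: tp_def)
  have kh: "?k \<in> Hom V ((bobj M \<boxtimes> bobj N) \<boxtimes> bobj P) ?Z" by (simp add: Hom_def)
  have kb: "?k \<bullet> ((rop M m y \<parallel> n) \<parallel> p) = ?k \<bullet> ((m \<parallel> lop N y n) \<parallel> p)"
    if "p \<in> elts P" "m \<in> elts M" "y \<in> lscal N" "n \<in> elts N" for m n p y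
    using that by (simp add: k del: app_comp)
  define h1 where "h1 = descend V (rel_proj V M N \<^bold>\<otimes> Ident V (bobj P)) ?k"
  have h1: "h1 \<in> Hom V (rel_obj V M N \<boxtimes> bobj P) ?Z"
    unfolding h1_def by (rule descend_tens_ident_rel(1)[OF M N c _ kh kb]) simp
  have h1_app: "h1 \<bullet> (tp M N m n \<parallel> p) = tp M (N \<odot> P) m (tp N P n p)"
    if x: "p \<in> elts P" "m \<in> elts M" "n \<in> elts N" for m n p
    unfolding h1_def
    by (rule trans[OF descend_tens_ident_rel(2)[OF M N c _ kh _ x] k[OF x]]) (simp, rule kb)
  have MN: "is_bimod V (M \<odot> N)" "btrg (M \<odot> N) = bsrc P" by simp_all
  have h1': "h1 \<in> Hom V (bobj (M \<odot> N) \<boxtimes> bobj P) ?Z" using h1 by simp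
  have h1b: "h1 \<bullet> (rop (M \<odot> N) (tp M N (bgen M) (bgen N)) y \<parallel> bgen P)
      = h1 \<bullet> (tp M N (bgen M) (bgen N) \<parallel> lop P y (bgen P))"
    if "y \<in> lscal P" for y
    using that by (simp add: h1_app)
  define h where "h = descend V (rel_proj V (M \<odot> N) P) h1"
  have h: "h \<in> Hom V (rel_obj V (M \<odot> N) P) ?Z"
    unfolding h_def by (rule descend_rel(1)[OF MN(1) P MN(2) h1' _ _ h1b]) simp_all
  have h_app: "h \<bullet> tp (M \<odot> N) P (tp M N m n) p = tp M (N \<odot> P) m (tp N P n p)"
    if x: "p \<in> elts P" "m \<in> elts M" "n \<in> elts N" for m n p
    unfolding h_def
    using descend_rel(2)[OF MN(1) P MN(2) h1' _ _ h1b, of "tp M N m n" p] x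
    by (simp add: h1_app)
  have e: "epi ?e" by (intro epi_comp epi_tens_ident rel_proj_epi) simp_all
  \<comment> \<open>this identifies \<open>h\<close> with the factorization through the composite projection\<close>
  have "h \<cdot> ?e = ?k"
    by (rule dense_ext[of "(bgen M \<parallel> bgen N) \<parallel> bgen P" _ _ _ ?Z, OF _ _ _ kh])
      (use h_app[unfolded tp_def] in \<open>simp_all add: Hom_def h[THEN HomD]\<close>)
  then have eq: "rel_assoc V M N P = h"
    unfolding rel_assoc_def using h by (intro descend_eq[OF e, of _ ?Z]) simp_all
  show "rel_assoc V M N P \<in> Hom V (rel_obj V (M \<odot> N) P) ?Z" using h eq by simp
  show "rel_assoc V M N P \<bullet> tp (M \<odot> N) P (tp M N m n) p = tp M (N \<odot> P) m (tp N P n p)"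
    if "m \<in> elts M" "n \<in> elts N" "p \<in> elts P" for m n p
    using h_app that eq by simp
qed

text \<open>The inverse is built in the same two steps from the other bracketing.\<close>
lemma rel_assoc_iso:
  assumes M: "is_bimod V M" and N: "is_bimod V N" and P: "is_bimod V P"
    and c: "btrg M = bsrc N" and c': "btrg N = bsrc P"
  shows "invertible V (rel_assoc V M N P)"
proof -
  note [simp] = M N P c c' rel_assoc(2)[OF M N P c c']
  let ?k = "rel_proj V (M \<odot> N) P \<cdot> (rel_proj V M N \<^bold>\<otimes> Ident V (bobj P))
    \<cdot> inverse_of V (asc V (bobj M) (bobj N) (bobj P))"
  let ?Z = "rel_obj V (M \<odot> N) P"
  have k: "?k \<bullet> (m \<parallel> (n \<parallel> p)) = tp (M \<odot> N) P (tp M N m n) p"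
    if "m \<in> elts M" "n \<in> elts N" "p \<in> elts P" for m n p
    using that by (simp add: tp_def)
  have kh: "?k \<in> Hom V (bobj M \<boxtimes> (bobj N \<boxtimes> bobj P)) ?Z" by (simp add: Hom_def)
  have kb: "?k \<bullet> (m \<parallel> (rop N n y \<parallel> p)) = ?k \<bullet> (m \<parallel> (n \<parallel> lop P y p))"
    if "m \<in> elts M" "n \<in> elts N" "y \<in> lscal P" "p \<in> elts P" for m n p y
    using that by (simp add: k del: app_comp flip: rel_tensor_right(2))
  define h1 where "h1 = descend V (Ident V (bobj M) \<^bold>\<otimes> rel_proj V N P) ?k"
  have h1: "h1 \<in> Hom V (bobj M \<boxtimes> rel_obj V N P) ?Z"
    unfolding h1_def by (rule descend_ident_tens_rel(1)[OF N P c' _ kh kb]) simp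
  have h1_app: "h1 \<bullet> (m \<parallel> tp N P n p) = tp (M \<odot> N) P (tp M N m n) p"
    if x: "m \<in> elts M" "n \<in> elts N" "p \<in> elts P" for m n p
    unfolding h1_def
    by (rule trans[OF descend_ident_tens_rel(2)[OF N P c' _ kh _ x] k[OF x]]) (simp, rule kb)
  have NP: "is_bimod V (N \<odot> P)" "btrg M = bsrc (N \<odot> P)" by simp_all
  have h1': "h1 \<in> Hom V (bobj M \<boxtimes> bobj (N \<odot> P)) ?Z" using h1 by simp
  have h1b: "h1 \<bullet> (rop M (bgen M) y \<parallel> tp N P (bgen N) (bgen P))
      = h1 \<bullet> (bgen M \<parallel> lop (N \<odot> P) y (tp N P (bgen N) (bgen P)))"
    if "y \<in> El (mobj (bsrc (N \<odot> P)))" for y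
    using that by (simp add: h1_app)
  define h where "h = descend V (rel_proj V M (N \<odot> P)) h1"
  have h: "h \<in> Hom V (rel_obj V M (N \<odot> P)) ?Z"
    unfolding h_def by (rule descend_rel(1)[OF M NP h1' _ _ h1b]) simp_all
  have h_app: "h \<bullet> tp M (N \<odot> P) m (tp N P n p) = tp (M \<odot> N) P (tp M N m n) p"
    if x: "p \<in> elts P" "m \<in> elts M" "n \<in> elts N" for m n p
    unfolding h_def
    using descend_rel(2)[OF M NP h1' _ _ h1b, of m "tp N P n p"] x
    by (simp add: h1_app)
  have "inverse_pair V (rel_assoc V M N P) h"
    by (rule inverse_pairI[OF rel_assoc(1)[OF M N P c c'] h,
        of "tp (M \<odot> N) P (tp M N (bgen M) (bgen N)) (bgen P)"
          "tp M (N \<odot> P) (bgen M) (tp N P (bgen N) (bgen P))"])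
      (simp_all add: h_app)
  then show ?thesis unfolding invertible_def by blast
qed

lemma rel_assoc_simps [simp]:
  assumes M: "is_bimod V M" and N: "is_bimod V N" and P: "is_bimod V P"
    and c: "btrg M = bsrc N" and c': "btrg N = bsrc P"
  shows "rel_assoc V M N P \<in> Arr V" "Dom V (rel_assoc V M N P) = rel_obj V (M \<odot> N) P"
    "Cod V (rel_assoc V M N P) = rel_obj V M (N \<odot> P)" "invertible V (rel_assoc V M N P)"
    "\<And>m n p. m \<in> elts M \<Longrightarrow> n \<in> elts N \<Longrightarrow> p \<in> elts P \<Longrightarrow>
      rel_assoc V M N P \<bullet> tp (M \<odot> N) P (tp M N m n) p = tp M (N \<odot> P) m (tp N P n p)"
    "\<And>m n p. m \<in> elts M \<Longrightarrow> n \<in> elts N \<Longrightarrow> p \<in> elts P \<Longrightarrow>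
      inverse_of V (rel_assoc V M N P) \<bullet> tp M (N \<odot> P) m (tp N P n p) = tp (M \<odot> N) P (tp M N m n) p"
proof -
  note [simp] = rel_assoc(1)[OF assms, THEN HomD] rel_assoc_iso[OF assms] rel_assoc(2)[OF assms] assms
  show "rel_assoc V M N P \<in> Arr V" "Dom V (rel_assoc V M N P) = rel_obj V (M \<odot> N) P"
    "Cod V (rel_assoc V M N P) = rel_obj V M (N \<odot> P)" "invertible V (rel_assoc V M N P)" by simp_all
  show "rel_assoc V M N P \<bullet> tp (M \<odot> N) P (tp M N m n) p = tp M (N \<odot> P) m (tp N P n p)"
    "inverse_of V (rel_assoc V M N P) \<bullet> tp M (N \<odot> P) m (tp N P n p) = tp (M \<odot> N) P (tp M N m n) p"
    if "m \<in> elts M" "n \<in> elts N" "p \<in> elts P" for m n p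
    using that by (auto intro: app_inverse_of)
qed

lemma rel_assoc_equivariant:
  assumes M: "is_bimod V M" and N: "is_bimod V N" and P: "is_bimod V P"
    and c: "btrg M = bsrc N" and c': "btrg N = bsrc P"
  shows "equivariant (Ident V (mobj (bsrc M))) (Ident V (mobj (btrg P)))
    ((M \<odot> N) \<odot> P) (M \<odot> (N \<odot> P)) (rel_assoc V M N P)"
proof -
  note [simp] = assms
  show ?thesis
    by (rule equivariantI[of _ _ _ _ _ "tp (M \<odot> N) P (tp M N (bgen M) (bgen N)) (bgen P)"])
      (simp_all add: Hom_def)
qed

text \<open>The inverse of the left unitor inserts the unit: \<open>m \<mapsto> 1 \<otimes> m\<close>.\<close>
lemma rel_lunit_simps [simp]:
  assumes M: "is_bimod V M"
  shows "rel_lunit V M \<in> Arr V" "Dom V (rel_lunit V M) = rel_obj V (unit_bimod (bsrc M)) M"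
    "Cod V (rel_lunit V M) = bobj M" "invertible V (rel_lunit V M)"
    "\<And>x m. x \<in> lscal M \<Longrightarrow> m \<in> elts M \<Longrightarrow>
      rel_lunit V M \<bullet> tp (unit_bimod (bsrc M)) M x m = lop M x m"
    "\<And>m. m \<in> elts M \<Longrightarrow>
      inverse_of V (rel_lunit V M) \<bullet> m = tp (unit_bimod (bsrc M)) M (mun (bsrc M)) m"
proof -
  let ?U = "unit_bimod (bsrc M)"
  note [simp] = M is_bimod_typing[OF M] is_mon_typing[OF is_bimod_typing(1)[OF M]]
  have U: "is_bimod V ?U" "btrg ?U = bsrc M" by simp_all
  have k: "lact M \<in> Hom V (bobj ?U \<boxtimes> bobj M) (bobj M)" by (simp add: Hom_def)
  have b: "lact M \<bullet> (rop ?U (bgen ?U) y \<parallel> bgen M) = lact M \<bullet> (bgen ?U \<parallel> lop M y (bgen M))"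
    if "y \<in> lscal M" for y
    using that by (simp flip: lop_def)
  have h: "rel_lunit V M \<in> Hom V (rel_obj V ?U M) (bobj M)"
    unfolding rel_lunit_def by (rule descend_rel(1)[OF U(1) M U(2) k _ _ b]) simp_all
  then show [simp]: "rel_lunit V M \<in> Arr V" "Dom V (rel_lunit V M) = rel_obj V ?U M"
    "Cod V (rel_lunit V M) = bobj M" by (auto simp: Hom_def)
  show [simp]: "rel_lunit V M \<bullet> tp ?U M x m = lop M x m"
    if x: "x \<in> lscal M" "m \<in> elts M" for x m
    using descend_rel(2)[OF U(1) M U(2) k _ _ b, of x m] x
    by (simp add: lop_def rel_lunit_def)
  let ?g = "rel_proj V ?U M \<cdot> (munit (bsrc M) \<^bold>\<otimes> Ident V (bobj M)) \<cdot> inverse_of V (lun V (bobj M))"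
  have g: "?g \<bullet> m = tp ?U M (mun (bsrc M)) m" if "m \<in> elts M" for m
    using that by (simp add: tp_def mun_def)
  have gh: "?g \<in> Hom V (bobj M) (rel_obj V ?U M)" by (simp add: Hom_def)
  \<comment> \<open>the rewrite rule for balanced tensors is used against its direction: \<open>1 \<otimes> x m = x \<otimes> m\<close>\<close>
  have bal: "tp ?U M (mun (bsrc M)) (lop M x m) = tp ?U M x m"
    if "x \<in> lscal M" "m \<in> elts M" for x m
    using tp_balanced[of ?U M "mun (bsrc M)" x m] that by (simp del: tp_balanced)
  have "inverse_pair V (rel_lunit V M) ?g"
    by (rule inverse_pairI[OF h gh, of "tp ?U M (gen (mobj (bsrc M))) (bgen M)" "bgen M"])
      (simp_all add: g bal del: app_comp)
  then show [simp]: "invertible V (rel_lunit V M)" unfolding invertible_def by blast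
  show "inverse_of V (rel_lunit V M) \<bullet> m = tp ?U M (mun (bsrc M)) m" if "m \<in> elts M" for m
    using that by (intro app_inverse_of) simp_all
qed

lemma rel_runit_simps [simp]:
  assumes M: "is_bimod V M"
  shows "rel_runit V M \<in> Arr V" "Dom V (rel_runit V M) = rel_obj V M (unit_bimod (btrg M))"
    "Cod V (rel_runit V M) = bobj M" "invertible V (rel_runit V M)"
    "\<And>x m. x \<in> rscal M \<Longrightarrow> m \<in> elts M \<Longrightarrow>
      rel_runit V M \<bullet> tp M (unit_bimod (btrg M)) m x = rop M m x"
    "\<And>m. m \<in> elts M \<Longrightarrow>
      inverse_of V (rel_runit V M) \<bullet> m = tp M (unit_bimod (btrg M)) m (mun (btrg M))"
proof -
  let ?U = "unit_bimod (btrg M)"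
  note [simp] = M is_bimod_typing[OF M] is_mon_typing[OF is_bimod_typing(2)[OF M]]
  have U: "is_bimod V ?U" "btrg M = bsrc ?U" by simp_all
  have k: "ract M \<in> Hom V (bobj M \<boxtimes> bobj ?U) (bobj M)" by (simp add: Hom_def)
  have b: "ract M \<bullet> (rop M (bgen M) y \<parallel> bgen ?U) = ract M \<bullet> (bgen M \<parallel> lop ?U y (bgen ?U))"
    if "y \<in> lscal ?U" for y
    using that by (simp flip: rop_def)
  have h: "rel_runit V M \<in> Hom V (rel_obj V M ?U) (bobj M)"
    unfolding rel_runit_def by (rule descend_rel(1)[OF M U k _ _ b]) simp_all
  then show [simp]: "rel_runit V M \<in> Arr V" "Dom V (rel_runit V M) = rel_obj V M ?U"
    "Cod V (rel_runit V M) = bobj M" by (auto simp: Hom_def)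
  show [simp]: "rel_runit V M \<bullet> tp M ?U m x = rop M m x"
    if x: "x \<in> rscal M" "m \<in> elts M" for x m
    using descend_rel(2)[OF M U k _ _ b, of m x] x
    by (simp add: rop_def rel_runit_def)
  let ?g = "rel_proj V M ?U \<cdot> (Ident V (bobj M) \<^bold>\<otimes> munit (btrg M)) \<cdot> inverse_of V (run V (bobj M))"
  have g: "?g \<bullet> m = tp M ?U m (mun (btrg M))" if "m \<in> elts M" for m
    using that by (simp add: tp_def mun_def)
  have gh: "?g \<in> Hom V (bobj M) (rel_obj V M ?U)" by (simp add: Hom_def)
  have "inverse_pair V (rel_runit V M) ?g"
    by (rule inverse_pairI[OF h gh, of "tp M ?U (bgen M) (gen (mobj (btrg M)))" "bgen M"])
      (simp_all add: g del: app_comp)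
  then show [simp]: "invertible V (rel_runit V M)" unfolding invertible_def by blast
  show "inverse_of V (rel_runit V M) \<bullet> m = tp M ?U m (mun (btrg M))" if "m \<in> elts M" for m
    using that by (intro app_inverse_of) simp_all
qed

lemma rel_lunit_equivariant:
  assumes M: "is_bimod V M"
  shows "equivariant (Ident V (mobj (bsrc M))) (Ident V (mobj (btrg M))) (unit_bimod (bsrc M) \<odot> M) M (rel_lunit V M)"
proof -
  note [simp] = assms
  show ?thesis
    by (rule equivariantI[of _ _ _ _ _ "tp (unit_bimod (bsrc M)) M (gen (mobj (bsrc M))) (bgen M)"])
      (simp_all add: Hom_def)
qed

lemma rel_runit_equivariant:
  assumes M: "is_bimod V M"
  shows "equivariant (Ident V (mobj (bsrc M))) (Ident V (mobj (btrg M))) (M \<odot> unit_bimod (btrg M)) M (rel_runit V M)"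
proof -
  note [simp] = assms
  show ?thesis
    by (rule equivariantI[of _ _ _ _ _ "tp M (unit_bimod (btrg M)) (bgen M) (gen (mobj (btrg M)))"])
      (simp_all add: Hom_def)
qed

end

section \<open>The bicategory laws of bimodules\<close>

context bimodule_setting
begin

lemma equivariant_ident:
  "is_bimod V M \<Longrightarrow> equivariant (Ident V (mobj (bsrc M))) (Ident V (mobj (btrg M))) M M (Ident V (bobj M))"
  using is_bimod_typing[of M] by (simp add: equivariant_def Hom_def)

lemma rel_map_ident:
  assumes M: "is_bimod V M" and N: "is_bimod V N" and c: "btrg M = bsrc N"
  shows "rel_map V M N M N (Ident V (bobj M)) (Ident V (bobj N)) = Ident V (rel_obj V M N)"
proof -
  have g: "equivariant (Ident V (mobj (btrg M))) (Ident V (mobj (btrg N))) N N (Ident V (bobj N))"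
    using equivariant_ident[OF N] c by simp
  note r = rel_map[OF M N c M N c equivariant_ident[OF M] g]
  note [simp] = assms r(1)[THEN HomD] r(2)
  show ?thesis
    by (rule dense_ext[of "tp M N (bgen M) (bgen N)" "rel_obj V M N" _ _ "rel_obj V M N"])
      (simp_all add: Hom_def)
qed

lemma equivariant_comp:
  assumes M: "is_bimod V M" and N: "is_bimod V N" and P: "is_bimod V P"
    and f: "equivariant \<alpha> \<beta> M N f" and g: "equivariant \<alpha>' \<beta>' N P g"
  shows "equivariant (\<alpha>' \<cdot> \<alpha>) (\<beta>' \<cdot> \<beta>) M P (g \<cdot> f)"
proof -
  note [simp] = equivariantD[OF f M N] equivariantD[OF g N P] M N P
  show ?thesis by (rule equivariantI[OF M P, of _ _ _ "bgen M"]) (simp_all add: Hom_def)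
qed

lemma rel_map_comp:
  assumes M: "is_bimod V M" "is_bimod V M'" "is_bimod V M''"
    and N: "is_bimod V N" "is_bimod V N'" "is_bimod V N''"
    and c: "btrg M = bsrc N" "btrg M' = bsrc N'" "btrg M'' = bsrc N''"
    and f: "equivariant \<alpha> \<beta> M M' f" "equivariant \<alpha>' \<beta>' M' M'' f'"
    and g: "equivariant \<beta> \<gamma> N N' g" "equivariant \<beta>' \<gamma>' N' N'' g'"
  shows "rel_map V M N M'' N'' (f' \<cdot> f) (g' \<cdot> g)
    = rel_map V M' N' M'' N'' f' g' \<cdot> rel_map V M N M' N' f g"
proof -
  note r1 = rel_map[OF M(1) N(1) c(1) M(2) N(2) c(2) f(1) g(1)]
  note r2 = rel_map[OF M(2) N(2) c(2) M(3) N(3) c(3) f(2) g(2)]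
  note r3 = rel_map[OF M(1) N(1) c(1) M(3) N(3) c(3) equivariant_comp[OF M f] equivariant_comp[OF N g]]
  note [simp] = M N c r1(1)[THEN HomD] r1(2) r2(1)[THEN HomD] r2(2) r3(1)[THEN HomD] r3(2)
    equivariantD[OF f(1) M(1,2)] equivariantD[OF f(2) M(2,3)]
    equivariantD[OF g(1) N(1,2)] equivariantD[OF g(2) N(2,3)]
  show ?thesis
    by (rule dense_ext[of "tp M N (bgen M) (bgen N)" "rel_obj V M N" _ _ "rel_obj V M'' N''"])
      (simp_all add: Hom_def)
qed

text \<open>Stated for semilinear maps, so that it covers both naturality in 2-cells and equivariance of
  the associator with respect to induced actions.\<close>
lemma rel_assoc_natural:
  assumes M: "is_bimod V M" "is_bimod V M'" and N: "is_bimod V N" "is_bimod V N'"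
    and P: "is_bimod V P" "is_bimod V P'"
    and c: "btrg M = bsrc N" "btrg M' = bsrc N'" and d: "btrg N = bsrc P" "btrg N' = bsrc P'"
    and f: "equivariant \<alpha> \<beta> M M' f" and g: "equivariant \<beta> \<gamma> N N' g" and h: "equivariant \<gamma> \<delta> P P' h"
  shows "rel_assoc V M' N' P' \<cdot> rel_map V (M \<odot> N) P (M' \<odot> N') P' (rel_map V M N M' N' f g) h
    = rel_map V M (N \<odot> P) M' (N' \<odot> P') f (rel_map V N P N' P' g h) \<cdot> rel_assoc V M N P"
proof -
  note [simp] = M N P c d
  note r1 = rel_map[OF M(1) N(1) c(1) M(2) N(2) c(2) f g]
  note r2 = rel_map[OF N(1) P(1) d(1) N(2) P(2) d(2) g h]
  have MN: "is_bimod V (M \<odot> N)" "btrg (M \<odot> N) = bsrc P" "is_bimod V (M' \<odot> N')" "btrg (M' \<odot> N') = bsrc P'"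
    and NP: "is_bimod V (N \<odot> P)" "btrg M = bsrc (N \<odot> P)" "is_bimod V (N' \<odot> P')" "btrg M' = bsrc (N' \<odot> P')"
    by simp_all
  note r3 = rel_map[OF MN(1) P(1) MN(2,3) P(2) MN(4) r1(3) h]
  note r4 = rel_map[OF M(1) NP(1,2) M(2) NP(3,4) f r2(3)]
  note [simp] = r1(1)[THEN HomD] r1(2) r2(1)[THEN HomD] r2(2) r3(1)[THEN HomD] r3(2)
    r4(1)[THEN HomD] r4(2) equivariantD[OF f M] equivariantD[OF g N] equivariantD[OF h P]
  show ?thesis
    by (rule dense_ext[of "tp (M \<odot> N) P (tp M N (bgen M) (bgen N)) (bgen P)"
          "rel_obj V (M \<odot> N) P" _ _ "rel_obj V M' (N' \<odot> P')"])
      (simp_all add: Hom_def)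
qed

lemma rel_lunit_natural:
  assumes M: "is_bimod V M" "is_bimod V N" and f: "equivariant \<alpha> \<beta> M N f" and a: "mon_hom V (bsrc M) (bsrc N) \<alpha>"
  shows "rel_lunit V N \<cdot> rel_map V (unit_bimod (bsrc M)) M (unit_bimod (bsrc N)) N \<alpha> f = f \<cdot> rel_lunit V M"
proof -
  note [simp] = M
  have A: "is_mon V (bsrc M)" "is_mon V (bsrc N)" by simp_all
  note r = rel_map[OF unit_bimod[OF A(1)] M(1) _ unit_bimod[OF A(2)] M(2) _ mon_hom_equivariant[OF A a] f,
      simplified]
  note [simp] = r(1)[THEN HomD] r(2) equivariantD[OF f M]
  show ?thesis
    by (rule dense_ext[of "tp (unit_bimod (bsrc M)) M (gen (mobj (bsrc M))) (bgen M)"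
          "rel_obj V (unit_bimod (bsrc M)) M" _ _ "bobj N"])
      (simp_all add: Hom_def)
qed

lemma rel_runit_natural:
  assumes M: "is_bimod V M" "is_bimod V N" and f: "equivariant \<alpha> \<beta> M N f" and a: "mon_hom V (btrg M) (btrg N) \<beta>"
  shows "rel_runit V N \<cdot> rel_map V M (unit_bimod (btrg M)) N (unit_bimod (btrg N)) f \<beta> = f \<cdot> rel_runit V M"
proof -
  note [simp] = M
  have A: "is_mon V (btrg M)" "is_mon V (btrg N)" by simp_all
  note r = rel_map[OF M(1) unit_bimod[OF A(1)] _ M(2) unit_bimod[OF A(2)] _ f mon_hom_equivariant[OF A a],
      simplified]
  note [simp] = r(1)[THEN HomD] r(2) equivariantD[OF f M]
  show ?thesis
    by (rule dense_ext[of "tp M (unit_bimod (btrg M)) (bgen M) (gen (mobj (btrg M)))"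
          "rel_obj V M (unit_bimod (btrg M))" _ _ "bobj N"])
      (simp_all add: Hom_def)
qed

abbreviation bimod_hom where
  "bimod_hom M N f \<equiv> equivariant (Ident V (mobj (bsrc M))) (Ident V (mobj (btrg M))) M N f"

lemma rel_pentagon:
  assumes M: "is_bimod V M" and N: "is_bimod V N" and P: "is_bimod V P" and Q: "is_bimod V Q"
    and c: "btrg M = bsrc N" "btrg N = bsrc P" "btrg P = bsrc Q"
  shows "rel_assoc V M N (P \<odot> Q) \<cdot> rel_assoc V (M \<odot> N) P Q
    = rel_map V M ((N \<odot> P) \<odot> Q) M (N \<odot> (P \<odot> Q)) (Ident V (bobj M)) (rel_assoc V N P Q)
      \<cdot> rel_assoc V M (N \<odot> P) Q
      \<cdot> rel_map V ((M \<odot> N) \<odot> P) Q (M \<odot> (N \<odot> P)) Q (rel_assoc V M N P) (Ident V (bobj Q))"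
proof -
  note [simp] = M N P Q c
  note a1 = rel_assoc_equivariant[OF M N P c(1,2)] and a2 = rel_assoc_equivariant[OF N P Q c(2,3)]
  have m: "equivariant (Ident V (mobj (bsrc M))) (Ident V (mobj (bsrc N))) M M (Ident V (bobj M))"
    using equivariant_ident[OF M] by simp
  have q: "equivariant (Ident V (mobj (btrg P))) (Ident V (mobj (btrg Q))) Q Q (Ident V (bobj Q))"
    using equivariant_ident[OF Q] by simp
  note r1 = rel_map[OF M _ _ M _ _ m a2, simplified]
  note r2 = rel_map[OF _ Q _ _ Q _ a1 q, simplified]
  note [simp] = r1(1)[THEN HomD] r1(2) r2(1)[THEN HomD] r2(2)
  show ?thesis
    by (rule dense_ext[of "tp ((M \<odot> N) \<odot> P) Q (tp (M \<odot> N) P (tp M N (bgen M) (bgen N)) (bgen P)) (bgen Q)"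
          "rel_obj V ((M \<odot> N) \<odot> P) Q" _ _ "rel_obj V M (N \<odot> (P \<odot> Q))"])
      (simp_all add: Hom_def)
qed

lemma rel_triangle:
  assumes M: "is_bimod V M" and N: "is_bimod V N" and c: "btrg M = bsrc N"
  shows "rel_map V M (unit_bimod (bsrc N) \<odot> N) M N (Ident V (bobj M)) (rel_lunit V N)
      \<cdot> rel_assoc V M (unit_bimod (bsrc N)) N
    = rel_map V (M \<odot> unit_bimod (bsrc N)) N M N (rel_runit V M) (Ident V (bobj N))"
proof -
  note [simp] = M N c
  have m: "equivariant (Ident V (mobj (bsrc M))) (Ident V (mobj (bsrc N))) M M (Ident V (bobj M))"
    using equivariant_ident[OF M] by simp
  have r: "equivariant (Ident V (mobj (bsrc M))) (Ident V (mobj (bsrc N))) (M \<odot> unit_bimod (bsrc N)) M (rel_runit V M)"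
    using rel_runit_equivariant[OF M] by simp
  note r1 = rel_map[OF M _ _ M N _ m rel_lunit_equivariant[OF N], simplified]
  note r2 = rel_map[OF _ N _ M N _ r equivariant_ident[OF N], simplified]
  note r3 = rel_runit_simps[OF M, simplified c]
  note [simp] = r1(1)[THEN HomD] r1(2) r2(1)[THEN HomD] r2(2) r3
  show ?thesis
    by (rule dense_ext[of "tp (M \<odot> unit_bimod (bsrc N)) N (tp M (unit_bimod (bsrc N)) (bgen M) (gen (mobj (bsrc N)))) (bgen N)"
          "rel_obj V (M \<odot> unit_bimod (bsrc N)) N" _ _ "rel_obj V M N"])
      (simp_all add: Hom_def)
qed

lemma bimod_hom_inverse:
  assumes M: "is_bimod V M" and N: "is_bimod V N" and c: "bsrc M = bsrc N" "btrg M = btrg N"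
    and f: "bimod_hom M N f" and g: "inverse_pair V f g"
  shows "bimod_hom N M g"
proof -
  note [simp] = M N c equivariantD[OF f M N, simplified]
  have gt [simp]: "g \<in> Arr V" "Dom V g = bobj N" "Cod V g = bobj M"
    and gf: "g \<cdot> f = Ident V (bobj M)" "f \<cdot> g = Ident V (bobj N)"
    using g by (auto simp: inverse_pair_def Hom_def)
  have i [simp]: "g \<bullet> f \<bullet> x = x" if "x \<in> elts M" for x
    using that arg_cong[OF gf(1), of "\<lambda>f. f \<bullet> x"] by simp
  have j [simp]: "f \<bullet> g \<bullet> x = x" if "x \<in> elts N" for x
    using that arg_cong[OF gf(2), of "\<lambda>f. f \<bullet> x"] by simp
  let ?n = "bgen N"
  have [simp]: "?n \<in> elts N" by (auto intro: dense_El)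
  have l: "g \<bullet> lop N x ?n = lop M x (g \<bullet> ?n)" if "x \<in> lscal N" for x
  proof -
    have "g \<bullet> lop N x ?n = g \<bullet> f \<bullet> lop M x (g \<bullet> ?n)" using that by (simp del: i)
    also have "\<dots> = lop M x (g \<bullet> ?n)" by (rule i) (use that in simp)
    finally show ?thesis .
  qed
  have r: "g \<bullet> rop N ?n x = rop M (g \<bullet> ?n) x" if "x \<in> rscal N" for x
  proof -
    have "g \<bullet> rop N ?n x = g \<bullet> f \<bullet> rop M (g \<bullet> ?n) x" using that by (simp del: i)
    also have "\<dots> = rop M (g \<bullet> ?n) x" by (rule i) (use that in simp)
    finally show ?thesis .
  qed
  show ?thesis
    by (rule equivariantI[of _ _ _ _ _ ?n]) (simp_all add: l r Hom_def)
qed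

end

section \<open>Bicategories of bimodules with additional structure\<close>

text \<open>Composites, units and compatible maps in the bicategory that the parameters \<open>H\<close>, \<open>U\<close> and \<open>E\<close>
  determine.\<close>
definition gcomp :: "('o, 'a) monoidal_category \<Rightarrow> ('g, 'm) monoid_scheme
    \<Rightarrow> (('o, 'a, 'g) gcell \<Rightarrow> ('o, 'a, 'g) gcell \<Rightarrow> 'g \<Rightarrow> 'a)
    \<Rightarrow> ('o, 'a, 'g) gcell \<Rightarrow> ('o, 'a, 'g) gcell \<Rightarrow> ('o, 'a, 'g) gcell" where
  "gcomp V G H m n = \<lparr>gsrc = gsrc m, gtrg = gtrg n, gbim = rel_tensor V (gbim m) (gbim n),
     gstr = restrict (H m n) (carrier G)\<rparr>"

definition gunit :: "('g, 'm) monoid_scheme \<Rightarrow> (('o, 'a, 'g) gmon \<Rightarrow> 'g \<Rightarrow> 'a)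
    \<Rightarrow> ('o, 'a, 'g) gmon \<Rightarrow> ('o, 'a, 'g) gcell" where
  "gunit G U A = \<lparr>gsrc = A, gtrg = A, gbim = unit_bimod (fst A), gstr = restrict (U A) (carrier G)\<rparr>"

definition gmap :: "('o, 'a) monoidal_category
    \<Rightarrow> (('o, 'a, 'g) gcell \<Rightarrow> ('o, 'a, 'g) gcell \<Rightarrow> 'a \<Rightarrow> bool)
    \<Rightarrow> ('o, 'a, 'g) gcell \<Rightarrow> ('o, 'a, 'g) gcell \<Rightarrow> 'a \<Rightarrow> bool" where
  "gmap V E m n f \<longleftrightarrow> gsrc m = gsrc n \<and> gtrg m = gtrg n \<and> bimod_map V (gbim m) (gbim n) f \<and> E m n f"

lemma gcomp_simps [simp]:
  "gsrc (gcomp V G H m n) = gsrc m" "gtrg (gcomp V G H m n) = gtrg n"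
  "gbim (gcomp V G H m n) = rel_tensor V (gbim m) (gbim n)"
  "gstr (gcomp V G H m n) = restrict (H m n) (carrier G)"
  by (simp_all add: gcomp_def)

lemma gunit_simps [simp]:
  "gsrc (gunit G U A) = A" "gtrg (gunit G U A) = A"
  "gbim (gunit G U A) = unit_bimod (fst A)"
  "gstr (gunit G U A) = restrict (U A) (carrier G)"
  by (simp_all add: gunit_def)

lemma is_gcell_baseD:
  assumes "is_gcell_base V G m"
  shows "is_gmon V G (gsrc m)" "is_gmon V G (gtrg m)" "is_bimod V (gbim m)"
    "bsrc (gbim m) = fst (gsrc m)" "btrg (gbim m) = fst (gtrg m)" "gstr m \<in> extensional (carrier G)"
  using assms by (auto simp: is_gcell_base_def)

context
  fixes V :: "('o, 'a) monoidal_category"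
    and G :: "('g, 'm) monoid_scheme"
    and P :: "('o, 'a, 'g) gcell \<Rightarrow> bool"
    and E :: "('o, 'a, 'g) gcell \<Rightarrow> ('o, 'a, 'g) gcell \<Rightarrow> 'a \<Rightarrow> bool"
    and H :: "('o, 'a, 'g) gcell \<Rightarrow> ('o, 'a, 'g) gcell \<Rightarrow> 'g \<Rightarrow> 'a"
    and U :: "('o, 'a, 'g) gmon \<Rightarrow> 'g \<Rightarrow> 'a"
begin

private abbreviation (input) "B \<equiv> equivariant_bicategory V G P E H U"

lemma equivariant_bicategory_simps:
  "cells B = {A. is_gmon V G A}"
  "Obj (vert B) = {m. P m}"
  "Arr (vert B) = {t. P (tdom t) \<and> P (tcod t) \<and> gmap V E (tdom t) (tcod t) (tmap t)}"
  "Dom (vert B) = tdom"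
  "Cod (vert B) = tcod"
  "Ident (vert B) m = \<lparr>tdom = m, tcod = m, tmap = Ident V (bobj (gbim m))\<rparr>"
  "s \<cdot>\<^bsub>vert B\<^esub> t = \<lparr>tdom = tdom t, tcod = tcod s, tmap = tmap s \<cdot>\<^bsub>V\<^esub> tmap t\<rparr>"
  "src B = gsrc"
  "trg B = gtrg"
  "unit1 B A = gunit G U A"
  "m \<diamondop>\<^bsub>B\<^esub> n = gcomp V G H m n"
  "t \<star>\<^bsub>B\<^esub> s = \<lparr>tdom = gcomp V G H (tdom t) (tdom s), tcod = gcomp V G H (tcod t) (tcod s),
    tmap = rel_map V (gbim (tdom t)) (gbim (tdom s)) (gbim (tcod t)) (gbim (tcod s)) (tmap t) (tmap s)\<rparr>"
  "bassoc B m n p = \<lparr>tdom = gcomp V G H (gcomp V G H m n) p, tcod = gcomp V G H m (gcomp V G H n p),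
        tmap = rel_assoc V (gbim m) (gbim n) (gbim p)\<rparr>"
  "blunit B m = \<lparr>tdom = gcomp V G H (gunit G U (gsrc m)) m, tcod = m, tmap = rel_lunit V (gbim m)\<rparr>"
  "brunit B m = \<lparr>tdom = gcomp V G H m (gunit G U (gtrg m)), tcod = m, tmap = rel_runit V (gbim m)\<rparr>"
  by (simp_all add: equivariant_bicategory_def Let_def gcomp_def gunit_def gmap_def)

lemma equivariant_cell1: "m \<in> cell1 B X Y \<longleftrightarrow> P m \<and> gsrc m = X \<and> gtrg m = Y"
  by (simp add: cell1_def equivariant_bicategory_simps)

lemma equivariant_cell2:
  "t \<in> cell2 B m n \<longleftrightarrow> P m \<and> P n \<and> tdom t = m \<and> tcod t = n \<and> gmap V E m n (tmap t)"
  by (auto simp: Hom_def equivariant_bicategory_simps)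

end

text \<open>All coherence laws of \<open>equivariant_bicategory\<close> are inherited from bimodules, as 2-cells with
  given source and target are determined by their underlying maps.  What has to be known about the
  families is closure: composites and units are 1-cells again, and the maps that occur as 2-cells
  are compatible with the families.\<close>
locale structured_bimodules = bimodule_setting V
  for V :: "('o, 'a) monoidal_category" (structure) +
  fixes G :: "('g, 'm) monoid_scheme"
    and P :: "('o, 'a, 'g) gcell \<Rightarrow> bool"
    and E :: "('o, 'a, 'g) gcell \<Rightarrow> ('o, 'a, 'g) gcell \<Rightarrow> 'a \<Rightarrow> bool"
    and H :: "('o, 'a, 'g) gcell \<Rightarrow> ('o, 'a, 'g) gcell \<Rightarrow> 'g \<Rightarrow> 'a"
    and U :: "('o, 'a, 'g) gmon \<Rightarrow> 'g \<Rightarrow> 'a"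
  assumes base: "P m \<Longrightarrow> is_gcell_base V G m"
    and P_comp: "P m \<Longrightarrow> P n \<Longrightarrow> gtrg m = gsrc n \<Longrightarrow> P (gcomp V G H m n)"
    and P_unit: "is_gmon V G A \<Longrightarrow> P (gunit G U A)"
    and E_ident: "P m \<Longrightarrow> E m m (Ident V (bobj (gbim m)))"
    and E_vcomp: "P m \<Longrightarrow> P n \<Longrightarrow> P p \<Longrightarrow> gmap V E m n f \<Longrightarrow> gmap V E n p g \<Longrightarrow> E m p (g \<cdot> f)"
    and E_inverse: "P m \<Longrightarrow> P n \<Longrightarrow> gmap V E m n f \<Longrightarrow> inverse_pair V f g \<Longrightarrow> E n m g"
    and E_hcomp: "P m \<Longrightarrow> P n \<Longrightarrow> P m' \<Longrightarrow> P n' \<Longrightarrow> gtrg m = gsrc n \<Longrightarrow> gmap V E m m' f \<Longrightarrow> gmap V E n n' g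
      \<Longrightarrow> E (gcomp V G H m n) (gcomp V G H m' n') (rel_map V (gbim m) (gbim n) (gbim m') (gbim n') f g)"
    and E_assoc: "P m \<Longrightarrow> P n \<Longrightarrow> P p \<Longrightarrow> gtrg m = gsrc n \<Longrightarrow> gtrg n = gsrc p
      \<Longrightarrow> E (gcomp V G H (gcomp V G H m n) p) (gcomp V G H m (gcomp V G H n p))
            (rel_assoc V (gbim m) (gbim n) (gbim p))"
    and E_lunit: "P m \<Longrightarrow> E (gcomp V G H (gunit G U (gsrc m)) m) m (rel_lunit V (gbim m))"
    and E_runit: "P m \<Longrightarrow> E (gcomp V G H m (gunit G U (gtrg m))) m (rel_runit V (gbim m))"
begin

abbreviation B where "B \<equiv> equivariant_bicategory V G P E H U"

lemma P_bimod [simp]: "P m \<Longrightarrow> is_bimod V (gbim m)" "P m \<Longrightarrow> bsrc (gbim m) = fst (gsrc m)"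
  "P m \<Longrightarrow> btrg (gbim m) = fst (gtrg m)" "P m \<Longrightarrow> is_gmon V G (gsrc m)" "P m \<Longrightarrow> is_gmon V G (gtrg m)"
  using base[of m] by (auto simp: is_gcell_base_def)

lemma gmap_equivariant:
  assumes "P m" "gmap V E m n f"
  shows "equivariant (Ident V (mobj (fst (gsrc m)))) (Ident V (mobj (fst (gtrg m)))) (gbim m) (gbim n) f"
    "gsrc m = gsrc n" "gtrg m = gtrg n" "E m n f"
  using assms(2) bimod_map_equivariant[OF P_bimod(1)[OF assms(1)], of "gbim n" f] P_bimod(2,3)[OF assms(1)]
  unfolding gmap_def by auto

lemma gmapI:
  assumes "P m" "equivariant (Ident V (mobj (fst (gsrc m)))) (Ident V (mobj (fst (gtrg m)))) (gbim m) (gbim n) f"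
    "gsrc m = gsrc n" "gtrg m = gtrg n" "E m n f" "P n"
  shows "gmap V E m n f"
  using assms(2-5) bimod_map_equivariant[OF P_bimod(1)[OF assms(1)], of "gbim n" f]
    P_bimod(2,3)[OF assms(1)] P_bimod(2,3)[OF assms(6)]
  unfolding gmap_def by auto

lemma gmon_mon [simp]: "is_gmon V G A \<Longrightarrow> is_mon V (fst A)"
  by (simp add: is_gmon_def)

lemma gmap_typing:
  assumes "P m" "P n" "gmap V E m n f"
  shows "f \<in> Arr V" "Dom V f = bobj (gbim m)" "Cod V f = bobj (gbim n)"
  using equivariantD[OF gmap_equivariant(1)[OF assms(1,3)]] assms by simp_all

lemma gmap_ident: "P m \<Longrightarrow> gmap V E m m (Ident V (bobj (gbim m)))"
  using equivariant_ident[of "gbim m"] by (intro gmapI E_ident) simp_all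

lemma gmap_comp:
  assumes m: "P m" "P n" "P p" and f: "gmap V E m n f" "gmap V E n p g"
  shows "gmap V E m p (g \<cdot> f)"
proof -
  note e = gmap_equivariant[OF m(1) f(1)] gmap_equivariant[OF m(2) f(2)]
  show ?thesis
    using equivariant_comp[OF _ _ _ e(1,5)] e(2,3,6,7) E_vcomp[OF m f] m by (intro gmapI) simp_all
qed

lemma gmap_inverse:
  assumes m: "P m" "P n" and f: "gmap V E m n f" and g: "inverse_pair V f g"
  shows "gmap V E n m g"
proof (rule gmapI)
  note e = gmap_equivariant[OF m(1) f]
  show "equivariant (Ident V (mobj (fst (gsrc n)))) (Ident V (mobj (fst (gtrg n)))) (gbim n) (gbim m) g"
    using bimod_hom_inverse[of "gbim m" "gbim n" f g] e m g by simp
  show "E n m g" by (rule E_inverse[OF m f g])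
qed (use m gmap_equivariant[OF m(1) f] in simp_all)

lemma gmap_hcomp:
  assumes m: "P m" "P n" "P m'" "P n'" and c: "gtrg m = gsrc n"
    and f: "gmap V E m m' f" and g: "gmap V E n n' g"
  shows "gmap V E (gcomp V G H m n) (gcomp V G H m' n') (rel_map V (gbim m) (gbim n) (gbim m') (gbim n') f g)"
proof -
  note e = gmap_equivariant[OF m(1) f] gmap_equivariant[OF m(2) g]
  have c': "gtrg m' = gsrc n'" using c e by simp
  note [simp] = m c c'
  note r = rel_map[OF _ _ _ _ _ _ e(1)[unfolded c] e(5), simplified]
  show ?thesis
    by (rule gmapI[OF P_comp[OF m(1,2) c] _ _ _ E_hcomp[OF m c f g] P_comp[OF m(3,4) c']])
      (use r(3) e in simp_all)
qed

lemma invertible_2cell: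
  assumes "P (tdom t)" "P (tcod t)" "gmap V E (tdom t) (tcod t) (tmap t)" "invertible V (tmap t)"
  shows "invertible (vert B) t"
proof -
  obtain g where g: "inverse_pair V (tmap t) g" using assms(4) by (auto simp: invertible_def)
  note t = gmap_typing[OF assms(1-3)]
  have "inverse_pair (vert B) t \<lparr>tdom = tcod t, tcod = tdom t, tmap = g\<rparr>"
    using assms gmap_inverse[OF assms(1-3) g] g t
    by (simp add: inverse_pair_def equivariant_bicategory_simps Hom_def)
  then show ?thesis by (auto simp: invertible_def)
qed

lemma vertical_category: "category (vert B)"
proof (rule category.intro)
  note [simp] = equivariant_bicategory_simps equivariant_cell2 gmap_ident gmap_typing
  show "Dom (vert B) f \<in> Obj (vert B)" "Cod (vert B) f \<in> Obj (vert B)" if "f \<in> Arr (vert B)" for f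
    using that by simp_all
  show "Ident (vert B) X \<in> cell2 B X X" if "X \<in> Obj (vert B)" for X
    using that by simp
  show "g \<cdot>\<^bsub>vert B\<^esub> f \<in> cell2 B X Z" if "f \<in> cell2 B X Y" "g \<in> cell2 B Y Z" for f g X Y Z
    using that by (auto intro: gmap_comp)
  show "f \<cdot>\<^bsub>vert B\<^esub> Ident (vert B) X = f" "Ident (vert B) Y \<cdot>\<^bsub>vert B\<^esub> f = f"
    if "f \<in> cell2 B X Y" for f X Y
    using that gmap_typing[of X Y "tmap f"] by (auto intro!: gcell2.equality)
  show "(h \<cdot>\<^bsub>vert B\<^esub> g) \<cdot>\<^bsub>vert B\<^esub> f = h \<cdot>\<^bsub>vert B\<^esub> (g \<cdot>\<^bsub>vert B\<^esub> f)"
    if "f \<in> cell2 B W X" "g \<in> cell2 B X Y" "h \<in> cell2 B Y Z" for f g h W X Y Z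
    using that gmap_typing[of W X "tmap f"] gmap_typing[of X Y "tmap g"] gmap_typing[of Y Z "tmap h"]
    by auto
qed

lemma gmap_assoc:
  assumes "P m" "P n" "P p" "gtrg m = gsrc n" "gtrg n = gsrc p"
  shows "gmap V E (gcomp V G H (gcomp V G H m n) p) (gcomp V G H m (gcomp V G H n p))
            (rel_assoc V (gbim m) (gbim n) (gbim p))"
  using assms rel_assoc_equivariant[of "gbim m" "gbim n" "gbim p"]
  by (intro gmapI E_assoc) (simp_all add: P_comp)

lemma gmap_lunit:
  assumes "P m"
  shows "gmap V E (gcomp V G H (gunit G U (gsrc m)) m) m (rel_lunit V (gbim m))"
  using assms rel_lunit_equivariant[of "gbim m"]
  by (intro gmapI E_lunit) (simp_all add: P_comp P_unit)

lemma gmap_runit: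
  assumes "P m"
  shows "gmap V E (gcomp V G H m (gunit G U (gtrg m))) m (rel_runit V (gbim m))"
  using assms rel_runit_equivariant[of "gbim m"]
  by (intro gmapI E_runit) (simp_all add: P_comp P_unit)

lemma gmap_ends: "gmap V E m n f \<Longrightarrow> gsrc n = gsrc m \<and> gtrg n = gtrg m"
  by (simp add: gmap_def)

lemma mon_hom_ident: "is_mon V A \<Longrightarrow> mon_hom V A A (Ident V (mobj A))"
  using is_mon_typing[of A] by (simp add: mon_hom_def Hom_def)

lemma bicategory: "bicategory B"
proof (rule bicategory.intro)
  note [simp] = equivariant_bicategory_simps equivariant_cell1 equivariant_cell2
    gmap_ident gmap_typing P_comp P_unit gmap_assoc gmap_lunit gmap_runit
  show "category (vert B)" by (rule vertical_category)
  show "src B M \<in> cells B" "trg B M \<in> cells B" if "M \<in> Obj (vert B)" for M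
    using that by simp_all
  show "src B M = src B N \<and> trg B M = trg B N" if "t \<in> cell2 B M N" for t M N
    using that by (simp add: gmap_def)
  show "unit1 B X \<in> cell1 B X X" if "X \<in> cells B" for X
    using that by simp
  show "M \<diamondop>\<^bsub>B\<^esub> N \<in> cell1 B X Z" if "M \<in> cell1 B X Y" "N \<in> cell1 B Y Z" for M N X Y Z
    using that by simp
  show "t \<star>\<^bsub>B\<^esub> s \<in> cell2 B (M \<diamondop>\<^bsub>B\<^esub> N) (M' \<diamondop>\<^bsub>B\<^esub> N')"
    if "M \<in> cell1 B X Y" "N \<in> cell1 B Y Z" "t \<in> cell2 B M M'" "s \<in> cell2 B N N'" for t s M N M' N' X Y Z
    using that gmap_ends[of M M' "tmap t"] gmap_ends[of N N' "tmap s"] by (auto intro: gmap_hcomp)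
  show "Ident (vert B) M \<star>\<^bsub>B\<^esub> Ident (vert B) N = Ident (vert B) (M \<diamondop>\<^bsub>B\<^esub> N)"
    if "M \<in> cell1 B X Y" "N \<in> cell1 B Y Z" for M N X Y Z
    using that by (simp add: rel_map_ident)
  show "(t' \<cdot>\<^bsub>vert B\<^esub> t) \<star>\<^bsub>B\<^esub> (s' \<cdot>\<^bsub>vert B\<^esub> s) = (t' \<star>\<^bsub>B\<^esub> s') \<cdot>\<^bsub>vert B\<^esub> (t \<star>\<^bsub>B\<^esub> s)"
    if a: "M \<in> cell1 B X Y" "N \<in> cell1 B Y Z" "t \<in> cell2 B M M'" "t' \<in> cell2 B M' M''"
      "s \<in> cell2 B N N'" "s' \<in> cell2 B N' N''" for t t' s s' M N M' N' M'' N'' X Y Z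
  proof -
    have g: "gmap V E M M' (tmap t)" "gmap V E M' M'' (tmap t')" "gmap V E N N' (tmap s)" "gmap V E N' N'' (tmap s')"
      and p [simp]: "P M" "P M'" "P M''" "P N" "P N'" "P N''" and c: "gtrg M = gsrc N" using a by auto
    note e = gmap_ends[OF g(1)] gmap_ends[OF g(2)] gmap_ends[OF g(3)] gmap_ends[OF g(4)]
    note q = gmap_equivariant(1)[OF p(1) g(1)] gmap_equivariant(1)[OF p(2) g(2)]
      gmap_equivariant(1)[OF p(4) g(3)] gmap_equivariant(1)[OF p(5) g(4)]
    have "rel_map V (gbim M) (gbim N) (gbim M'') (gbim N'') (tmap t' \<cdot> tmap t) (tmap s' \<cdot> tmap s)
      = rel_map V (gbim M') (gbim N') (gbim M'') (gbim N'') (tmap t') (tmap s')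
        \<cdot> rel_map V (gbim M) (gbim N) (gbim M') (gbim N') (tmap t) (tmap s)"
      by (rule rel_map_comp[OF _ _ _ _ _ _ _ _ _ q(1,2) q(3)[folded c] _]) (use q(4) e c in simp_all)
    then show ?thesis using a by simp
  qed
  show "bassoc B M N Q \<in> cell2 B ((M \<diamondop>\<^bsub>B\<^esub> N) \<diamondop>\<^bsub>B\<^esub> Q) (M \<diamondop>\<^bsub>B\<^esub> (N \<diamondop>\<^bsub>B\<^esub> Q))"
    "invertible (vert B) (bassoc B M N Q)"
    if "M \<in> cell1 B W X" "N \<in> cell1 B X Y" "Q \<in> cell1 B Y Z" for M N Q W X Y Z
    using that by (auto intro!: invertible_2cell)
  show "bassoc B M' N' Q' \<cdot>\<^bsub>vert B\<^esub> ((t \<star>\<^bsub>B\<^esub> s) \<star>\<^bsub>B\<^esub> r) = (t \<star>\<^bsub>B\<^esub> (s \<star>\<^bsub>B\<^esub> r)) \<cdot>\<^bsub>vert B\<^esub> bassoc B M N Q"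
    if a: "M \<in> cell1 B W X" "N \<in> cell1 B X Y" "Q \<in> cell1 B Y Z"
      "t \<in> cell2 B M M'" "s \<in> cell2 B N N'" "r \<in> cell2 B Q Q'" for M N Q M' N' Q' t s r W X Y Z
  proof -
    have g: "gmap V E M M' (tmap t)" "gmap V E N N' (tmap s)" "gmap V E Q Q' (tmap r)"
      and p [simp]: "P M" "P M'" "P N" "P N'" "P Q" "P Q'" and c: "gtrg M = gsrc N" "gtrg N = gsrc Q"
      using a by auto
    note e = gmap_ends[OF g(1)] gmap_ends[OF g(2)] gmap_ends[OF g(3)]
    note q = gmap_equivariant(1)[OF p(1) g(1)] gmap_equivariant(1)[OF p(3) g(2)]
      gmap_equivariant(1)[OF p(5) g(3)]
    show ?thesis
      using rel_assoc_natural[OF _ _ _ _ _ _ _ _ _ _ q(1) q(2)[folded c(1)] q(3)[folded c(2)]] a e c by simp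
  qed
  show "blunit B M \<in> cell2 B (unit1 B X \<diamondop>\<^bsub>B\<^esub> M) M" "invertible (vert B) (blunit B M)"
    "brunit B M \<in> cell2 B (M \<diamondop>\<^bsub>B\<^esub> unit1 B Y) M" "invertible (vert B) (brunit B M)"
    if "M \<in> cell1 B X Y" for M X Y
    using that by (auto intro!: invertible_2cell)
  show "blunit B N \<cdot>\<^bsub>vert B\<^esub> (Ident (vert B) (unit1 B X) \<star>\<^bsub>B\<^esub> t) = t \<cdot>\<^bsub>vert B\<^esub> blunit B M"
    "brunit B N \<cdot>\<^bsub>vert B\<^esub> (t \<star>\<^bsub>B\<^esub> Ident (vert B) (unit1 B Y)) = t \<cdot>\<^bsub>vert B\<^esub> brunit B M"
    if a: "M \<in> cell1 B X Y" "t \<in> cell2 B M N" for M N X Y t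
  proof -
    have g: "gmap V E M N (tmap t)" and p [simp]: "P M" "P N" using a by auto
    note e = gmap_equivariant[OF p(1) g]
    show "blunit B N \<cdot>\<^bsub>vert B\<^esub> (Ident (vert B) (unit1 B X) \<star>\<^bsub>B\<^esub> t) = t \<cdot>\<^bsub>vert B\<^esub> blunit B M"
      using rel_lunit_natural[OF _ _ e(1)] e(2,3) a mon_hom_ident by simp
    show "brunit B N \<cdot>\<^bsub>vert B\<^esub> (t \<star>\<^bsub>B\<^esub> Ident (vert B) (unit1 B Y)) = t \<cdot>\<^bsub>vert B\<^esub> brunit B M"
      using rel_runit_natural[OF _ _ e(1)] e(2,3) a mon_hom_ident by simp
  qed
  show "bassoc B M N (Q \<diamondop>\<^bsub>B\<^esub> R) \<cdot>\<^bsub>vert B\<^esub> bassoc B (M \<diamondop>\<^bsub>B\<^esub> N) Q R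
        = (Ident (vert B) M \<star>\<^bsub>B\<^esub> bassoc B N Q R) \<cdot>\<^bsub>vert B\<^esub> bassoc B M (N \<diamondop>\<^bsub>B\<^esub> Q) R
            \<cdot>\<^bsub>vert B\<^esub> (bassoc B M N Q \<star>\<^bsub>B\<^esub> Ident (vert B) R)"
    if "M \<in> cell1 B X1 X2" "N \<in> cell1 B X2 X3" "Q \<in> cell1 B X3 X4" "R \<in> cell1 B X4 X5"
    for M N Q R X1 X2 X3 X4 X5
    using that rel_pentagon[of "gbim M" "gbim N" "gbim Q" "gbim R"] by simp
  show "(Ident (vert B) M \<star>\<^bsub>B\<^esub> blunit B N) \<cdot>\<^bsub>vert B\<^esub> bassoc B M (unit1 B Y) N
        = brunit B M \<star>\<^bsub>B\<^esub> Ident (vert B) N"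
    if "M \<in> cell1 B X Y" "N \<in> cell1 B Y Z" for M N X Y Z
    using that rel_triangle[of "gbim M" "gbim N"] by simp
qed

end

section \<open>The bicategory of bimodules with semilinear group actions\<close>

locale group_bimodule_setting = bimodule_setting V
  for V :: "('o, 'a) monoidal_category" (structure) +
  fixes G :: "('g, 'm) monoid_scheme"
  assumes group: "group G"
begin

lemmas group_closed [simp] = monoid.m_closed[OF group.axioms(1)[OF group]]
  monoid.one_closed[OF group.axioms(1)[OF group]] group.inv_closed[OF group]
  group.r_inv[OF group] group.l_inv[OF group]

lemma gmon_hom:
  assumes "is_gmon V G A"
  shows "is_mon V (fst A)" "g \<in> carrier G \<Longrightarrow> mon_hom V (fst A) (fst A) (snd A g)"
    "g \<in> carrier G \<Longrightarrow> h \<in> carrier G \<Longrightarrow> snd A (g \<otimes>\<^bsub>G\<^esub> h) = snd A g \<cdot> snd A h"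
    "snd A \<one>\<^bsub>G\<^esub> = Ident V (mobj (fst A))" "snd A \<in> extensional (carrier G)"
proof -
  show A: "is_mon V (fst A)" and "snd A \<in> extensional (carrier G)"
    using assms by (simp_all add: is_gmon_def)
  have h: "snd A g \<in> carrier (Aut_mon V (fst A))" if "g \<in> carrier G" for g
    using assms that by (auto simp: is_gmon_def hom_def)
  then show "g \<in> carrier G \<Longrightarrow> mon_hom V (fst A) (fst A) (snd A g)" for g
    by (simp add: Aut_mon_def)
  show m: "snd A (g \<otimes>\<^bsub>G\<^esub> h) = snd A g \<cdot> snd A h" if "g \<in> carrier G" "h \<in> carrier G" for g h
    using assms that by (simp add: is_gmon_def hom_def Aut_mon_def)
  let ?e = "snd A \<one>\<^bsub>G\<^esub>"
  have ee: "?e \<cdot> ?e = ?e" using m[of "\<one>\<^bsub>G\<^esub>" "\<one>\<^bsub>G\<^esub>"] monoid.l_one[OF group.axioms(1)[OF group]] by simp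
  have i: "invertible V ?e" and t: "?e \<in> Hom V (mobj (fst A)) (mobj (fst A))"
    using h[of "\<one>\<^bsub>G\<^esub>"] by (auto simp: Aut_mon_def invertible_def mon_hom_def)
  note [simp] = t[THEN HomD] is_mon_obj[OF A]
  have "?e \<cdot> ?e = ?e \<cdot> Ident V (mobj (fst A))" using ee by simp
  then show "?e = Ident V (mobj (fst A))" by (rule cancel_left[OF i]) simp_all
qed

lemma gmon_app:
  assumes A: "is_gmon V G A" and g: "g \<in> carrier G"
  shows "snd A g \<in> Arr V" "Dom V (snd A g) = mobj (fst A)" "Cod V (snd A g) = mobj (fst A)"
    "snd A g \<bullet> mun (fst A) = mun (fst A)"
    "\<And>x y. x \<in> El (mobj (fst A)) \<Longrightarrow> y \<in> El (mobj (fst A))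
      \<Longrightarrow> snd A g \<bullet> mop (fst A) x y = mop (fst A) (snd A g \<bullet> x) (snd A g \<bullet> y)"
    "\<And>h x. h \<in> carrier G \<Longrightarrow> x \<in> El (mobj (fst A)) \<Longrightarrow> snd A (g \<otimes>\<^bsub>G\<^esub> h) \<bullet> x = snd A g \<bullet> snd A h \<bullet> x"
    "\<And>x. x \<in> El (mobj (fst A)) \<Longrightarrow> snd A g \<bullet> snd A (inv\<^bsub>G\<^esub> g) \<bullet> x = x"
    "\<And>x. x \<in> El (mobj (fst A)) \<Longrightarrow> snd A (inv\<^bsub>G\<^esub> g) \<bullet> snd A g \<bullet> x = x"
proof -
  note h = gmon_hom[OF A]
  have t: "snd A k \<in> Arr V" "Dom V (snd A k) = mobj (fst A)" "Cod V (snd A k) = mobj (fst A)" if "k \<in> carrier G" for k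
    using mon_homD(1-3)[OF h(1,1) h(2)[OF that]] by auto
  show "snd A g \<in> Arr V" "Dom V (snd A g) = mobj (fst A)" "Cod V (snd A g) = mobj (fst A)" using t g by auto
  show "snd A g \<bullet> mun (fst A) = mun (fst A)"
    "\<And>x y. x \<in> El (mobj (fst A)) \<Longrightarrow> y \<in> El (mobj (fst A))
      \<Longrightarrow> snd A g \<bullet> mop (fst A) x y = mop (fst A) (snd A g \<bullet> x) (snd A g \<bullet> y)"
    using mon_homD[OF h(1,1) h(2)[OF g]] by simp_all
  have m: "snd A (k \<otimes>\<^bsub>G\<^esub> l) \<bullet> x = snd A k \<bullet> snd A l \<bullet> x"
    if "k \<in> carrier G" "l \<in> carrier G" "x \<in> El (mobj (fst A))" for k l x
    using that t by (simp add: h(3))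
  then show "snd A (g \<otimes>\<^bsub>G\<^esub> k) \<bullet> x = snd A g \<bullet> snd A k \<bullet> x" if "k \<in> carrier G" "x \<in> El (mobj (fst A))" for k x
    using that g by simp
  show "snd A g \<bullet> snd A (inv\<^bsub>G\<^esub> g) \<bullet> x = x" "snd A (inv\<^bsub>G\<^esub> g) \<bullet> snd A g \<bullet> x = x" if "x \<in> El (mobj (fst A))" for x
    using m[of g "inv\<^bsub>G\<^esub> g" x] m[of "inv\<^bsub>G\<^esub> g" g x] g that h(4) by simp_all
qed

text \<open>A family of semilinear maps that respects products and the neutral element consists of
  invertible maps: the inverse of \<open>\<phi>\<^sub>g\<close> is the member of the family at the inverse of \<open>g\<close>.\<close>
lemma G_cell_equivariant:
  assumes "is_gcell_base V G m"
  shows "G_cell V G m \<longleftrightarrow> gstr m \<one>\<^bsub>G\<^esub> = Ident V (bobj (gbim m))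
     \<and> (\<forall>g \<in> carrier G. equivariant (snd (gsrc m) g) (snd (gtrg m) g) (gbim m) (gbim m) (gstr m g))
     \<and> (\<forall>g \<in> carrier G. \<forall>h \<in> carrier G. gstr m (g \<otimes>\<^bsub>G\<^esub> h) = gstr m g \<cdot> gstr m h)"
    (is "_ \<longleftrightarrow> ?one \<and> ?eq \<and> ?mult")
proof
  note b = is_gcell_baseD[OF assms]
  have t: "snd (gsrc m) g \<in> Hom V (mobj (bsrc (gbim m))) (mobj (bsrc (gbim m)))"
    "snd (gtrg m) g \<in> Hom V (mobj (btrg (gbim m))) (mobj (btrg (gbim m)))" if "g \<in> carrier G" for g
    using gmon_app(1-3)[OF b(1) that] gmon_app(1-3)[OF b(2) that] b(4,5) by (simp_all add: Hom_def)
  show "?one \<and> ?eq \<and> ?mult" if "G_cell V G m"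
    using that t unfolding G_cell_def equivariant_def Let_def by blast
  assume a: "?one \<and> ?eq \<and> ?mult"
  have "invertible V (gstr m g)" if g: "g \<in> carrier G" for g
  proof -
    have "gstr m g \<in> Hom V (bobj (gbim m)) (bobj (gbim m))" "gstr m (inv\<^bsub>G\<^esub> g) \<in> Hom V (bobj (gbim m)) (bobj (gbim m))"
      using a g by (auto simp: equivariant_def)
    moreover have "gstr m g \<cdot> gstr m (inv\<^bsub>G\<^esub> g) = Ident V (bobj (gbim m))"
      "gstr m (inv\<^bsub>G\<^esub> g) \<cdot> gstr m g = Ident V (bobj (gbim m))"
      using a g group_closed by metis+
    ultimately show ?thesis by (auto simp: invertible_def inverse_pair_def Hom_def)
  qed
  then show "G_cell V G m" using a assms unfolding G_cell_def equivariant_def Let_def by blast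
qed

lemma G_cellD:
  assumes "G_cell V G m"
  shows "is_gcell_base V G m" "gstr m \<one>\<^bsub>G\<^esub> = Ident V (bobj (gbim m))"
    "\<And>g. g \<in> carrier G \<Longrightarrow> equivariant (snd (gsrc m) g) (snd (gtrg m) g) (gbim m) (gbim m) (gstr m g)"
    "\<And>g h. g \<in> carrier G \<Longrightarrow> h \<in> carrier G \<Longrightarrow> gstr m (g \<otimes>\<^bsub>G\<^esub> h) = gstr m g \<cdot> gstr m h"
  using assms G_cell_equivariant[of m] by (auto simp: G_cell_def)

text \<open>The families carried by composites and units in \<open>Mod(V)^G\<close>.\<close>
abbreviation GH where "GH \<equiv> (\<lambda>m n g. rel_map V (gbim m) (gbim n) (gbim m) (gbim n) (gstr m g) (gstr n g))"
abbreviation GU where "GU \<equiv> (\<lambda>A :: ('o, 'a, 'g) gmon. snd A)"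

lemma gcomp_base:
  assumes m: "is_gcell_base V G m" and n: "is_gcell_base V G n" and c: "gtrg m = gsrc n"
  shows "is_gcell_base V G (gcomp V G H m n)"
  using is_gcell_baseD[OF m] is_gcell_baseD[OF n] c by (simp add: is_gcell_base_def)

lemma gunit_base: "is_gmon V G A \<Longrightarrow> is_gcell_base V G (gunit G U A)"
  by (simp add: is_gcell_base_def gmon_hom)

lemma gcomp_G_cell:
  assumes m: "G_cell V G m" and n: "G_cell V G n" and c: "gtrg m = gsrc n"
  shows "G_cell V G (gcomp V G GH m n)"
proof -
  note M = G_cellD[OF m] and N = G_cellD[OF n]
  note bm = is_gcell_baseD[OF M(1)] and bn = is_gcell_baseD[OF N(1)]
  have mn: "btrg (gbim m) = bsrc (gbim n)" using bm bn c by simp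
  note r = rel_map[OF bm(3) bn(3) mn bm(3) bn(3) mn M(3)[unfolded c] N(3)]
  have "GH m n (g \<otimes>\<^bsub>G\<^esub> h) = GH m n g \<cdot> GH m n h" if g: "g \<in> carrier G" "h \<in> carrier G" for g h
    using rel_map_comp[OF bm(3,3,3) bn(3,3,3) mn mn mn M(3)[OF g(2), unfolded c] M(3)[OF g(1), unfolded c]
      N(3)[OF g(2)] N(3)[OF g(1)]] M(4)[OF g] N(4)[OF g] by simp
  then show ?thesis
    using r(3) M(2) N(2) rel_map_ident[OF bm(3) bn(3) mn]
    by (subst G_cell_equivariant[OF gcomp_base[OF M(1) N(1) c]]) simp
qed

lemma gunit_G_cell:
  assumes A: "is_gmon V G A"
  shows "G_cell V G (gunit G GU A)"
  using gmon_hom[OF A] mon_hom_equivariant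
  by (subst G_cell_equivariant[OF gunit_base[OF A]]) simp

text \<open>Compatibility of composites, associators and unitors with the families is functoriality of
  \<open>rel_map\<close> and naturality of the associator and the unitors along semilinear maps.\<close>
lemma G_structured: "structured_bimodules V G (G_cell V G) (G_equivariant V G) GH GU"
proof (intro_locales, rule structured_bimodules_axioms.intro)
  note [simp] = gcomp_G_cell gunit_G_cell
  show "is_gcell_base V G m" if "G_cell V G m" for m using that by (rule G_cellD)
  show "G_cell V G (gcomp V G GH m n)" if "G_cell V G m" "G_cell V G n" "gtrg m = gsrc n" for m n
    using that by simp
  show "G_cell V G (gunit G GU A)" if "is_gmon V G A" for A using that by simp
  have t: "gstr m g \<in> Arr V" "Dom V (gstr m g) = bobj (gbim m)" "Cod V (gstr m g) = bobj (gbim m)"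
    if "G_cell V G m" "g \<in> carrier G" for m g
    using G_cellD(3)[OF that] by (auto simp: equivariant_def Hom_def)
  have ft: "f \<in> Arr V" "Dom V f = bobj (gbim m)" "Cod V f = bobj (gbim n)"
    if "gmap V (G_equivariant V G) m n f" for m n f
    using that by (auto simp: gmap_def bimod_map_def Hom_def)
  show "G_equivariant V G m m (Ident V (bobj (gbim m)))" if "G_cell V G m" for m
    using that by (simp add: G_equivariant_def t)
  show "G_equivariant V G m p (g \<cdot> f)"
    if a: "G_cell V G m" "G_cell V G n" "G_cell V G p" "gmap V (G_equivariant V G) m n f"
      "gmap V (G_equivariant V G) n p g" for m n p f g
    unfolding G_equivariant_def
  proof
    fix k assume k: "k \<in> carrier G"
    have e: "f \<cdot> gstr m k = gstr n k \<cdot> f" "g \<cdot> gstr n k = gstr p k \<cdot> g"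
      using a k by (simp_all add: gmap_def G_equivariant_def)
    have "(g \<cdot> f) \<cdot> gstr m k = g \<cdot> (f \<cdot> gstr m k)" using a k by (simp add: t ft)
    also have "\<dots> = (g \<cdot> gstr n k) \<cdot> f" unfolding e(1) using a k by (simp add: t ft)
    also have "\<dots> = gstr p k \<cdot> (g \<cdot> f)" unfolding e(2) using a k by (simp add: t ft)
    finally show "(g \<cdot> f) \<cdot> gstr m k = gstr p k \<cdot> (g \<cdot> f)" .
  qed
  show "G_equivariant V G n m g"
    if a: "G_cell V G m" "G_cell V G n" "gmap V (G_equivariant V G) m n f" "inverse_pair V f g" for m n f g
    unfolding G_equivariant_def
  proof
    fix k assume k: "k \<in> carrier G"
    note [simp] = t[OF a(1) k] t[OF a(2) k] ft[OF a(3)]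
    have g: "g \<in> Arr V" "Dom V g = bobj (gbim n)" "Cod V g = bobj (gbim m)"
      and i: "g \<cdot> f = Ident V (bobj (gbim m))" "f \<cdot> g = Ident V (bobj (gbim n))"
      using a(4) by (auto simp: inverse_pair_def Hom_def)
    note [simp] = g
    have "g \<cdot> gstr n k = g \<cdot> gstr n k \<cdot> (f \<cdot> g)" by (simp add: i)
    also have "\<dots> = g \<cdot> (gstr n k \<cdot> f) \<cdot> g" by simp
    also have "gstr n k \<cdot> f = f \<cdot> gstr m k" using a(3) k by (simp add: gmap_def G_equivariant_def)
    also have "g \<cdot> (f \<cdot> gstr m k) \<cdot> g = (g \<cdot> f) \<cdot> gstr m k \<cdot> g" by simp
    also have "\<dots> = gstr m k \<cdot> g" by (simp add: i)
    finally show "g \<cdot> gstr n k = gstr m k \<cdot> g" .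
  qed
  show "G_equivariant V G (gcomp V G GH m n) (gcomp V G GH m' n') (rel_map V (gbim m) (gbim n) (gbim m') (gbim n') f g)"
    if a: "G_cell V G m" "G_cell V G n" "G_cell V G m'" "G_cell V G n'" "gtrg m = gsrc n"
      "gmap V (G_equivariant V G) m m' f" "gmap V (G_equivariant V G) n n' g" for m n m' n' f g
    unfolding G_equivariant_def
  proof
    fix k assume k: "k \<in> carrier G"
    note b = is_gcell_baseD[OF G_cellD(1)[OF a(1)]] is_gcell_baseD[OF G_cellD(1)[OF a(2)]]
      is_gcell_baseD[OF G_cellD(1)[OF a(3)]] is_gcell_baseD[OF G_cellD(1)[OF a(4)]]
    have e: "gsrc m = gsrc m'" "gtrg m = gtrg m'" "gsrc n = gsrc n'" "gtrg n = gtrg n'"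
      using a(6,7) by (simp_all add: gmap_def)
    have c: "btrg (gbim m) = bsrc (gbim n)" "btrg (gbim m') = bsrc (gbim n')" using b a(5) e by simp_all
    have f: "bimod_hom (gbim m) (gbim m') f" and g: "bimod_hom (gbim n) (gbim n') g"
      using a(6,7) b bimod_map_equivariant by (auto simp: gmap_def)
    note s = G_cellD(3)[OF a(1) k] G_cellD(3)[OF a(2) k] G_cellD(3)[OF a(3) k] G_cellD(3)[OF a(4) k]
    have "rel_map V (gbim m) (gbim n) (gbim m') (gbim n') f g \<cdot> GH m n k
      = rel_map V (gbim m) (gbim n) (gbim m') (gbim n') (f \<cdot> gstr m k) (g \<cdot> gstr n k)"
      using rel_map_comp[OF b(3,3) b(15) b(9,9) b(21) c(1,1,2) s(1)[unfolded a(5)] f s(2) g[folded c(1)]] by simp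
    also have "\<dots> = rel_map V (gbim m) (gbim n) (gbim m') (gbim n') (gstr m' k \<cdot> f) (gstr n' k \<cdot> g)"
      using a(6,7) k by (simp add: gmap_def G_equivariant_def)
    also have "\<dots> = GH m' n' k \<cdot> rel_map V (gbim m) (gbim n) (gbim m') (gbim n') f g"
      using rel_map_comp[OF b(3) b(15,15) b(9) b(21,21) c(1,2,2) f s(3)[folded e, unfolded a(5)] g[folded c(1)] s(4)[folded e]] by simp
    finally show "rel_map V (gbim m) (gbim n) (gbim m') (gbim n') f g \<cdot> gstr (gcomp V G GH m n) k
      = gstr (gcomp V G GH m' n') k \<cdot> rel_map V (gbim m) (gbim n) (gbim m') (gbim n') f g"
      using k by simp
  qed
  show "G_equivariant V G (gcomp V G GH (gcomp V G GH m n) p) (gcomp V G GH m (gcomp V G GH n p))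
            (rel_assoc V (gbim m) (gbim n) (gbim p))"
    if a: "G_cell V G m" "G_cell V G n" "G_cell V G p" "gtrg m = gsrc n" "gtrg n = gsrc p" for m n p
    unfolding G_equivariant_def
  proof
    fix k assume k: "k \<in> carrier G"
    note b = is_gcell_baseD[OF G_cellD(1)[OF a(1)]] is_gcell_baseD[OF G_cellD(1)[OF a(2)]]
      is_gcell_baseD[OF G_cellD(1)[OF a(3)]]
    have c: "btrg (gbim m) = bsrc (gbim n)" "btrg (gbim n) = bsrc (gbim p)" using b a by simp_all
    note s = G_cellD(3)[OF a(1) k] G_cellD(3)[OF a(2) k] G_cellD(3)[OF a(3) k]
    show "rel_assoc V (gbim m) (gbim n) (gbim p) \<cdot> gstr (gcomp V G GH (gcomp V G GH m n) p) k
      = gstr (gcomp V G GH m (gcomp V G GH n p)) k \<cdot> rel_assoc V (gbim m) (gbim n) (gbim p)"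
      using rel_assoc_natural[OF b(3,3,9,9,15,15) c(1,1,2,2) s(1)[unfolded a(4)] s(2)[unfolded a(5)] s(3)] k by simp
  qed
  show "G_equivariant V G (gcomp V G GH (gunit G GU (gsrc m)) m) m (rel_lunit V (gbim m))"
    "G_equivariant V G (gcomp V G GH m (gunit G GU (gtrg m))) m (rel_runit V (gbim m))"
    if a: "G_cell V G m" for m
  proof -
    note b = is_gcell_baseD[OF G_cellD(1)[OF a]]
    show "G_equivariant V G (gcomp V G GH (gunit G GU (gsrc m)) m) m (rel_lunit V (gbim m))"
      using rel_lunit_natural[OF b(3,3) G_cellD(3)[OF a]] gmon_hom(2)[OF b(1)] b(4)
      by (simp add: G_equivariant_def)
    show "G_equivariant V G (gcomp V G GH m (gunit G GU (gtrg m))) m (rel_runit V (gbim m))"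
      using rel_runit_natural[OF b(3,3) G_cellD(3)[OF a]] gmon_hom(2)[OF b(2)] b(5)
      by (simp add: G_equivariant_def)
  qed
qed

end

section \<open>Twisted structure maps are semilinear maps\<close>

context group_bimodule_setting
begin

lemma twist_simps [simp]:
  "bsrc (twist V A g) = fst A" "btrg (twist V A g) = fst A" "bobj (twist V A g) = mobj (fst A)"
  "lop (twist V A g) = mop (fst A)"
  by (auto simp: twist_def lop_def mop_def fun_eq_iff)

lemma rop_twist [simp]:
  assumes A: "is_gmon V G A" and g: "g \<in> carrier G" and "x \<in> El (mobj (fst A))" "y \<in> El (mobj (fst A))"
  shows "rop (twist V A g) x y = mop (fst A) x (snd A g \<bullet> y)"
proof -
  note [simp] = gmon_app[OF A g] gmon_hom(1)[OF A] is_mon_typing[OF gmon_hom(1)[OF A]]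
  show ?thesis using assms by (simp add: twist_def rop_def mop_def)
qed

lemma twist_bimod [simp]:
  assumes A: "is_gmon V G A" and g: "g \<in> carrier G"
  shows "is_bimod V (twist V A g)"
proof -
  note [simp] = gmon_app[OF A g] gmon_hom(1)[OF A] is_mon_typing[OF gmon_hom(1)[OF A]] A g
  show ?thesis
  proof (rule is_bimodI[of _ "gen (mobj (fst A))"])
    show "ract (twist V A g) \<in> Hom V (bobj (twist V A g) \<boxtimes> mobj (btrg (twist V A g))) (bobj (twist V A g))"
      "lact (twist V A g) \<in> Hom V (mobj (bsrc (twist V A g)) \<boxtimes> bobj (twist V A g)) (bobj (twist V A g))"
      by (simp_all add: twist_def Hom_def)
  qed simp_all
qed

text \<open>Moving a scalar across the tensor sign of \<open>A\<^sup>g \<odot> M\<close> applies \<open>\<alpha>\<^sub>g\<close> to it.\<close>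
lemma tp_twist_left:
  assumes A: "is_gmon V G A" and g: "g \<in> carrier G" and M: "is_bimod V M" "bsrc M = fst A"
    and "a \<in> El (mobj (fst A))" "b \<in> El (mobj (fst A))" "x \<in> elts M"
  shows "tp (twist V A g) M (mop (fst A) a (snd A g \<bullet> b)) x = tp (twist V A g) M a (lop M b x)"
  using tp_balanced[of "twist V A g" M a b x] assms by simp

lemma lwhisk:
  assumes M: "is_bimod V M" and N: "is_bimod V N" "is_bimod V N'" and c: "btrg M = bsrc N" "bsrc N' = bsrc N"
    and d: "btrg N' = btrg N" and f: "bimod_hom N N' f"
  shows "lwhisk V M N N' f \<in> Arr V" "Dom V (lwhisk V M N N' f) = rel_obj V M N"
    "Cod V (lwhisk V M N N' f) = rel_obj V M N'"
    "\<And>m n. m \<in> elts M \<Longrightarrow> n \<in> elts N \<Longrightarrow> lwhisk V M N N' f \<bullet> tp M N m n = tp M N' m (f \<bullet> n)"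
    "bimod_hom (M \<odot> N) (M \<odot> N') (lwhisk V M N N' f)"
proof -
  have m: "equivariant (Ident V (mobj (bsrc M))) (Ident V (mobj (bsrc N))) M M (Ident V (bobj M))"
    using equivariant_ident[OF M] c by simp
  note r = rel_map[OF M N(1) c(1) M N(2) _ m f]
  show "lwhisk V M N N' f \<in> Arr V" "Dom V (lwhisk V M N N' f) = rel_obj V M N"
    "Cod V (lwhisk V M N N' f) = rel_obj V M N'"
    "\<And>m n. m \<in> elts M \<Longrightarrow> n \<in> elts N \<Longrightarrow> lwhisk V M N N' f \<bullet> tp M N m n = tp M N' m (f \<bullet> n)"
    "bimod_hom (M \<odot> N) (M \<odot> N') (lwhisk V M N N' f)"
    unfolding lwhisk_def using r c M by (auto simp: Hom_def)
qed

lemma rwhisk: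
  assumes M: "is_bimod V M" "is_bimod V M'" and N: "is_bimod V N" and c: "btrg M = bsrc N" "btrg M' = btrg M"
    and d: "bsrc M' = bsrc M" and f: "bimod_hom M M' f"
  shows "rwhisk V M M' f N \<in> Arr V" "Dom V (rwhisk V M M' f N) = rel_obj V M N"
    "Cod V (rwhisk V M M' f N) = rel_obj V M' N"
    "\<And>m n. m \<in> elts M \<Longrightarrow> n \<in> elts N \<Longrightarrow> rwhisk V M M' f N \<bullet> tp M N m n = tp M' N (f \<bullet> m) n"
    "bimod_hom (M \<odot> N) (M' \<odot> N) (rwhisk V M M' f N)"
proof -
  have n: "equivariant (Ident V (mobj (btrg M))) (Ident V (mobj (btrg N))) N N (Ident V (bobj N))"
    using equivariant_ident[OF N] c by simp
  note r = rel_map[OF M(1) N c(1) M(2) N _ f n]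
  show "rwhisk V M M' f N \<in> Arr V" "Dom V (rwhisk V M M' f N) = rel_obj V M N"
    "Cod V (rwhisk V M M' f N) = rel_obj V M' N"
    "\<And>m n. m \<in> elts M \<Longrightarrow> n \<in> elts N \<Longrightarrow> rwhisk V M M' f N \<bullet> tp M N m n = tp M' N (f \<bullet> m) n"
    "bimod_hom (M \<odot> N) (M' \<odot> N) (rwhisk V M M' f N)"
    unfolding rwhisk_def using r c N by (auto simp: Hom_def)
qed

text \<open>The relation between a twisted structure map \<open>t\<close> and a semilinear map \<open>p\<close>: on elements,
  \<open>t (a \<otimes> x) = a p(x) \<otimes> 1\<close>.  It depends on the bimodule and the \<open>G\<close>-monoids of the cell \<open>m\<close> but not on
  the family that \<open>m\<close> carries, so that it applies to cells of either bicategory.\<close>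
definition represents where
  "represents m g t p \<longleftrightarrow>
    t \<in> Hom V (rel_obj V (twist V (gsrc m) g) (gbim m)) (rel_obj V (gbim m) (twist V (gtrg m) g))
    \<and> equivariant (snd (gsrc m) g) (snd (gtrg m) g) (gbim m) (gbim m) p
    \<and> (\<forall>a \<in> El (mobj (fst (gsrc m))). \<forall>x \<in> El (bobj (gbim m)).
        t \<bullet> tp (twist V (gsrc m) g) (gbim m) a x
        = tp (gbim m) (twist V (gtrg m) g) (lop (gbim m) a (p \<bullet> x)) (mun (fst (gtrg m))))"

context
  fixes m :: "('o, 'a, 'g) gcell" and g M A B \<alpha> \<beta> T S
  assumes base: "is_gcell_base V G m" and g: "g \<in> carrier G"
  defines "M \<equiv> gbim m" and "A \<equiv> fst (gsrc m)" and "B \<equiv> fst (gtrg m)"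
    and "\<alpha> \<equiv> snd (gsrc m) g" and "\<beta> \<equiv> snd (gtrg m) g"
    and "T \<equiv> twist V (gsrc m) g" and "S \<equiv> twist V (gtrg m) g"
begin

private lemmas m_facts = is_gcell_baseD[OF base]

private lemma facts [simp]:
  "is_bimod V M" "bsrc M = A" "btrg M = B" "is_mon V A" "is_mon V B"
  "is_bimod V T" "bsrc T = A" "btrg T = A" "bobj T = mobj A" "lop T = mop A"
  "is_bimod V S" "bsrc S = B" "btrg S = B" "bobj S = mobj B" "lop S = mop B"
  "x \<in> El (mobj A) \<Longrightarrow> y \<in> El (mobj A) \<Longrightarrow> rop T x y = mop A x (\<alpha> \<bullet> y)"
  "x \<in> El (mobj B) \<Longrightarrow> y \<in> El (mobj B) \<Longrightarrow> rop S x y = mop B x (\<beta> \<bullet> y)"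
  "bobj M \<in> Obj V" "mobj A \<in> Obj V" "mobj B \<in> Obj V"
  using m_facts gmon_hom[OF m_facts(1)] gmon_hom[OF m_facts(2)] g
  by (simp_all add: M_def A_def B_def T_def S_def \<alpha>_def \<beta>_def)

private lemmas \<alpha>_facts [simp] = gmon_app[OF m_facts(1) g, folded A_def \<alpha>_def]
private lemmas \<beta>_facts [simp] = gmon_app[OF m_facts(2) g, folded B_def \<beta>_def]

private lemma left_facts [simp]:
  assumes "b \<in> El (mobj A)" "x \<in> elts M"
  shows "tp T M (mun A) (lop M b x) = tp T M (\<alpha> \<bullet> b) x"
  using tp_twist_left[OF m_facts(1) g m_facts(3,4), of "mun A" b x] assms
  by (simp add: M_def[symmetric] A_def[symmetric] T_def[symmetric] \<alpha>_def[symmetric])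

private lemma right_facts [simp]:
  assumes "a \<in> El (mobj A)" "x \<in> elts M" "b \<in> El (mobj B)"
  shows "tp M S (lop M a (rop M x b)) (mun B) = tp M S (lop M a x) b"
proof -
  have "tp M S (lop M a (rop M x b)) (mun B) = tp M S (rop M (lop M a x) b) (mun B)"
    using assms by (simp del: tp_balanced)
  also have "\<dots> = tp M S (lop M a x) b" using assms by (simp del: bimod_middle)
  finally show ?thesis .
qed

private lemma dense_facts [simp]:
  "bgen M \<in> dense (bobj M)" "gen (mobj A) \<in> dense (mobj A)" "gen (mobj B) \<in> dense (mobj B)"
  "bgen M \<in> elts M" "gen (mobj A) \<in> El (mobj A)" "gen (mobj B) \<in> El (mobj B)"
  by (simp_all add: dense_El)

private lemma represents_iff: "represents m g t p \<longleftrightarrow> t \<in> Hom V (rel_obj V T M) (rel_obj V M S)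
    \<and> equivariant \<alpha> \<beta> M M p
    \<and> (\<forall>a \<in> El (mobj A). \<forall>x \<in> elts M. t \<bullet> tp T M a x = tp M S (lop M a (p \<bullet> x)) (mun B))"
  by (simp add: represents_def M_def A_def B_def T_def S_def \<alpha>_def \<beta>_def)

text \<open>The map \<open>x \<otimes> b \<mapsto> x b\<close> from \<open>M \<odot> B\<^sup>g\<close> to \<open>M\<close>; its inverse is \<open>x \<mapsto> x \<otimes> 1\<close>, from \<open>right_include\<close>.\<close>
private lemma right_collapse:
  obtains k where "k \<in> Hom V (rel_obj V M S) (bobj M)"
    "\<And>x b. x \<in> elts M \<Longrightarrow> b \<in> El (mobj B) \<Longrightarrow> k \<bullet> tp M S x b = rop M x b"
proof (rule that)
  have k: "ract M \<in> Hom V (bobj M \<boxtimes> bobj S) (bobj M)"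
    using is_bimod_typing[of M] by (simp add: Hom_def)
  have b: "ract M \<bullet> (rop M (bgen M) y \<parallel> bgen S) = ract M \<bullet> (bgen M \<parallel> lop S y (bgen S))"
    if "y \<in> lscal S" for y
    using that by (simp flip: rop_def)
  note d = descend_rel[OF _ _ _ k _ _ b]
  show "descend V (rel_proj V M S) (ract M) \<in> Hom V (rel_obj V M S) (bobj M)" by (rule d(1)) simp_all
  show "descend V (rel_proj V M S) (ract M) \<bullet> tp M S x b = rop M x b"
    if "x \<in> elts M" "b \<in> El (mobj B)" for x b
    using d(2)[of x b] that by (simp add: rop_def)
qed

lemma twist_right_inject:
  assumes "tp (gbim m) (twist V (gtrg m) g) x (mun (fst (gtrg m))) = tp (gbim m) (twist V (gtrg m) g) y (mun (fst (gtrg m)))"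
    "x \<in> El (bobj (gbim m))" "y \<in> El (bobj (gbim m))"
  shows "x = y"
proof -
  obtain k where k: "\<And>x b. x \<in> elts M \<Longrightarrow> b \<in> El (mobj B) \<Longrightarrow> k \<bullet> tp M S x b = rop M x b"
    by (rule right_collapse) blast
  from arg_cong[OF assms(1), of "\<lambda>w. k \<bullet> w"] show ?thesis
    using k[of x "mun B"] k[of y "mun B"] assms(2,3) bimod_right(2)[of M x] bimod_right(2)[of M y]
    by (simp flip: M_def B_def S_def)
qed

private lemma right_include:
  obtains k where "k \<in> Hom V (bobj M) (rel_obj V M S)" "\<And>x. x \<in> elts M \<Longrightarrow> k \<bullet> x = tp M S x (mun B)"
proof (rule that)
  note [simp] = is_mon_typing[of B] is_bimod_typing[of M]
  let ?k = "rel_proj V M S \<cdot> (Ident V (bobj M) \<^bold>\<otimes> munit B) \<cdot> inverse_of V (run V (bobj M))"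
  show "?k \<in> Hom V (bobj M) (rel_obj V M S)" by (simp add: Hom_def)
  show "?k \<bullet> x = tp M S x (mun B)" if "x \<in> elts M" for x using that by (simp add: tp_def mun_def)
qed

private lemma left_include:
  obtains k where "k \<in> Hom V (bobj M) (rel_obj V T M)" "\<And>x. x \<in> elts M \<Longrightarrow> k \<bullet> x = tp T M (mun A) x"
proof (rule that)
  note [simp] = is_mon_typing[of A] is_bimod_typing[of M]
  let ?k = "rel_proj V T M \<cdot> (munit A \<^bold>\<otimes> Ident V (bobj M)) \<cdot> inverse_of V (lun V (bobj M))"
  show "?k \<in> Hom V (bobj M) (rel_obj V T M)" by (simp add: Hom_def)
  show "?k \<bullet> x = tp T M (mun A) x" if "x \<in> elts M" for x using that by (simp add: tp_def mun_def)
qed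

text \<open>The map \<open>a \<otimes> x \<mapsto> a p(x)\<close> is balanced over \<open>A\<^sup>g\<close> because \<open>p\<close> is semilinear:
  \<open>a \<alpha>\<^sub>g(b) p(x) = a p(b x)\<close>.\<close>
lemma represents_exists:
  assumes p: "equivariant (snd (gsrc m) g) (snd (gtrg m) g) (gbim m) (gbim m) p"
  shows "\<exists>t. represents m g t p"
proof -
  have p: "equivariant \<alpha> \<beta> M M p" using p by (simp add: M_def \<alpha>_def \<beta>_def)
  note [simp] = is_bimod_typing[of M] equivariantD[OF p]
  obtain r where r: "r \<in> Hom V (bobj M) (rel_obj V M S)"
    and r2 [simp]: "\<And>x. x \<in> elts M \<Longrightarrow> r \<bullet> x = tp M S x (mun B)"
    by (rule right_include) blast
  note [simp] = r[THEN HomD]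
  let ?k = "lact M \<cdot> (Ident V (mobj A) \<^bold>\<otimes> p)"
  have k: "?k \<in> Hom V (bobj T \<boxtimes> bobj M) (bobj M)" by (simp add: Hom_def)
  have ka: "?k \<bullet> (a \<parallel> x) = lop M a (p \<bullet> x)" if "a \<in> El (mobj A)" "x \<in> elts M" for a x
    using that by (simp add: lop_def)
  have b: "?k \<bullet> (rop T (bgen T) y \<parallel> bgen M) = ?k \<bullet> (bgen T \<parallel> lop M y (bgen M))"
    if "y \<in> lscal M" for y
    using that bimod_left(1)[of M "p \<bullet> bgen M" "gen (mobj A)" "\<alpha> \<bullet> y"] by (simp add: ka del: app_comp)
  note d = descend_rel[OF _ _ _ k _ _ b]
  let ?d = "descend V (rel_proj V T M) ?k"
  have h: "?d \<in> Hom V (rel_obj V T M) (bobj M)" by (rule d(1)) simp_all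
  have da: "?d \<bullet> tp T M a x = lop M a (p \<bullet> x)" if "x \<in> elts M" "a \<in> El (mobj A)" for x a
    using d(2)[of a x] that ka[of a x] by (simp del: app_comp)
  note [simp] = h[THEN HomD]
  have "represents m g (r \<cdot> ?d) p"
    using p by (simp add: represents_iff Hom_def da)
  then show ?thesis by blast
qed

lemma represents_left_unique:
  assumes "represents m g t p" "represents m g s p"
  shows "t = s"
  using assms unfolding represents_iff
  by (intro dense_ext[of "tp T M (gen (mobj A)) (bgen M)" "rel_obj V T M" _ _ "rel_obj V M S"]) auto

lemma represents_right_unique:
  assumes "represents m g t p" "represents m g t q"
  shows "p = q"
proof -
  have p: "equivariant \<alpha> \<beta> M M p" and q: "equivariant \<alpha> \<beta> M M q" using assms by (simp_all add: represents_iff)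
  note [simp] = equivariantD[OF p] equivariantD[OF q]
  let ?x = "bgen M"
  have "tp M S (lop M (mun A) (p \<bullet> ?x)) (mun B) = tp M S (lop M (mun A) (q \<bullet> ?x)) (mun B)"
    using assms unfolding represents_iff by (metis dense_facts(4) mun_in facts(4))
  then have "tp M S (p \<bullet> ?x) (mun B) = tp M S (q \<bullet> ?x) (mun B)"
    using bimod_left(2)[of M "p \<bullet> ?x"] bimod_left(2)[of M "q \<bullet> ?x"] by simp
  then have "p \<bullet> ?x = q \<bullet> ?x"
    using twist_right_inject[of "p \<bullet> ?x" "q \<bullet> ?x"] by (simp flip: M_def B_def S_def)
  then show ?thesis by (intro dense_ext[of ?x "bobj M" p q "bobj M"]) (simp_all add: Hom_def)
qed

lemma represents_bimod_hom:
  assumes "represents m g t p"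
  shows "bimod_hom (twist V (gsrc m) g \<odot> gbim m) (gbim m \<odot> twist V (gtrg m) g) t"
proof -
  have p: "equivariant \<alpha> \<beta> M M p" and t: "t \<in> Hom V (rel_obj V T M) (rel_obj V M S)"
    and ta [simp]: "\<And>a x. a \<in> El (mobj A) \<Longrightarrow> x \<in> elts M \<Longrightarrow> t \<bullet> tp T M a x = tp M S (lop M a (p \<bullet> x)) (mun B)"
    using assms by (simp_all add: represents_iff)
  note [simp] = equivariantD[OF p] t[THEN HomD] bimod_left(1)[of M, simplified]
  have "bimod_hom (T \<odot> M) (M \<odot> S) t"
    by (rule equivariantI[of _ _ _ _ _ "tp T M (gen (mobj A)) (bgen M)"])
      (simp_all add: Hom_def)
  then show ?thesis by (simp add: M_def T_def S_def)
qed

text \<open>The semilinear map is \<open>x \<mapsto> t (1 \<otimes> x)\<close> followed by \<open>x \<otimes> b \<mapsto> x b\<close>.\<close>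
lemma bimod_hom_represents:
  assumes "bimod_hom (twist V (gsrc m) g \<odot> gbim m) (gbim m \<odot> twist V (gtrg m) g) t"
  shows "\<exists>p. represents m g t p"
proof -
  have t: "bimod_hom (T \<odot> M) (M \<odot> S) t" using assms by (simp add: M_def T_def S_def)
  obtain k where k: "k \<in> Hom V (rel_obj V M S) (bobj M)"
    and k2 [simp]: "\<And>x b. x \<in> elts M \<Longrightarrow> b \<in> El (mobj B) \<Longrightarrow> k \<bullet> tp M S x b = rop M x b"
    by (rule right_collapse) blast
  obtain r where r: "r \<in> Hom V (bobj M) (rel_obj V M S)"
    and r2 [simp]: "\<And>x. x \<in> elts M \<Longrightarrow> r \<bullet> x = tp M S x (mun B)"
    by (rule right_include) blast
  obtain l where l: "l \<in> Hom V (bobj M) (rel_obj V T M)"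
    and l2 [simp]: "\<And>x. x \<in> elts M \<Longrightarrow> l \<bullet> x = tp T M (mun A) x"
    by (rule left_include) blast
  note [simp] = equivariantD[OF t, simplified] k[THEN HomD] l[THEN HomD] r[THEN HomD]
  \<comment> \<open>the collapse \<open>k\<close> is inverse to \<open>r\<close>, left linear, and right semilinear over \<open>\<beta>\<close>\<close>
  have rk0: "r \<cdot> k = Ident V (rel_obj V M S)"
    by (rule dense_ext[of "tp M S (bgen M) (gen (mobj B))" "rel_obj V M S" _ _ "rel_obj V M S"])
      (simp_all add: Hom_def)
  have rk: "tp M S (k \<bullet> w) (mun B) = w" if "w \<in> El (rel_obj V M S)" for w
    using that arg_cong[OF rk0, of "\<lambda>f. f \<bullet> w"] by simp
  have kl: "k \<bullet> lop (M \<odot> S) a w = lop M a (k \<bullet> w)" if a: "a \<in> El (mobj A)" and w: "w \<in> El (rel_obj V M S)" for a w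
  proof -
    have "k \<bullet> lop (M \<odot> S) a w = k \<bullet> lop (M \<odot> S) a (tp M S (k \<bullet> w) (mun B))" using rk[OF w] by simp
    also have "\<dots> = lop M a (k \<bullet> w)" using a w bimod_right(2)[of M "lop M a (k \<bullet> w)"] by simp
    finally show ?thesis .
  qed
  have kr: "k \<bullet> rop (M \<odot> S) w b = rop M (k \<bullet> w) (\<beta> \<bullet> b)" if b: "b \<in> El (mobj B)" and w: "w \<in> El (rel_obj V M S)" for b w
  proof -
    have "k \<bullet> rop (M \<odot> S) w b = k \<bullet> rop (M \<odot> S) (tp M S (k \<bullet> w) (mun B)) b" using rk[OF w] by simp
    also have "\<dots> = rop M (k \<bullet> w) (\<beta> \<bullet> b)" using b w by simp
    finally show ?thesis .
  qed
  define p where "p = k \<cdot> t \<cdot> l"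
  have pa: "p \<bullet> x = k \<bullet> t \<bullet> tp T M (mun A) x" if "x \<in> elts M" for x
    using that by (simp add: p_def)
  have ph: "p \<in> Hom V (bobj M) (bobj M)" by (simp add: p_def Hom_def)
  note [simp] = ph[THEN HomD]
  have ta: "t \<bullet> tp T M a x = lop (M \<odot> S) a (t \<bullet> tp T M (mun A) x)" if "a \<in> El (mobj A)" "x \<in> elts M" for a x
  proof -
    have "t \<bullet> tp T M a x = t \<bullet> lop (T \<odot> M) a (tp T M (mun A) x)" using that by simp
    also have "\<dots> = lop (M \<odot> S) a (t \<bullet> tp T M (mun A) x)" using that by (simp del: rel_tensor_ops)
    finally show ?thesis .
  qed
  have tb: "t \<bullet> tp T M a (rop M x b) = rop (M \<odot> S) (t \<bullet> tp T M a x) b"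
    if "a \<in> El (mobj A)" "x \<in> elts M" "b \<in> El (mobj B)" for a x b
  proof -
    have "t \<bullet> tp T M a (rop M x b) = t \<bullet> rop (T \<odot> M) (tp T M a x) b" using that by simp
    also have "\<dots> = rop (M \<odot> S) (t \<bullet> tp T M a x) b" using that by (simp del: rel_tensor_ops)
    finally show ?thesis .
  qed
  have pe: "equivariant \<alpha> \<beta> M M p"
  proof (rule equivariantI[of _ _ _ _ _ "bgen M"])
    show "p \<bullet> lop M x (bgen M) = lop M (\<alpha> \<bullet> x) (p \<bullet> bgen M)" if "x \<in> lscal M" for x
    proof -
      have "p \<bullet> lop M x (bgen M) = k \<bullet> t \<bullet> tp T M (\<alpha> \<bullet> x) (bgen M)"
        using that by (simp add: pa)
      also have "\<dots> = k \<bullet> lop (M \<odot> S) (\<alpha> \<bullet> x) (t \<bullet> tp T M (mun A) (bgen M))"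
        using that by (subst ta) simp_all
      also have "\<dots> = lop M (\<alpha> \<bullet> x) (p \<bullet> bgen M)" using that by (simp add: kl pa)
      finally show ?thesis .
    qed
    show "p \<bullet> rop M (bgen M) y = rop M (p \<bullet> bgen M) (\<beta> \<bullet> y)" if "y \<in> rscal M" for y
      using that by (simp add: pa tb kr)
  qed (simp_all add: Hom_def)
  have "t \<bullet> tp T M a x = tp M S (lop M a (p \<bullet> x)) (mun B)" if "a \<in> El (mobj A)" "x \<in> elts M" for a x
  proof -
    have "tp M S (lop M a (p \<bullet> x)) (mun B) = tp M S (k \<bullet> lop (M \<odot> S) a (t \<bullet> tp T M (mun A) x)) (mun B)"
      using that by (simp add: pa kl)
    also have "\<dots> = t \<bullet> tp T M a x" using that by (simp add: rk ta[symmetric])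
    finally show ?thesis by simp
  qed
  then have "represents m g t p" using pe by (simp add: represents_iff Hom_def)
  then show ?thesis by blast
qed

text \<open>If \<open>p\<close> has the semilinear inverse \<open>q\<close> then \<open>x \<otimes> b \<mapsto> 1 \<otimes> q(x b)\<close> is inverse to \<open>t\<close>.\<close>
lemma represents_invertible:
  assumes "represents m g t p" and q: "equivariant (snd (gsrc m) (inv\<^bsub>G\<^esub> g)) (snd (gtrg m) (inv\<^bsub>G\<^esub> g)) (gbim m) (gbim m) q"
    and pq: "p \<cdot> q = Ident V (bobj (gbim m))" "q \<cdot> p = Ident V (bobj (gbim m))"
  shows "\<exists>s. inverse_pair V t s"
proof -
  obtain k where k: "k \<in> Hom V (rel_obj V M S) (bobj M)"
    and k2 [simp]: "\<And>x b. x \<in> elts M \<Longrightarrow> b \<in> El (mobj B) \<Longrightarrow> k \<bullet> tp M S x b = rop M x b"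
    by (rule right_collapse) blast
  obtain l where l: "l \<in> Hom V (bobj M) (rel_obj V T M)"
    and l2 [simp]: "\<And>x. x \<in> elts M \<Longrightarrow> l \<bullet> x = tp T M (mun A) x"
    by (rule left_include) blast
  have p: "equivariant \<alpha> \<beta> M M p" and t: "t \<in> Hom V (rel_obj V T M) (rel_obj V M S)"
    and ta [simp]: "\<And>a x. a \<in> El (mobj A) \<Longrightarrow> x \<in> elts M \<Longrightarrow> t \<bullet> tp T M a x = tp M S (lop M a (p \<bullet> x)) (mun B)"
    using assms by (simp_all add: represents_iff)
  define \<alpha>' where "\<alpha>' = snd (gsrc m) (inv\<^bsub>G\<^esub> g)"
  have q: "equivariant \<alpha>' (snd (gtrg m) (inv\<^bsub>G\<^esub> g)) M M q" using q by (simp add: M_def \<alpha>'_def)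
  have \<alpha>' [simp]: "\<alpha> \<bullet> \<alpha>' \<bullet> a = a" if "a \<in> El (mobj A)" for a
    using that \<alpha>_facts(7) by (simp add: \<alpha>'_def)
  note [simp] = equivariantD[OF p] t[THEN HomD] equivariantD[OF q] k[THEN HomD] l[THEN HomD]
  have pq' [simp]: "p \<bullet> q \<bullet> x = x" "q \<bullet> p \<bullet> x = x" if "x \<in> elts M" for x
    using that arg_cong[OF pq(1), of "\<lambda>f. f \<bullet> x"] arg_cong[OF pq(2), of "\<lambda>f. f \<bullet> x"]
    by (simp_all flip: M_def)
  have "inverse_pair V t (l \<cdot> q \<cdot> k)"
  proof (rule inverse_pairI[of t "rel_obj V T M" "rel_obj V M S"])
    show "(l \<cdot> q \<cdot> k) \<bullet> t \<bullet> tp T M (gen (mobj A)) (bgen M) = tp T M (gen (mobj A)) (bgen M)"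
      using bimod_right(2)[of M "lop M (gen (mobj A)) (p \<bullet> bgen M)"] by simp
    show "t \<bullet> (l \<cdot> q \<cdot> k) \<bullet> tp M S (bgen M) (gen (mobj B)) = tp M S (bgen M) (gen (mobj B))"
      using bimod_left(2)[of M "rop M (bgen M) (gen (mobj B))"] by simp
  qed (simp_all add: Hom_def)
  then show ?thesis by blast
qed

end

end

context group_bimodule_setting
begin

lemma representsD:
  assumes "represents m g t p"
  shows "t \<in> Arr V" "Dom V t = rel_obj V (twist V (gsrc m) g) (gbim m)"
    "Cod V t = rel_obj V (gbim m) (twist V (gtrg m) g)"
    "equivariant (snd (gsrc m) g) (snd (gtrg m) g) (gbim m) (gbim m) p"
    "\<And>a x. a \<in> El (mobj (fst (gsrc m))) \<Longrightarrow> x \<in> El (bobj (gbim m)) \<Longrightarrow>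
      t \<bullet> tp (twist V (gsrc m) g) (gbim m) a x
        = tp (gbim m) (twist V (gtrg m) g) (lop (gbim m) a (p \<bullet> x)) (mun (fst (gtrg m)))"
  using assms by (auto simp: represents_def Hom_def)

lemma twist_one: "is_gmon V G A \<Longrightarrow> twist V A \<one>\<^bsub>G\<^esub> = unit_bimod (fst A)"
  using gmon_hom(1,4)[of A] is_mon_typing[of "fst A"] by (simp add: twist_def unit_bimod_def)

text \<open>On elements the composite is \<open>x \<mapsto> 1 \<otimes> x \<mapsto> p(x) \<otimes> 1 \<mapsto> p(x)\<close>.  As \<open>\<alpha>\<close> is a homomorphism, the
  twist by the neutral element is the unit bimodule on the nose.\<close>
lemma twisted_unit_condition:
  assumes base: "is_gcell_base V G m" and r: "represents m \<one>\<^bsub>G\<^esub> t p"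
  shows "rel_runit V (gbim m)
     \<cdot> lwhisk V (gbim m) (twist V (gtrg m) \<one>\<^bsub>G\<^esub>) (unit_bimod (fst (gtrg m))) (inverse_of V (twist_eta V (gtrg m)))
     \<cdot> t
     \<cdot> rwhisk V (unit_bimod (fst (gsrc m))) (twist V (gsrc m) \<one>\<^bsub>G\<^esub>) (twist_eta V (gsrc m)) (gbim m)
     \<cdot> inverse_of V (rel_lunit V (gbim m)) = p"
proof -
  note b = is_gcell_baseD[OF base]
  note [simp] = b gmon_hom(1)[OF b(1)] gmon_hom(1)[OF b(2)] twist_one[OF b(1)] twist_one[OF b(2)]
  note R = representsD[OF r, simplified]
  note L = rel_lunit_simps[OF b(3), simplified] and Rr = rel_runit_simps[OF b(3), simplified]
  note [simp] = R(1,2,3,5) equivariantD(7-9)[OF R(4) b(3) b(3)] L Rr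
  let ?A = "unit_bimod (fst (gsrc m))" and ?B = "unit_bimod (fst (gtrg m))" and ?M = "gbim m"
  have eA: "bimod_hom ?A ?A (Ident V (mobj (fst (gsrc m))))" and eB: "bimod_hom ?B ?B (Ident V (mobj (fst (gtrg m))))"
    using equivariant_ident[of ?A] equivariant_ident[of ?B] by simp_all
  note w1 = rwhisk[of ?A ?A ?M, OF _ _ _ _ _ _ eA, simplified]
  note w2 = lwhisk[of ?M ?B ?B, OF _ _ _ _ _ _ eB, simplified]
  note [simp] = w1(1-4) w2(1-4)
  have pl: "lop ?M (mun (fst (gsrc m))) (p \<bullet> bgen ?M) = p \<bullet> bgen ?M"
    "rop ?M (p \<bullet> bgen ?M) (mun (fst (gtrg m))) = p \<bullet> bgen ?M"
    using bimod_left(2)[of ?M "p \<bullet> bgen ?M"] bimod_right(2)[of ?M "p \<bullet> bgen ?M"] by simp_all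
  show ?thesis
    by (rule dense_ext[of "bgen ?M" "bobj ?M" _ _ "bobj ?M"])
      (simp_all add: Hom_def twist_eta_def pl)
qed

text \<open>The inverse of \<open>a \<otimes> b \<mapsto> a \<alpha>\<^sub>g(b)\<close> is \<open>a \<mapsto> a \<otimes> 1\<close>.\<close>
lemma twist_mu_simps:
  assumes A: "is_gmon V G A" and g: "g \<in> carrier G" and h: "h \<in> carrier G"
  shows "twist_mu V A g h \<in> Arr V" "Dom V (twist_mu V A g h) = rel_obj V (twist V A g) (twist V A h)"
    "Cod V (twist_mu V A g h) = mobj (fst A)"
    "\<And>a b. a \<in> El (mobj (fst A)) \<Longrightarrow> b \<in> El (mobj (fst A)) \<Longrightarrow>
      twist_mu V A g h \<bullet> tp (twist V A g) (twist V A h) a b = mop (fst A) a (snd A g \<bullet> b)"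
    "bimod_hom (twist V A g \<odot> twist V A h) (twist V A (g \<otimes>\<^bsub>G\<^esub> h)) (twist_mu V A g h)"
    "invertible V (twist_mu V A g h)"
    "\<And>a. a \<in> El (mobj (fst A)) \<Longrightarrow>
      inverse_of V (twist_mu V A g h) \<bullet> a = tp (twist V A g) (twist V A h) a (mun (fst A))"
    "bimod_hom (twist V A (g \<otimes>\<^bsub>G\<^esub> h)) (twist V A g \<odot> twist V A h) (inverse_of V (twist_mu V A g h))"
proof -
  let ?Tg = "twist V A g" and ?Th = "twist V A h" and ?a = "mobj (fst A)"
  note [simp] = A g h gmon_hom(1)[OF A] gmon_app[OF A g] gmon_app[OF A h] is_mon_typing[OF gmon_hom(1)[OF A]]
  let ?k = "mmul (fst A) \<cdot> (Ident V ?a \<^bold>\<otimes> snd A g)"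
  have k: "?k \<in> Hom V (bobj ?Tg \<boxtimes> bobj ?Th) ?a" by (simp add: Hom_def)
  have ka: "?k \<bullet> (x \<parallel> y) = mop (fst A) x (snd A g \<bullet> y)" if "x \<in> El ?a" "y \<in> El ?a" for x y
    using that by (simp add: mop_def)
  have b: "?k \<bullet> (rop ?Tg (bgen ?Tg) y \<parallel> bgen ?Th) = ?k \<bullet> (bgen ?Tg \<parallel> lop ?Th y (bgen ?Th))"
    if "y \<in> lscal ?Th" for y
    using that by (simp add: ka del: app_comp)
  note d = descend_rel[OF _ _ _ k _ _ b]
  have mh: "twist_mu V A g h \<in> Hom V (rel_obj V ?Tg ?Th) ?a"
    unfolding twist_mu_def by (rule d(1)) simp_all
  then show [simp]: "twist_mu V A g h \<in> Arr V" "Dom V (twist_mu V A g h) = rel_obj V ?Tg ?Th"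
    "Cod V (twist_mu V A g h) = ?a" by (simp_all add: Hom_def)
  show [simp]: "twist_mu V A g h \<bullet> tp ?Tg ?Th x y = mop (fst A) x (snd A g \<bullet> y)"
    if "x \<in> El ?a" "y \<in> El ?a" for x y
    using d(2)[of x y] that ka[of x y] by (simp add: twist_mu_def del: app_comp)
  show e: "bimod_hom (?Tg \<odot> ?Th) (twist V A (g \<otimes>\<^bsub>G\<^esub> h)) (twist_mu V A g h)"
    by (rule equivariantI[of _ _ _ _ _ "tp ?Tg ?Th (gen ?a) (gen ?a)"]) (simp_all add: Hom_def)
  let ?i = "rel_proj V ?Tg ?Th \<cdot> (Ident V ?a \<^bold>\<otimes> munit (fst A)) \<cdot> inverse_of V (run V ?a)"
  have ih: "?i \<in> Hom V ?a (rel_obj V ?Tg ?Th)" by (simp add: Hom_def)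
  have ia: "?i \<bullet> x = tp ?Tg ?Th x (mun (fst A))" if "x \<in> El ?a" for x
    using that by (simp add: tp_def mun_def)
  have bal: "tp ?Tg ?Th (mop (fst A) x (snd A g \<bullet> y)) (mun (fst A)) = tp ?Tg ?Th x y"
    if "x \<in> El ?a" "y \<in> El ?a" for x y
    using tp_balanced[of ?Tg ?Th x y "mun (fst A)"] that by simp
  have p: "inverse_pair V (twist_mu V A g h) ?i"
    by (rule inverse_pairI[OF mh ih, of "tp ?Tg ?Th (gen ?a) (gen ?a)" "gen ?a"])
      (simp_all add: ia bal del: app_comp)
  then show [simp]: "invertible V (twist_mu V A g h)" by (auto simp: invertible_def)
  show "inverse_of V (twist_mu V A g h) \<bullet> x = tp ?Tg ?Th x (mun (fst A))" if "x \<in> El ?a" for x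
    using ia[OF that] inverse_of_eq[OF p] by simp
  show "bimod_hom (twist V A (g \<otimes>\<^bsub>G\<^esub> h)) (?Tg \<odot> ?Th) (inverse_of V (twist_mu V A g h))"
    by (rule bimod_hom_inverse[OF _ _ _ _ e]) (simp_all add: inverse_pair_inverse_of)
qed

text \<open>On elements: \<open>a \<otimes> x \<mapsto> a \<otimes> 1 \<otimes> x \<mapsto> a \<otimes> q(x) \<otimes> 1 \<mapsto> a p(q(x)) \<otimes> 1 \<otimes> 1 \<mapsto> a p(q(x)) \<otimes> 1\<close>, where the last
  step uses \<open>\<beta>\<^sub>g(1) = 1\<close>.\<close>
lemma twisted_cocycle:
  assumes base: "is_gcell_base V G m" and g: "g \<in> carrier G" and h: "h \<in> carrier G"
    and r: "represents m g t p" and s: "represents m h s q"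
  defines "M \<equiv> gbim m" and "A \<equiv> twist V (gsrc m)" and "B \<equiv> twist V (gtrg m)"
  shows "represents m (g \<otimes>\<^bsub>G\<^esub> h)
     (lwhisk V M (B g \<odot> B h) (B (g \<otimes>\<^bsub>G\<^esub> h)) (twist_mu V (gtrg m) g h)
               \<cdot> rel_assoc V M (B g) (B h)
               \<cdot> rwhisk V (A g \<odot> M) (M \<odot> B g) t (B h)
               \<cdot> inverse_of V (rel_assoc V (A g) M (B h))
               \<cdot> lwhisk V (A g) (A h \<odot> M) (M \<odot> B h) s
               \<cdot> rel_assoc V (A g) (A h) M
               \<cdot> rwhisk V (A (g \<otimes>\<^bsub>G\<^esub> h)) (A g \<odot> A h) (inverse_of V (twist_mu V (gsrc m) g h)) M)
     (p \<cdot> q)" (is "represents m _ ?c _")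
proof -
  note b = is_gcell_baseD[OF base]
  let ?a = "fst (gsrc m)" and ?b = "fst (gtrg m)" and ?gh = "g \<otimes>\<^bsub>G\<^esub> h"
  have tw [simp]: "is_bimod V (A k)" "is_bimod V (B k)" if "k \<in> carrier G" for k
    using that b unfolding A_def B_def by simp_all
  have tws [simp]: "bsrc (A k) = ?a" "btrg (A k) = ?a" "bobj (A k) = mobj ?a" "lop (A k) = mop ?a"
    "bsrc (B k) = ?b" "btrg (B k) = ?b" "bobj (B k) = mobj ?b" "lop (B k) = mop ?b" for k
    by (simp_all add: A_def B_def)
  have M [simp]: "is_bimod V M" "bsrc M = ?a" "btrg M = ?b" using b by (simp_all add: M_def)
  note [simp] = g h gmon_hom(1)[OF b(1)] gmon_hom(1)[OF b(2)] gmon_app[OF b(1) g] gmon_app[OF b(2) g]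
  note t = representsD[OF r, folded M_def A_def B_def] and s' = representsD[OF s, folded M_def A_def B_def]
  note mA = twist_mu_simps[OF b(1) g h, folded A_def] and mB = twist_mu_simps[OF b(2) g h, folded B_def]
  note ht = represents_bimod_hom[OF base g r, folded M_def A_def B_def]
    and hs = represents_bimod_hom[OF base h s, folded M_def A_def B_def]
  note w1 = lwhisk[OF _ _ _ _ _ _ mB(5), of M, simplified]
  note w2 = rwhisk[OF _ _ _ _ _ _ ht, of "B h", simplified]
  note w3 = lwhisk[OF _ _ _ _ _ _ hs, of "A g", simplified]
  note w4 = rwhisk[OF _ _ _ _ _ _ mA(8), of M, simplified]
  note eq = equivariantD(7-9)[OF t(4) M(1) M(1)] equivariantD(7-9)[OF s'(4) M(1) M(1)]
  note [simp] = w1(1-4) w2(1-4) w3(1-4) w4(1-4) t(1,2,3,5) s'(1,2,3,5) mA(1-4,6,7) mB(1-4) eq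
  have u [simp]: "lop M (mun ?a) x = x" if "x \<in> elts M" for x using that bimod_left(2)[of M x] by simp
  have mm [simp]: "mop ?b (mun ?b) (snd (gtrg m) g \<bullet> mun ?b) = mun ?b" by simp
  have pq: "equivariant (snd (gsrc m) ?gh) (snd (gtrg m) ?gh) M M (p \<cdot> q)"
    using equivariant_comp[OF M(1) M(1) M(1) s'(4) t(4)] gmon_hom(3)[OF b(1) g h] gmon_hom(3)[OF b(2) g h] by simp
  have ca: "?c \<bullet> tp (A ?gh) M a x = tp M (B ?gh) (lop M a ((p \<cdot> q) \<bullet> x)) (mun ?b)"
    if "a \<in> El (mobj ?a)" "x \<in> elts M" for a x
    using that by simp
  have ch: "?c \<in> Hom V (rel_obj V (A ?gh) M) (rel_obj V M (B ?gh))" by (simp add: Hom_def)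
  show ?thesis unfolding represents_def M_def[symmetric] A_def[symmetric] B_def[symmetric] using pq ca ch by blast
qed

text \<open>Both sides of the first equation have the form \<open>a \<otimes> x \<mapsto> a y \<otimes> 1\<close>, with \<open>y = q(f(x))\<close> and
  \<open>y = f(p(x))\<close>, and \<open>y \<mapsto> y \<otimes> 1\<close> is injective.\<close>
lemma twisted_equivariance:
  assumes m: "is_gcell_base V G m" and n: "is_gcell_base V G n" and g: "g \<in> carrier G"
    and r: "represents m g t p" and s: "represents n g s q"
    and e: "gsrc m = gsrc n" "gtrg m = gtrg n" and f: "bimod_map V (gbim m) (gbim n) f"
  shows "s \<cdot> lwhisk V (twist V (gsrc m) g) (gbim m) (gbim n) f
      = rwhisk V (gbim m) (gbim n) f (twist V (gtrg m) g) \<cdot> t \<longleftrightarrow> f \<cdot> p = q \<cdot> f"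
    (is "?l = ?r \<longleftrightarrow> _")
proof -
  note b = is_gcell_baseD[OF m] and c = is_gcell_baseD[OF n]
  have f: "bimod_hom (gbim m) (gbim n) f" using f b bimod_map_equivariant by auto
  let ?a = "fst (gsrc n)" and ?b = "fst (gtrg n)" and ?A = "twist V (gsrc n) g" and ?B = "twist V (gtrg n) g"
    and ?M = "gbim m" and ?N = "gbim n"
  note [simp] = b(3,4,5) c(1-5) e g gmon_hom(1)[OF c(1)] gmon_hom(1)[OF c(2)]
  note t = representsD[OF r, unfolded e] and s' = representsD[OF s]
  note w1 = lwhisk[OF _ _ _ _ _ _ f, of ?A, simplified] and w2 = rwhisk[OF _ _ _ _ _ _ f, of ?B, simplified]
  note eq = equivariantD(7-9)[OF t(4) b(3) b(3)] equivariantD(7-9)[OF s'(4) c(3) c(3)]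
  note fe = equivariantD[OF f b(3) c(3), simplified]
  note [simp] = w1(1-4) w2(1-4) t(1,2,3,5) s'(1,2,3,5) eq fe
  have l: "?l \<bullet> tp ?A ?M a x = tp ?N ?B (lop ?N a (q \<bullet> f \<bullet> x)) (mun ?b)"
    and rr: "?r \<bullet> tp ?A ?M a x = tp ?N ?B (lop ?N a (f \<bullet> p \<bullet> x)) (mun ?b)"
    if "a \<in> El (mobj ?a)" "x \<in> elts ?M" for a x
    using that by simp_all
  have lh: "?l \<in> Hom V (rel_obj V ?A ?M) (rel_obj V ?N ?B)" "?r \<in> Hom V (rel_obj V ?A ?M) (rel_obj V ?N ?B)"
    by (simp_all add: Hom_def)
  show ?thesis
  proof
    assume fp: "f \<cdot> p = q \<cdot> f"
    have fpx: "f \<bullet> p \<bullet> x = q \<bullet> f \<bullet> x" if "x \<in> elts ?M" for x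
      using that arg_cong[OF fp, of "\<lambda>f. f \<bullet> x"] by simp
    show "?l = ?r"
      by (rule dense_ext[OF _ _ lh, of "tp ?A ?M (gen (mobj ?a)) (bgen ?M)"]) (simp_all add: fpx)
  next
    assume lr: "?l = ?r"
    let ?x = "bgen ?M"
    let ?w = "tp ?A ?M (mun ?a) ?x"
    have "tp ?N ?B (lop ?N (mun ?a) (q \<bullet> f \<bullet> ?x)) (mun ?b) = ?l \<bullet> ?w" by (rule l[symmetric]) simp_all
    also have "\<dots> = ?r \<bullet> ?w" by (simp only: lr)
    also have "\<dots> = tp ?N ?B (lop ?N (mun ?a) (f \<bullet> p \<bullet> ?x)) (mun ?b)" by (rule rr) simp_all
    finally have "tp ?N ?B (lop ?N (mun ?a) (q \<bullet> f \<bullet> ?x)) (mun ?b)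
      = tp ?N ?B (lop ?N (mun ?a) (f \<bullet> p \<bullet> ?x)) (mun ?b)" .
    then have "q \<bullet> f \<bullet> ?x = f \<bullet> p \<bullet> ?x"
      using twist_right_inject[OF n g, of "q \<bullet> f \<bullet> ?x" "f \<bullet> p \<bullet> ?x"]
        bimod_left(2)[of ?N "q \<bullet> f \<bullet> ?x"] bimod_left(2)[of ?N "f \<bullet> p \<bullet> ?x"] by simp
    then show "f \<cdot> p = q \<cdot> f"
      by (intro dense_ext[of ?x "bobj ?M" _ _ "bobj ?N"]) (simp_all add: Hom_def)
  qed
qed

text \<open>On elements: \<open>a \<otimes> x \<otimes> y \<mapsto> a p(x) \<otimes> 1 \<otimes> y \<mapsto> a p(x) \<otimes> q(y) \<otimes> 1\<close>.\<close>
lemma twisted_composite: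
  assumes m: "is_gcell_base V G m" and n: "is_gcell_base V G n" and c: "gtrg m = gsrc n" and g: "g \<in> carrier G"
    and r: "represents m g (gstr m g) p" and s: "represents n g (gstr n g) q"
  shows "represents (gcomp V G H m n) g (Gtw_comp V m n g)
    (rel_map V (gbim m) (gbim n) (gbim m) (gbim n) p q)"
proof -
  note b = is_gcell_baseD[OF m] and d = is_gcell_baseD[OF n]
  let ?M = "gbim m" and ?N = "gbim n" and ?A = "twist V (gsrc m) g" and ?B = "twist V (gsrc n) g" and ?C = "twist V (gtrg n) g"
  let ?a = "fst (gsrc m)" and ?b = "fst (gsrc n)" and ?c = "fst (gtrg n)"
  note [simp] = b(1-5) d(1-5) c g gmon_hom(1)[OF b(1)] gmon_hom(1)[OF d(1)] gmon_hom(1)[OF d(2)]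
  note t = representsD[OF r, unfolded c] and s' = representsD[OF s]
  note ht = represents_bimod_hom[OF m g r, unfolded c] and hs = represents_bimod_hom[OF n g s]
  note w1 = rwhisk[OF _ _ _ _ _ _ ht, of ?N, simplified] and w2 = lwhisk[OF _ _ _ _ _ _ hs, of ?M, simplified]
  note rm = rel_map[OF b(3) d(3) _ b(3) d(3) _ t(4) s'(4), simplified]
  note eq = equivariantD(7-9)[OF t(4) b(3) b(3)] equivariantD(7-9)[OF s'(4) d(3) d(3)]
  note [simp] = w1(1-4) w2(1-4) t(1,2,3,5) s'(1,2,3,5) eq rm(1)[THEN HomD] rm(2)
  have u [simp]: "tp ?M (?N \<odot> ?C) (lop ?M a x) (tp ?N ?C (lop ?N (mun ?b) y) (mun ?c)) =  tp ?M (?N \<odot> ?C) (lop ?M a x) (tp ?N ?C y (mun ?c))"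
    if "y \<in> elts ?N" for a x y
    using that bimod_left(2)[of ?N y] by simp
  let ?P = "?M \<odot> ?N" and ?h = "rel_map V ?M ?N ?M ?N p q" and ?t = "Gtw_comp V m n g"
  have gb: "is_gcell_base V G (gcomp V G H m n)" by (rule gcomp_base[OF m n c])
  \<comment> \<open>the defining formula of \<open>t'\<close> holds for all elements of \<open>M \<odot> N\<close>; comparing on the classes \<open>x \<otimes> y\<close> suffices\<close>
  obtain t' where r': "represents (gcomp V G H m n) g t' ?h"
    using represents_exists[OF gb g, of ?h] rm(3) by auto
  note t' = representsD[OF r', simplified]
  note [simp] = t'(1,2,3,5)
  have "?t = t'"
    by (rule dense_ext[of "tp ?A ?P (gen (mobj ?a)) (tp ?M ?N (bgen ?M) (bgen ?N))"
          "rel_obj V ?A ?P" _ _ "rel_obj V ?P ?C"])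
      (simp_all add: Hom_def Gtw_comp_def Let_def)
  then show ?thesis using r' by simp
qed

text \<open>On elements the canonical isomorphism is \<open>a \<otimes> b \<mapsto> a \<alpha>\<^sub>g(b) \<mapsto> 1 \<otimes> a \<alpha>\<^sub>g(b)\<close>, and the factor \<open>1\<close> can be
  moved to the other side of the tensor sign of \<open>A \<odot> A\<^sup>g\<close>.\<close>
lemma twisted_unit:
  assumes A: "is_gmon V G A" and g: "g \<in> carrier G"
  shows "represents (gunit G U A) g (Gtw_unit V A g) (snd A g)"
proof -
  note [simp] = A g gmon_hom(1)[OF A] gmon_app[OF A g]
  have e: "equivariant (snd A g) (snd A g) (unit_bimod (fst A)) (unit_bimod (fst A)) (snd A g)"
    by (rule mon_hom_equivariant) (simp_all add: gmon_hom(2)[OF A g])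
  note L = rel_lunit_simps[of "twist V A g", simplified] and R = rel_runit_simps[of "twist V A g", simplified]
  note [simp] = L R
  have bal: "tp (unit_bimod (fst A)) (twist V A g) (mun (fst A)) x = tp (unit_bimod (fst A)) (twist V A g) x (mun (fst A))"
    if "x \<in> El (mobj (fst A))" for x
    using tp_balanced[of "unit_bimod (fst A)" "twist V A g" "mun (fst A)" x "mun (fst A)"] that by simp
  show ?thesis using e by (simp add: represents_def Gtw_unit_def Hom_def bal)
qed

end

section \<open>Strict isomorphisms of bicategories\<close>

lemma (in bicategory) hom_category_category:
  "category (hom_category B X Y)"
proof -
  interpret v: category "vert B" by (rule vert_category)
  have h: "Hom (hom_category B X Y) M N = {t \<in> cell2 B M N. M \<in> cell1 B X Y \<and> N \<in> cell1 B X Y}" for M N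
    by (auto simp: Hom_def hom_category_def)
  show ?thesis
  proof
    show "Ident (hom_category B X Y) M \<in> Hom (hom_category B X Y) M M"
      if "M \<in> Obj (hom_category B X Y)" for M
      using that v.ident_in[of M] by (simp add: h) (simp add: hom_category_def cell1_def)
  qed (auto simp: h v.comp_in v.comp_assoc v.comp_ident v.ident_comp, auto simp: hom_category_def v.comp_in v.comp_ident v.ident_comp v.comp_assoc)
qed

lemma (in bicategory) equivalent_cells_refl:
  "X \<in> cells B \<Longrightarrow> equivalent_cells B X X"
proof -
  interpret v: category "vert B" by (rule vert_category)
  assume X: "X \<in> cells B"
  let ?U = "unit1 B X"
  have U: "?U \<in> cell1 B X X" by (rule unit1_in[OF X])
  have l: "blunit B ?U \<in> cell2 B (?U \<diamondop> ?U) ?U" "invertible (vert B) (blunit B ?U)"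
    using blunit_in[OF U] blunit_iso[OF U] by auto
  then have "inverse_of (vert B) (blunit B ?U) \<in> cell2 B ?U (?U \<diamondop> ?U)"
    "invertible (vert B) (inverse_of (vert B) (blunit B ?U))"
    by (auto simp: Hom_def)
  then show ?thesis unfolding equivalent_cells_def using U l by blast
qed

text \<open>Isomorphisms of bicategories that are the identity on 0-cells and preserve all
  operations on the nose; \<open>S1\<close> and \<open>S2\<close> are the inverses on 1-cells and on 2-cells.\<close>
locale strict_isomorphism = B: bicategory B + D: bicategory D
  for B :: "('o, 'f, 't) bicategory" and D :: "('o, 'h, 's) bicategory" +
  fixes T1 T2 S1 S2
  assumes cells: "cells D = cells B"
    and T: "is_functor (vert B) (vert D) T1 T2"
    and S: "is_functor (vert D) (vert B) S1 S2"
    and ST: "M \<in> Obj (vert B) \<Longrightarrow> S1 (T1 M) = M" "t \<in> Arr (vert B) \<Longrightarrow> S2 (T2 t) = t"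
    and TS: "K \<in> Obj (vert D) \<Longrightarrow> T1 (S1 K) = K" "s \<in> Arr (vert D) \<Longrightarrow> T2 (S2 s) = s"
    and ends: "M \<in> Obj (vert B) \<Longrightarrow> src D (T1 M) = src B M \<and> trg D (T1 M) = trg B M"
    and T_unit: "X \<in> cells B \<Longrightarrow> T1 (unit1 B X) = unit1 D X"
    and T_hcomp1: "M \<in> cell1 B X Y \<Longrightarrow> N \<in> cell1 B Y Z \<Longrightarrow> T1 (M \<diamondop>\<^bsub>B\<^esub> N) = T1 M \<diamondop>\<^bsub>D\<^esub> T1 N"
    and T_hcomp2: "M \<in> cell1 B X Y \<Longrightarrow> N \<in> cell1 B Y Z \<Longrightarrow> t \<in> cell2 B M M' \<Longrightarrow> r \<in> cell2 B N N'
      \<Longrightarrow> T2 (t \<star>\<^bsub>B\<^esub> r) = T2 t \<star>\<^bsub>D\<^esub> T2 r"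
    and T_assoc: "M \<in> cell1 B W X \<Longrightarrow> N \<in> cell1 B X Y \<Longrightarrow> P \<in> cell1 B Y Z
      \<Longrightarrow> T2 (bassoc B M N P) = bassoc D (T1 M) (T1 N) (T1 P)"
    and T_lunit: "M \<in> cell1 B X Y \<Longrightarrow> T2 (blunit B M) = blunit D (T1 M)"
    and T_runit: "M \<in> cell1 B X Y \<Longrightarrow> T2 (brunit B M) = brunit D (T1 M)"
begin

sublocale vB: category "vert B" by (rule B.vert_category)
sublocale vD: category "vert D" by (rule D.vert_category)

lemma T1_in: "M \<in> cell1 B X Y \<Longrightarrow> T1 M \<in> cell1 D X Y"
  using T ends by (auto simp: cell1_def is_functor_def)

lemma T2_in: "t \<in> cell2 B M N \<Longrightarrow> T2 t \<in> cell2 D (T1 M) (T1 N)"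
  using T by (auto simp: is_functor_def Hom_def)

lemma S1_in: "N \<in> cell1 D X Y \<Longrightarrow> S1 N \<in> cell1 B X Y"
  using S ends[of "S1 N"] TS by (auto simp: cell1_def is_functor_def)

definition F where
  "F = \<lparr>F0 = (\<lambda>X. X), F1 = T1, F2 = T2, Fcomp = (\<lambda>M N. Ident (vert D) (T1 M \<diamondop>\<^bsub>D\<^esub> T1 N)),
     Funit = (\<lambda>X. Ident (vert D) (unit1 D X))\<rparr>"

lemma F_simps [simp]: "F0 F X = X" "F1 F = T1" "F2 F = T2"
  "Fcomp F M N = Ident (vert D) (T1 M \<diamondop>\<^bsub>D\<^esub> T1 N)" "Funit F X = Ident (vert D) (unit1 D X)"
  by (simp_all add: F_def)

lemma cell1_obj: "M \<in> cell1 D X Y \<Longrightarrow> M \<in> Obj (vert D)"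
  by (simp add: cell1_def)

lemma pseudofunctor: "pseudofunctor B D F"
proof (intro_locales, rule pseudofunctor_axioms.intro)
  show "F0 F X \<in> cells D" if "X \<in> cells B" for X using that cells by simp
  show "F1 F M \<in> cell1 D (F0 F X) (F0 F Y)" if "M \<in> cell1 B X Y" for M X Y using T1_in that by simp
  show "is_functor (vert B) (vert D) (F1 F) (F2 F)" using T by simp
  show "Fcomp F M N \<in> cell2 D (F1 F M \<diamondop>\<^bsub>D\<^esub> F1 F N) (F1 F (M \<diamondop>\<^bsub>B\<^esub> N))" "invertible (vert D) (Fcomp F M N)"
    if "M \<in> cell1 B X Y" "N \<in> cell1 B Y Z" for M N X Y Z
    using D.hcomp1_in[OF T1_in T1_in, OF that, THEN cell1_obj] vD.ident_in T_hcomp1[OF that] by simp_all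
  show "Fcomp F M' N' \<cdot>\<^bsub>vert D\<^esub> (F2 F t \<star>\<^bsub>D\<^esub> F2 F s) = F2 F (t \<star>\<^bsub>B\<^esub> s) \<cdot>\<^bsub>vert D\<^esub> Fcomp F M N"
    if a: "M \<in> cell1 B X Y" "N \<in> cell1 B Y Z" "t \<in> cell2 B M M'" "s \<in> cell2 B N N'" for M N M' N' t s X Y Z
    using D.hcomp2_in[OF T1_in T1_in T2_in T2_in, OF a] T_hcomp2[OF a] vD.comp_ident vD.ident_comp by simp
  show "Funit F X \<in> cell2 D (unit1 D (F0 F X)) (F1 F (unit1 B X))" "invertible (vert D) (Funit F X)"
    if "X \<in> cells B" for X
    using D.unit1_in[of X, THEN cell1_obj] that cells vD.ident_in T_unit[OF that] by simp_all
  show "F2 F (bassoc B M N P) \<cdot>\<^bsub>vert D\<^esub> Fcomp F (M \<diamondop>\<^bsub>B\<^esub> N) P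
            \<cdot>\<^bsub>vert D\<^esub> (Fcomp F M N \<star>\<^bsub>D\<^esub> Ident (vert D) (F1 F P))
        = Fcomp F M (N \<diamondop>\<^bsub>B\<^esub> P) \<cdot>\<^bsub>vert D\<^esub> (Ident (vert D) (F1 F M) \<star>\<^bsub>D\<^esub> Fcomp F N P)
            \<cdot>\<^bsub>vert D\<^esub> bassoc D (F1 F M) (F1 F N) (F1 F P)"
    if a: "M \<in> cell1 B W X" "N \<in> cell1 B X Y" "P \<in> cell1 B Y Z" for M N P W X Y Z
  proof -
    note t = T1_in[OF a(1)] T1_in[OF a(2)] T1_in[OF a(3)]
    note h = D.hcomp1_in[OF t(1,2)] D.hcomp1_in[OF t(2,3)]
    note hh = D.hcomp1_in[OF h(1) t(3)] D.hcomp1_in[OF t(1) h(2)]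
    note i = D.hcomp2_ident[OF h(1) t(3)] D.hcomp2_ident[OF t(1) h(2)]
    note [simp] = T_hcomp1[OF a(1,2)] T_hcomp1[OF a(2,3)] T_assoc[OF a] i
      hh[THEN cell1_obj] D.bassoc_in[OF t, THEN HomD]
    show ?thesis by simp
  qed
  show "F2 F (blunit B M) \<cdot>\<^bsub>vert D\<^esub> Fcomp F (unit1 B X) M
            \<cdot>\<^bsub>vert D\<^esub> (Funit F X \<star>\<^bsub>D\<^esub> Ident (vert D) (F1 F M)) = blunit D (F1 F M)"
    "F2 F (brunit B M) \<cdot>\<^bsub>vert D\<^esub> Fcomp F M (unit1 B Y)
            \<cdot>\<^bsub>vert D\<^esub> (Ident (vert D) (F1 F M) \<star>\<^bsub>D\<^esub> Funit F Y) = brunit D (F1 F M)"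
    if a: "M \<in> cell1 B X Y" for M X Y
  proof -
    have X: "X \<in> cells B" "Y \<in> cells B" using a B.src_in B.trg_in by (auto simp: cell1_def)
    note t = T1_in[OF a]
    have u: "unit1 D X \<in> cell1 D X X" "unit1 D Y \<in> cell1 D Y Y" using X cells D.unit1_in by auto
    note [simp] = T_lunit[OF a] T_runit[OF a] T_unit[OF X(1)] T_unit[OF X(2)]
      D.hcomp2_ident[OF u(1) t] D.hcomp2_ident[OF t u(2)]
      D.hcomp1_in[OF u(1) t, THEN cell1_obj] D.hcomp1_in[OF t u(2), THEN cell1_obj]
      D.blunit_in[OF t, THEN HomD] D.brunit_in[OF t, THEN HomD]
    show "F2 F (blunit B M) \<cdot>\<^bsub>vert D\<^esub> Fcomp F (unit1 B X) M
            \<cdot>\<^bsub>vert D\<^esub> (Funit F X \<star>\<^bsub>D\<^esub> Ident (vert D) (F1 F M)) = blunit D (F1 F M)"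
      "F2 F (brunit B M) \<cdot>\<^bsub>vert D\<^esub> Fcomp F M (unit1 B Y)
            \<cdot>\<^bsub>vert D\<^esub> (Ident (vert D) (F1 F M) \<star>\<^bsub>D\<^esub> Funit F Y) = brunit D (F1 F M)"
      by simp_all
  qed
qed

lemma hom_category_simps:
  "Obj (hom_category C X Y) = cell1 C X Y"
  "Arr (hom_category C X Y) = {t \<in> Arr (vert C). Dom (vert C) t \<in> cell1 C X Y \<and> Cod (vert C) t \<in> cell1 C X Y}"
  "Dom (hom_category C X Y) = Dom (vert C)" "Cod (hom_category C X Y) = Cod (vert C)"
  "Ident (hom_category C X Y) = Ident (vert C)" "Comp (hom_category C X Y) = Comp (vert C)"
  by (simp_all add: hom_category_def)

lemma functor_T: "is_functor (hom_category B X Y) (hom_category D X Y) T1 T2"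
  using T T1_in B.hom_category_category D.hom_category_category
  unfolding is_functor_def hom_category_simps Hom_def by (auto simp: cell1_def)

lemma functor_S: "is_functor (hom_category D X Y) (hom_category B X Y) S1 S2"
  using S S1_in B.hom_category_category D.hom_category_category
  unfolding is_functor_def hom_category_simps Hom_def by (auto simp: cell1_def)

lemma biequivalence: "biequivalence B D F"
proof -
  interpret pseudofunctor B D F by (rule pseudofunctor)
  show ?thesis
  proof
    fix X Y
    let ?B = "hom_category B X Y" and ?D = "hom_category D X Y"
    interpret hB: category ?B by (rule B.hom_category_category)
    interpret hD: category ?D by (rule D.hom_category_category)
    have "natural_iso ?B ?B (\<lambda>X. X) (\<lambda>f. f) (S1 \<circ> T1) (S2 \<circ> T2) (Ident ?B)"
      unfolding natural_iso_def
      using hB.ident_in hB.invertible_ident by (auto simp: ST hom_category_simps cell1_def)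
    moreover have "natural_iso ?D ?D (T1 \<circ> S1) (T2 \<circ> S2) (\<lambda>X. X) (\<lambda>f. f) (Ident ?D)"
      unfolding natural_iso_def
      using hD.ident_in hD.invertible_ident by (auto simp: TS hom_category_simps cell1_def)
    ultimately show "equivalence_functor ?B (hom_category D (F0 F X) (F0 F Y)) (F1 F) (F2 F)"
      unfolding equivalence_functor_def using functor_T functor_S by simp blast
  next
    show "\<exists>X\<in>cells B. equivalent_cells D (F0 F X) Z" if "Z \<in> cells D" for Z
      using that cells D.equivalent_cells_refl[OF that] by auto
  qed
qed

end

section \<open>Twisting\<close>

context group_bimodule_setting
begin

text \<open>The choices are unique by \<open>represents_left_unique\<close> and \<open>represents_right_unique\<close>, and
  restriction to the carrier keeps the families extensional.\<close>
definition twisted where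
  "twisted m = m\<lparr>gstr := restrict (\<lambda>g. SOME t. represents m g t (gstr m g)) (carrier G)\<rparr>"

definition untwisted where
  "untwisted n = n\<lparr>gstr := restrict (\<lambda>g. SOME p. represents n g (gstr n g) p) (carrier G)\<rparr>"

lemma twisted_simps [simp]:
  "gsrc (twisted m) = gsrc m" "gtrg (twisted m) = gtrg m" "gbim (twisted m) = gbim m"
  "gsrc (untwisted m) = gsrc m" "gtrg (untwisted m) = gtrg m" "gbim (untwisted m) = gbim m"
  by (simp_all add: twisted_def untwisted_def)

lemma represents_cong:
  "gsrc m = gsrc n \<Longrightarrow> gtrg m = gtrg n \<Longrightarrow> gbim m = gbim n \<Longrightarrow> represents m g t p \<longleftrightarrow> represents n g t p"
  by (simp add: represents_def)

lemma twisted_represents: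
  assumes "G_cell V G m" "g \<in> carrier G"
  shows "represents m g (gstr (twisted m) g) (gstr m g)"
  using someI_ex[OF represents_exists[OF G_cellD(1)[OF assms(1)] assms(2) G_cellD(3)[OF assms]]] assms(2)
  by (simp add: twisted_def)

lemma twisted_base:
  "is_gcell_base V G m \<Longrightarrow> is_gcell_base V G (twisted m)"
  "is_gcell_base V G m \<Longrightarrow> is_gcell_base V G (untwisted m)"
proof -
  have "gstr (twisted m) \<in> extensional (carrier G)" "gstr (untwisted m) \<in> extensional (carrier G)"
    by (simp_all add: twisted_def untwisted_def)
  then show "is_gcell_base V G m \<Longrightarrow> is_gcell_base V G (twisted m)"
    "is_gcell_base V G m \<Longrightarrow> is_gcell_base V G (untwisted m)"
    unfolding is_gcell_base_def twisted_simps by blast+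
qed

lemma twisted_eqI:
  assumes base: "is_gcell_base V G m" "is_gcell_base V G n"
    and "gsrc m = gsrc n" "gtrg m = gtrg n" "gbim m = gbim n"
    and "\<And>g. g \<in> carrier G \<Longrightarrow> gstr m g = gstr n g"
  shows "m = n"
  using assms is_gcell_baseD(6)[OF base(1)] is_gcell_baseD(6)[OF base(2)]
  by (intro gcell.equality) (auto intro: extensionalityI)

lemma Gtw_cell_twisted:
  assumes m: "G_cell V G m"
  shows "Gtw_cell V G (twisted m)"
proof -
  note M = G_cellD[OF m] and r = twisted_represents[OF m]
  note b = is_gcell_baseD[OF M(1)]
  have iso: "bimod_iso V (twist V (gsrc m) g \<odot> gbim m) (gbim m \<odot> twist V (gtrg m) g) (gstr (twisted m) g)"
    if g: "g \<in> carrier G" for g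
  proof -
    have "gstr m g \<cdot> gstr m (inv\<^bsub>G\<^esub> g) = Ident V (bobj (gbim m))"
      "gstr m (inv\<^bsub>G\<^esub> g) \<cdot> gstr m g = Ident V (bobj (gbim m))"
      using M(2,4) g group_closed by metis+
    then obtain s where s: "inverse_pair V (gstr (twisted m) g) s"
      using represents_invertible[OF M(1) g r[OF g] M(3)] g by auto
    have t: "is_bimod V (twist V (gsrc m) g \<odot> gbim m)" "is_bimod V (gbim m \<odot> twist V (gtrg m) g)"
      using b g by simp_all
    note h = represents_bimod_hom[OF M(1) g r[OF g]]
    have "bimod_hom (gbim m \<odot> twist V (gtrg m) g) (twist V (gsrc m) g \<odot> gbim m) s"
      by (rule bimod_hom_inverse[OF t _ _ h s]) (simp_all add: b)
    then show ?thesis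
      using h s b bimod_map_equivariant[OF t(1)] bimod_map_equivariant[OF t(2)]
      unfolding bimod_iso_def by auto
  qed
  have cocycle: "gstr (twisted m) (g \<otimes>\<^bsub>G\<^esub> h) = t"
    if "g \<in> carrier G" "h \<in> carrier G" "represents m (g \<otimes>\<^bsub>G\<^esub> h) t (gstr m g \<cdot> gstr m h)" for g h t
    using represents_left_unique[OF M(1) _ r that(3)[folded M(4)[OF that(1,2)]]] that by simp
  show ?thesis
    unfolding Gtw_cell_def Let_def twisted_simps
    using iso twisted_base(1)[OF M(1)] twisted_unit_condition[OF M(1) r] M(2)
      cocycle[OF _ _ twisted_cocycle[OF M(1) _ _ r r]] by simp
qed

lemma untwisted_represents:
  assumes n: "Gtw_cell V G n" and g: "g \<in> carrier G"
  shows "represents n g (gstr n g) (gstr (untwisted n) g)"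
proof -
  have base: "is_gcell_base V G n" and i: "bimod_iso V (twist V (gsrc n) g \<odot> gbim n) (gbim n \<odot> twist V (gtrg n) g) (gstr n g)"
    using assms unfolding Gtw_cell_def Let_def by auto
  note b = is_gcell_baseD[OF base]
  have t: "is_bimod V (twist V (gsrc n) g \<odot> gbim n)" using b g by simp
  have "bimod_hom (twist V (gsrc n) g \<odot> gbim n) (gbim n \<odot> twist V (gtrg n) g) (gstr n g)"
    using i bimod_map_equivariant[OF t] unfolding bimod_iso_def by blast
  from someI_ex[OF bimod_hom_represents[OF base g this]] show ?thesis
    using g by (simp add: untwisted_def)
qed

lemma G_cell_untwisted:
  assumes n: "Gtw_cell V G n"
  shows "G_cell V G (untwisted n)"
proof -
  note r = untwisted_represents[OF n]
  have base: "is_gcell_base V G n" using n by (simp add: Gtw_cell_def)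
  note N = n[unfolded Gtw_cell_def Let_def, THEN conjunct2]
  have one: "gstr (untwisted n) \<one>\<^bsub>G\<^esub> = Ident V (bobj (gbim n))"
    using twisted_unit_condition[OF base r] N by simp
  have mult: "gstr (untwisted n) (g \<otimes>\<^bsub>G\<^esub> h) = gstr (untwisted n) g \<cdot> gstr (untwisted n) h"
    if g: "g \<in> carrier G" and h: "h \<in> carrier G" for g h
    using twisted_cocycle[OF base g h r[OF g] r[OF h]] N g h
    by (intro represents_right_unique[OF base _ r]) simp_all
  show ?thesis
    using one mult representsD(4)[OF r]
    by (subst G_cell_equivariant[OF twisted_base(2)[OF base]]) simp
qed

lemma untwisted_twisted:
  assumes m: "G_cell V G m" shows "untwisted (twisted m) = m"
proof (rule twisted_eqI)
  note base = G_cellD(1)[OF m]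
  show "is_gcell_base V G (untwisted (twisted m))" "is_gcell_base V G m"
    using base by (simp_all add: twisted_base)
  show "gstr (untwisted (twisted m)) g = gstr m g" if g: "g \<in> carrier G" for g
    using represents_right_unique[OF base g _ twisted_represents[OF m g]]
      untwisted_represents[OF Gtw_cell_twisted[OF m] g] represents_cong[of "twisted m" m] by simp
qed simp_all

lemma twisted_untwisted:
  assumes n: "Gtw_cell V G n" shows "twisted (untwisted n) = n"
proof (rule twisted_eqI)
  have base: "is_gcell_base V G n" using n by (simp add: Gtw_cell_def)
  show "is_gcell_base V G (twisted (untwisted n))" "is_gcell_base V G n"
    using base by (simp_all add: twisted_base)
  show "gstr (twisted (untwisted n)) g = gstr n g" if g: "g \<in> carrier G" for g
    using represents_left_unique[OF base g _ untwisted_represents[OF n g]]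
      twisted_represents[OF G_cell_untwisted[OF n] g] represents_cong[of "untwisted n" n] by simp
qed simp_all

lemma gmap_twisted:
  assumes m: "G_cell V G m" and n: "G_cell V G n"
  shows "gmap V (Gtw_equivariant V G) (twisted m) (twisted n) f \<longleftrightarrow> gmap V (G_equivariant V G) m n f"
  using twisted_equivariance[OF G_cellD(1)[OF m] G_cellD(1)[OF n] _ twisted_represents[OF m] twisted_represents[OF n]]
  by (auto simp: gmap_def Gtw_equivariant_def G_equivariant_def)

lemma twisted_gcomp:
  assumes m: "G_cell V G m" and n: "G_cell V G n" and c: "gtrg m = gsrc n"
  shows "gcomp V G (Gtw_comp V) (twisted m) (twisted n) = twisted (gcomp V G GH m n)"
proof (rule twisted_eqI)
  note M = G_cellD(1)[OF m] and N = G_cellD(1)[OF n]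
  have mn: "G_cell V G (gcomp V G GH m n)" by (rule gcomp_G_cell[OF m n c])
  show "is_gcell_base V G (gcomp V G (Gtw_comp V) (twisted m) (twisted n))"
    "is_gcell_base V G (twisted (gcomp V G GH m n))"
    using c by (auto intro!: gcomp_base twisted_base M N)
  show "gstr (gcomp V G (Gtw_comp V) (twisted m) (twisted n)) g = gstr (twisted (gcomp V G GH m n)) g"
    if g: "g \<in> carrier G" for g
  proof (rule represents_left_unique[OF G_cellD(1)[OF mn] g _ twisted_represents[OF mn g]])
    have "represents (twisted m) g (gstr (twisted m) g) (gstr m g)"
      "represents (twisted n) g (gstr (twisted n) g) (gstr n g)"
      using twisted_represents[OF m g] twisted_represents[OF n g]
        represents_cong[of "twisted m" m] represents_cong[of "twisted n" n] by simp_all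
    from twisted_composite[OF twisted_base(1)[OF M] twisted_base(1)[OF N] _ g this, of "Gtw_comp V"] c g
    show "represents (gcomp V G GH m n) g (gstr (gcomp V G (Gtw_comp V) (twisted m) (twisted n)) g) (gstr (gcomp V G GH m n) g)"
      by (simp add: represents_def)
  qed
qed simp_all

lemma twisted_gunit:
  assumes A: "is_gmon V G A"
  shows "gunit G (Gtw_unit V) A = twisted (gunit G GU A)"
proof (rule twisted_eqI)
  have u: "G_cell V G (gunit G GU A)" by (rule gunit_G_cell[OF A])
  show "is_gcell_base V G (gunit G (Gtw_unit V) A)" "is_gcell_base V G (twisted (gunit G GU A))"
    using A by (auto intro!: gunit_base twisted_base)
  show "gstr (gunit G (Gtw_unit V) A) g = gstr (twisted (gunit G GU A)) g" if g: "g \<in> carrier G" for g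
    using represents_left_unique[OF G_cellD(1)[OF u] g _ twisted_represents[OF u g]] twisted_unit[OF A g, of GU] g
    by simp
qed simp_all

interpretation GS: structured_bimodules V G "G_cell V G" "G_equivariant V G" GH GU
  by (rule G_structured)

text \<open>Every twisted 1-cell is \<open>twisted m\<close> for a 1-cell \<open>m\<close> of \<open>Mod(V)^G\<close>, and twisting is compatible
  with composites, units and the compatibility of maps; so each closure property is carried over
  from \<open>Mod(V)^G\<close>.\<close>
lemma Gtw_structured:
  "structured_bimodules V G (Gtw_cell V G) (Gtw_equivariant V G) (Gtw_comp V) (Gtw_unit V)"
proof (intro_locales, rule structured_bimodules_axioms.intro)
  have ex: "\<exists>m'. m = twisted m' \<and> G_cell V G m'" if "Gtw_cell V G m" for m
    using twisted_untwisted[OF that] G_cell_untwisted[OF that] by metis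
  have E: "Gtw_equivariant V G (twisted m) (twisted n) f"
    if "G_cell V G m" "G_cell V G n" "gmap V (G_equivariant V G) m n f" for m n f
    using gmap_twisted[OF that(1,2), THEN iffD2, OF that(3)] by (simp add: gmap_def)
  note [simp] = twisted_gcomp twisted_gunit gcomp_G_cell gunit_G_cell Gtw_cell_twisted gmap_twisted
  show "is_gcell_base V G m" if "Gtw_cell V G m" for m
    using that by (simp add: Gtw_cell_def)
  show "Gtw_cell V G (gcomp V G (Gtw_comp V) m n)" if "Gtw_cell V G m" "Gtw_cell V G n" "gtrg m = gsrc n" for m n
    using ex[OF that(1)] ex[OF that(2)] that(3) by auto
  show "Gtw_cell V G (gunit G (Gtw_unit V) A)" if "is_gmon V G A" for A using that by simp
  show "Gtw_equivariant V G m m (Ident V (bobj (gbim m)))" if "Gtw_cell V G m" for m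
    using ex[OF that] by (auto intro!: E simp: GS.gmap_ident)
  show "Gtw_equivariant V G m p (g \<cdot> f)"
    if a: "Gtw_cell V G m" "Gtw_cell V G n" "Gtw_cell V G p" "gmap V (Gtw_equivariant V G) m n f"
      "gmap V (Gtw_equivariant V G) n p g" for m n p f g
  proof -
    obtain m' n' p' where e: "m = twisted m'" "G_cell V G m'" "n = twisted n'" "G_cell V G n'"
      "p = twisted p'" "G_cell V G p'"
      using ex[OF a(1)] ex[OF a(2)] ex[OF a(3)] by blast
    have "gmap V (G_equivariant V G) m' p' (g \<cdot> f)"
      by (rule GS.gmap_comp[of m' n' p']) (use e a(4,5) in simp_all)
    then show ?thesis using E e by simp
  qed
  show "Gtw_equivariant V G n m g"
    if a: "Gtw_cell V G m" "Gtw_cell V G n" "gmap V (Gtw_equivariant V G) m n f" "inverse_pair V f g" for m n f g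
  proof -
    obtain m' n' where e: "m = twisted m'" "G_cell V G m'" "n = twisted n'" "G_cell V G n'"
      using ex[OF a(1)] ex[OF a(2)] by blast
    have "gmap V (G_equivariant V G) n' m' g"
      by (rule GS.gmap_inverse[of m' n' f]) (use e a(3,4) in simp_all)
    then show ?thesis using E e by simp
  qed
  show "Gtw_equivariant V G (gcomp V G (Gtw_comp V) m n) (gcomp V G (Gtw_comp V) m' n')
      (rel_map V (gbim m) (gbim n) (gbim m') (gbim n') f g)"
    if a: "Gtw_cell V G m" "Gtw_cell V G n" "Gtw_cell V G m'" "Gtw_cell V G n'" "gtrg m = gsrc n"
      "gmap V (Gtw_equivariant V G) m m' f" "gmap V (Gtw_equivariant V G) n n' g" for m n m' n' f g
  proof -
    have "gtrg m' = gsrc n'" using a by (simp add: gmap_def)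
    then show ?thesis
      using ex[OF a(1)] ex[OF a(2)] ex[OF a(3)] ex[OF a(4)] a(5-7) by (auto intro!: E GS.gmap_hcomp)
  qed
  show "Gtw_equivariant V G (gcomp V G (Gtw_comp V) (gcomp V G (Gtw_comp V) m n) p)
        (gcomp V G (Gtw_comp V) m (gcomp V G (Gtw_comp V) n p)) (rel_assoc V (gbim m) (gbim n) (gbim p))"
    if "Gtw_cell V G m" "Gtw_cell V G n" "Gtw_cell V G p" "gtrg m = gsrc n" "gtrg n = gsrc p" for m n p
    using ex[OF that(1)] ex[OF that(2)] ex[OF that(3)] that(4,5) by (auto intro!: E GS.gmap_assoc)
  show "Gtw_equivariant V G (gcomp V G (Gtw_comp V) (gunit G (Gtw_unit V) (gsrc m)) m) m (rel_lunit V (gbim m))"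
    "Gtw_equivariant V G (gcomp V G (Gtw_comp V) m (gunit G (Gtw_unit V) (gtrg m))) m (rel_runit V (gbim m))"
    if "Gtw_cell V G m" for m
    using ex[OF that] by (auto intro!: E GS.gmap_lunit GS.gmap_runit)
qed

interpretation TS: structured_bimodules V G "Gtw_cell V G" "Gtw_equivariant V G" "Gtw_comp V" "Gtw_unit V"
  by (rule Gtw_structured)

definition twisted2 where
  "twisted2 t = \<lparr>tdom = twisted (tdom t), tcod = twisted (tcod t), tmap = tmap t\<rparr>"

definition untwisted2 where
  "untwisted2 t = \<lparr>tdom = untwisted (tdom t), tcod = untwisted (tcod t), tmap = tmap t\<rparr>"

lemma gmap_untwisted:
  assumes "Gtw_cell V G m" "Gtw_cell V G n"
  shows "gmap V (G_equivariant V G) (untwisted m) (untwisted n) f \<longleftrightarrow> gmap V (Gtw_equivariant V G) m n f"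
  using gmap_twisted[OF G_cell_untwisted G_cell_untwisted, OF assms] twisted_untwisted assms by simp

lemma twisting_strict_isomorphism:
  "strict_isomorphism GS.B TS.B twisted twisted2 untwisted untwisted2"
proof (rule strict_isomorphism.intro[OF GS.bicategory TS.bicategory], rule strict_isomorphism_axioms.intro)
  note [simp] = equivariant_bicategory_simps equivariant_cell1 equivariant_cell2 twisted2_def untwisted2_def
    twisted_gcomp twisted_gunit Gtw_cell_twisted G_cell_untwisted gmap_twisted gmap_untwisted
    untwisted_twisted twisted_untwisted gunit_G_cell gcomp_G_cell
  show "cells TS.B = cells GS.B" by simp
  show "is_functor (vert GS.B) (vert TS.B) twisted twisted2"
    unfolding is_functor_def using GS.vertical_category TS.vertical_category by simp
  show "is_functor (vert TS.B) (vert GS.B) untwisted untwisted2"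
    unfolding is_functor_def using GS.vertical_category TS.vertical_category by simp
  show "twisted2 (t \<star>\<^bsub>GS.B\<^esub> r) = twisted2 t \<star>\<^bsub>TS.B\<^esub> twisted2 r"
    if "M \<in> cell1 GS.B X Y" "N \<in> cell1 GS.B Y Z" "t \<in> cell2 GS.B M M'" "r \<in> cell2 GS.B N N'" for M N M' N' t r X Y Z
  proof -
    have "gtrg M' = gsrc N'" using that by (simp add: gmap_def)
    then show ?thesis using that by auto
  qed
qed (auto simp: equivariant_bicategory_simps equivariant_cell1 twisted2_def untwisted2_def
    twisted_gcomp twisted_gunit untwisted_twisted twisted_untwisted gunit_G_cell gcomp_G_cell)

lemma Mod_G_eq: "Mod_G V G = GS.B" by (simp add: Mod_G_def)
lemma Mod_Gtw_eq: "Mod_Gtw V G = TS.B" by (simp add: Mod_Gtw_def)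

lemma Mod_biequivalence: "\<exists>F. biequivalence (Mod_G V G) (Mod_Gtw V G) F"
  unfolding Mod_G_eq Mod_Gtw_eq using strict_isomorphism.biequivalence[OF twisting_strict_isomorphism] by blast

end

theorem corollary3p25:
  fixes V :: "('o, 'a) monoidal_category"
    and G :: "('g, 'm) monoid_scheme"
  assumes "symmetric_monoidal_category V"
    and "closed_monoidal V"
    and "cocomplete TYPE('i::infinite) V"
    and "has_relative_tensors V"
    and "group G"
  shows "\<exists>F. biequivalence (Mod_G V G) (Mod_Gtw V G) F"
proof -
  interpret group_bimodule_setting V G
    by (intro group_bimodule_setting.intro group_bimodule_setting_axioms.intro bimodule_setting.intro
        bimodule_setting_axioms.intro closed_symmetric_monoidal_category.intro
        closed_symmetric_monoidal_category_axioms.intro assms)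
  show ?thesis by (rule Mod_biequivalence)
qed

end
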